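(* Let $f:S^n\to S^m$ be an LOMSE of $(n,p,k)$-type with $(n,p)=(3,2)$, $k\ge4$ or $(n,p)=(5,4)$, $k\ge6$. Then the associated Lawson-Osserman cone $C_{f,\theta}$ is non-minimizing, i.e. it is not area-minimizing.
   Context: $S^d\subset\mathbb R^{d+1}$ is the unit sphere with canonical metric $g_d$. Singular values of $(f_* )_x:(T_xS^n,g_n)\to(T_{f(x)}S^m,g_m)$ are counted with multiplicity. For smooth $f:S^n\to S^m$ and $\theta\in(0,\pi/2)$ put $M_{f,\theta}:=\{(\cos\theta\cdot x,\sin\theta\cdot f(x)):x\in S^n\}\subset S^{n+m+1}$. The map $f$ is a Lawson-Osserman map (LOM) if $M_{f,\theta}$ is a minimal submanifold of $S^{n+m+1}$ for some $\theta\in(0,\pi/2)$; then the cone $C_{f,\theta}\subset\mathbb R^{n+m+2}$ over $M_{f,\theta}$ is the associated Lawson-Osserman cone (LOC). An LOMSE is an LOM that is not totally geodesic (as a map $(S^n,g_n)\to(S^m,g_m)$) and such that, for each $x$, all nonzero singular values of $(f_* )_x$ are equal. It is of $(n,p,k)$-type if its nonzero singular value $\lambda$ is constant with constant multiplicity $p$ and all components of $f$ in $\mathbb R^{m+1}$ are spherical harmonics of degree $k\ge2$ (every LOMSE is of such a type); then the angle $\theta$ is unique and equals $\arccos\sqrt{\frac{1-p/n}{1-p/(k(k+n-1))}}$. A cone $C$ is area-minimizing if, for every (equivalently, one) radius $R>0$, its truncation $C\cap \mathbb D(R)$ by the ball of radius $R$ centered at the origin has least volume among all integral currents (in particular, all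 submanifolds) with the same boundary. *)

theory Defs
  imports "HOL-Analysis.Analysis"
begin

section \<open>Smooth maps\<close>

primrec Ck_on :: "nat \<Rightarrow> 'a::euclidean_space set \<Rightarrow> ('a \<Rightarrow> 'b::real_normed_vector) \<Rightarrow> bool" where
  "Ck_on 0 S f \<longleftrightarrow> continuous_on S f"
| "Ck_on (Suc k) S f \<longleftrightarrow>
     f differentiable_on S \<and> (\<forall>v. Ck_on k S (\<lambda>x. frechet_derivative f (at x) v))"

text \<open>Only used for open sets.\<close>

definition smooth_on :: "'a::euclidean_space set \<Rightarrow> ('a \<Rightarrow> 'b::real_normed_vector) \<Rightarrow> bool" where
  "smooth_on S f \<longleftrightarrow> (\<forall>k. Ck_on k S f)"

text \<open>
  The sphere \<open>S\<^sup>n\<close> is \<open>sphere 0 1\<close> in a Euclidean space of dimension \<open>n + 1\<close>.  Away from the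
  origin \<open>sgn x = x /\<^sub>R norm x\<close> is the radial retraction onto the sphere.  It is a smooth
  submersion and its derivative at a point \<open>x\<close> of the sphere is the orthogonal projection onto
  the tangent space at \<open>x\<close>.  Hence a map \<open>f\<close> on the sphere is smooth iff its extension
  \<open>f \<circ> sgn\<close> is smooth off the origin, and the differential of \<open>f\<close> at \<open>x\<close> is the derivative of
  that extension restricted to the tangent space.
\<close>

definition smooth_on_sphere :: "('a::euclidean_space \<Rightarrow> 'b::real_normed_vector) \<Rightarrow> bool" where
  "smooth_on_sphere f \<longleftrightarrow> smooth_on (- {0}) (\<lambda>x. f (sgn x))"

definition sphere_tangent :: "'a::euclidean_space \<Rightarrow> 'a set" where
  "sphere_tangent x = {v. v \<bullet> x = 0}"

definition sphere_deriv :: "('a::euclidean_space \<Rightarrow> 'b::real_normed_vector) \<Rightarrow> 'a \<Rightarrow> 'a \<Rightarrow> 'b" where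
  "sphere_deriv f x = frechet_derivative (\<lambda>y. f (sgn y)) (at x)"

definition acceleration :: "(real \<Rightarrow> 'a::real_normed_vector) \<Rightarrow> real \<Rightarrow> 'a" where
  "acceleration c t = vector_derivative (\<lambda>s. vector_derivative c (at s)) (at t)"


section \<open>Singular values, totally geodesic maps, spherical harmonics\<close>

text \<open>
  With \<open>A\<close> the differential at \<open>x\<close>, this is the eigenspace of \<open>A\<^sup>* A\<close> on the tangent space
  for the eigenvalue \<open>\<sigma>\<^sup>2\<close>: the equation \<open>A\<^sup>* A v = \<sigma>\<^sup>2 v\<close> tested against all tangent vectors.
\<close>

definition singular_space ::
    "('a::euclidean_space \<Rightarrow> 'b::euclidean_space) \<Rightarrow> 'a \<Rightarrow> real \<Rightarrow> 'a set" where
  "singular_space f x \<sigma> = {v \<in> sphere_tangent x. \<forall>w \<in> sphere_tangent x.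
      sphere_deriv f x v \<bullet> sphere_deriv f x w = \<sigma>\<^sup>2 * (v \<bullet> w)}"

definition singular_mult ::
    "('a::euclidean_space \<Rightarrow> 'b::euclidean_space) \<Rightarrow> 'a \<Rightarrow> real \<Rightarrow> nat" where
  "singular_mult f x \<sigma> = dim (singular_space f x \<sigma>)"

definition singular_value ::
    "('a::euclidean_space \<Rightarrow> 'b::euclidean_space) \<Rightarrow> 'a \<Rightarrow> real \<Rightarrow> bool" where
  "singular_value f x \<sigma> \<longleftrightarrow> \<sigma> \<ge> 0 \<and> singular_mult f x \<sigma> > 0"

text \<open>
  Second fundamental form \<open>\<nabla>df(v, v)\<close> of a map between unit spheres, for a unit tangent vector
  \<open>v\<close> at \<open>x\<close>: the covariant acceleration in the target sphere of the image of the unit speed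
  great circle through \<open>x\<close> with velocity \<open>v\<close>.  Since \<open>\<nabla>df\<close> is symmetric, these values
  determine it.
\<close>

definition map_second_fundamental_form ::
    "('a::euclidean_space \<Rightarrow> 'b::euclidean_space) \<Rightarrow> 'a \<Rightarrow> 'a \<Rightarrow> 'b" where
  "map_second_fundamental_form f x v =
    (let a = acceleration (\<lambda>t. f (cos t *\<^sub>R x + sin t *\<^sub>R v)) 0 in a - (a \<bullet> f x) *\<^sub>R f x)"

definition totally_geodesic :: "('a::euclidean_space \<Rightarrow> 'b::euclidean_space) \<Rightarrow> bool" where
  "totally_geodesic f \<longleftrightarrow> (\<forall>x \<in> sphere 0 1. \<forall>v \<in> sphere_tangent x.
      norm v = 1 \<longrightarrow> map_second_fundamental_form f x v = 0)"

definition laplacian :: "('a::euclidean_space \<Rightarrow> real) \<Rightarrow> 'a \<Rightarrow> real" where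
  "laplacian P x =
    (\<Sum>b\<in>Basis. frechet_derivative (\<lambda>y. frechet_derivative P (at y) b) (at x) b)"

definition spherical_harmonic :: "nat \<Rightarrow> ('a::euclidean_space \<Rightarrow> real) \<Rightarrow> bool" where
  "spherical_harmonic k h \<longleftrightarrow> (\<exists>P. real_polynomial_function P \<and>
      (\<forall>t x. P (t *\<^sub>R x) = t ^ k * P x) \<and> (\<forall>x. laplacian P x = 0) \<and>
      (\<forall>x \<in> sphere 0 1. h x = P x))"


section \<open>Minimal submanifolds of the unit sphere\<close>

definition embedded_submanifold :: "nat \<Rightarrow> 'c::euclidean_space set \<Rightarrow> bool" where
  "embedded_submanifold n M \<longleftrightarrow> (\<forall>p \<in> M. \<exists>U V (h :: 'c \<Rightarrow> 'c) (g :: 'c \<Rightarrow> 'c) W.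
      open U \<and> p \<in> U \<and> open V \<and> smooth_on U h \<and> smooth_on V g \<and> h ` U = V \<and> g ` V = U \<and>
      (\<forall>x \<in> U. g (h x) = x) \<and> (\<forall>y \<in> V. h (g y) = y) \<and>
      subspace W \<and> dim W = n \<and> h ` (U \<inter> M) = V \<inter> W)"

definition curve_in :: "'c::euclidean_space set \<Rightarrow> 'c \<Rightarrow> 'c \<Rightarrow> (real \<Rightarrow> 'c) \<Rightarrow> bool" where
  "curve_in M p v c \<longleftrightarrow> (\<exists>\<epsilon>>0. smooth_on {-\<epsilon><..<\<epsilon>} c \<and> c ` {-\<epsilon><..<\<epsilon>} \<subseteq> M) \<and>
      c 0 = p \<and> vector_derivative c (at 0) = v"

definition tangent_space :: "'c::euclidean_space set \<Rightarrow> 'c \<Rightarrow> 'c set" where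
  "tangent_space M p = {v. \<exists>c. curve_in M p v c}"

text \<open>The normal space inside the unit sphere, whose tangent space at \<open>p\<close> is \<open>p\<close>'s complement.\<close>

definition sphere_normal_space :: "'c::euclidean_space set \<Rightarrow> 'c \<Rightarrow> 'c set" where
  "sphere_normal_space M p = {\<nu>. \<nu> \<bullet> p = 0 \<and> (\<forall>v \<in> tangent_space M p. \<nu> \<bullet> v = 0)}"

definition orthonormal :: "'c::real_inner list \<Rightarrow> bool" where
  "orthonormal vs \<longleftrightarrow>
    (\<forall>i<length vs. \<forall>j<length vs. vs ! i \<bullet> vs ! j = (if i = j then 1 else 0))"

text \<open>
  If \<open>c\<close> is a curve in \<open>M\<close> through \<open>p\<close> with velocity \<open>v\<close>, and \<open>\<nu>\<close> is normal to \<open>M\<close> in the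
  sphere, then \<open>acceleration c 0 \<bullet> \<nu>\<close> is the \<open>\<nu>\<close>-component of the second fundamental form
  \<open>II(v, v)\<close> of \<open>M\<close> in the sphere; it does not depend on \<open>c\<close>.  So the sum below is the
  \<open>\<nu>\<close>-component of the mean curvature vector (the trace of \<open>II\<close>), and the condition is that
  the mean curvature vector vanishes.
\<close>

definition minimal_in_sphere :: "nat \<Rightarrow> 'c::euclidean_space set \<Rightarrow> bool" where
  "minimal_in_sphere n M \<longleftrightarrow> M \<subseteq> sphere 0 1 \<and> embedded_submanifold n M \<and>
    (\<forall>p \<in> M. \<forall>es cs \<nu>.
        length es = n \<and> orthonormal es \<and> set es \<subseteq> tangent_space M p \<and>
        (\<forall>i<n. curve_in M p (es ! i) (cs i)) \<and> \<nu> \<in> sphere_normal_space M p \<longrightarrow>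
        (\<Sum>i<n. acceleration (cs i) 0 \<bullet> \<nu>) = 0)"


section \<open>Lawson-Osserman maps and cones\<close>

definition LO_submanifold ::
    "('a::euclidean_space \<Rightarrow> 'b::euclidean_space) \<Rightarrow> real \<Rightarrow> ('a \<times> 'b) set" where
  "LO_submanifold f \<theta> = (\<lambda>x. (cos \<theta> *\<^sub>R x, sin \<theta> *\<^sub>R f x)) ` sphere 0 1"

definition cone_over :: "'c::real_vector set \<Rightarrow> 'c set" where
  "cone_over M = {t *\<^sub>R y | t y. t \<ge> 0 \<and> y \<in> M}"

definition LO_cone ::
    "('a::euclidean_space \<Rightarrow> 'b::euclidean_space) \<Rightarrow> real \<Rightarrow> ('a \<times> 'b) set" where
  "LO_cone f \<theta> = cone_over (LO_submanifold f \<theta>)"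

definition LO_angle ::
    "('a::euclidean_space \<Rightarrow> 'b::euclidean_space) \<Rightarrow> real \<Rightarrow> bool" where
  "LO_angle f \<theta> \<longleftrightarrow> 0 < \<theta> \<and> \<theta> < pi / 2 \<and> minimal_in_sphere (DIM('a) - 1) (LO_submanifold f \<theta>)"

definition LOM :: "('a::euclidean_space \<Rightarrow> 'b::euclidean_space) \<Rightarrow> bool" where
  "LOM f \<longleftrightarrow> f ` sphere 0 1 \<subseteq> sphere 0 1 \<and> smooth_on_sphere f \<and> (\<exists>\<theta>. LO_angle f \<theta>)"

definition LOMSE :: "('a::euclidean_space \<Rightarrow> 'b::euclidean_space) \<Rightarrow> bool" where
  "LOMSE f \<longleftrightarrow> LOM f \<and> \<not> totally_geodesic f \<and>
    (\<forall>x \<in> sphere 0 1. \<forall>\<sigma> \<tau>. singular_value f x \<sigma> \<and> \<sigma> \<noteq> 0 \<and> singular_value f x \<tau> \<and> \<tau> \<noteq> 0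
        \<longrightarrow> \<sigma> = \<tau>)"

definition LOMSE_type ::
    "nat \<Rightarrow> nat \<Rightarrow> nat \<Rightarrow> ('a::euclidean_space \<Rightarrow> 'b::euclidean_space) \<Rightarrow> bool" where
  "LOMSE_type n p k f \<longleftrightarrow> DIM('a) = n + 1 \<and> LOMSE f \<and>
    (\<exists>\<mu>>0. \<forall>x \<in> sphere 0 1. singular_mult f x \<mu> = p \<and>
        (\<forall>\<sigma>. singular_value f x \<sigma> \<and> \<sigma> \<noteq> 0 \<longrightarrow> \<sigma> = \<mu>)) \<and>
    k \<ge> 2 \<and> (\<forall>b \<in> Basis. spherical_harmonic k (\<lambda>x. f x \<bullet> b))"

text \<open>
  The homogeneous parametrization of the cone by \<open>\<real>\<^bsup>n+1\<^esup>\<close> (in polar coordinates,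
  \<open>(r, x) \<mapsto> r (cos \<theta> x, sin \<theta> f(x))\<close>).  It is norm preserving and a bijection onto the cone,
  see below, and it is a smooth embedding off the origin whenever \<open>f\<close> is smooth.
\<close>

definition LO_cone_param ::
    "('a::euclidean_space \<Rightarrow> 'b::euclidean_space) \<Rightarrow> real \<Rightarrow> 'a \<Rightarrow> 'a \<times> 'b" where
  "LO_cone_param f \<theta> x = norm x *\<^sub>R (cos \<theta> *\<^sub>R sgn x, sin \<theta> *\<^sub>R f (sgn x))"

lemma norm_LO_cone_param:
  assumes "f ` sphere 0 1 \<subseteq> sphere 0 1"
  shows "norm (LO_cone_param f \<theta> x) = norm x"
proof (cases "x = 0")
  case False
  then have "norm (sgn x) = 1" by (simp add: norm_sgn)
  moreover from this have "norm (f (sgn x)) = 1" using assms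
    by (metis image_subset_iff mem_sphere_0)
  moreover have "(norm x * cos \<theta>)\<^sup>2 + (norm x * sin \<theta>)\<^sup>2 = (norm x)\<^sup>2"
    by (simp add: power_mult_distrib flip: distrib_left)
  ultimately show ?thesis by (simp add: LO_cone_param_def norm_Pair)
qed (simp add: LO_cone_param_def)

lemma bij_betw_LO_cone_param:
  fixes f :: "'a::euclidean_space \<Rightarrow> 'b::euclidean_space"
  assumes "0 < \<theta>" "\<theta> < pi / 2"
  shows "bij_betw (LO_cone_param f \<theta>) UNIV (LO_cone f \<theta>)"
proof -
  have c: "cos \<theta> > 0" using assms by (intro cos_gt_zero) auto
  have n: "norm x *\<^sub>R sgn x = x" for x :: 'a by (cases "x = 0") (auto simp: sgn_div_norm)
  have "fst (LO_cone_param f \<theta> x) = cos \<theta> *\<^sub>R x" for x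
    using arg_cong[OF n[of x], of "\<lambda>y. cos \<theta> *\<^sub>R y"]
    by (simp add: LO_cone_param_def mult.commute)
  then have "inj (\<lambda>x. fst (LO_cone_param f \<theta> x))"
    using c by (auto intro: injI)
  then have "inj (LO_cone_param f \<theta>)"
    by (auto simp: inj_def)
  moreover have "range (LO_cone_param f \<theta>) = LO_cone f \<theta>"
  proof (intro equalityI subsetI)
    fix y assume "y \<in> range (LO_cone_param f \<theta>)"
    then obtain x where y: "y = LO_cone_param f \<theta> x" by auto
    obtain z :: 'a where z: "norm z = 1" using vector_choose_size[of 1] by auto
    show "y \<in> LO_cone f \<theta>"
    proof (cases "x = 0")
      case True
      then have "y = 0 *\<^sub>R (cos \<theta> *\<^sub>R z, sin \<theta> *\<^sub>R f z)" by (simp add: y LO_cone_param_def)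
      moreover have "(cos \<theta> *\<^sub>R z, sin \<theta> *\<^sub>R f z) \<in> LO_submanifold f \<theta>"
        using z by (auto simp: LO_submanifold_def)
      ultimately show ?thesis unfolding LO_cone_def cone_over_def by blast
    next
      case False
      then have "sgn x \<in> sphere 0 1" by (simp add: norm_sgn)
      then show ?thesis unfolding y LO_cone_def cone_over_def LO_submanifold_def LO_cone_param_def
        by (blast intro: norm_ge_zero)
    qed
  next
    fix y assume "y \<in> LO_cone f \<theta>"
    then obtain t x where t: "t \<ge> 0" "norm x = 1"
      and y: "y = t *\<^sub>R (cos \<theta> *\<^sub>R x, sin \<theta> *\<^sub>R f x)"
      by (auto simp: LO_cone_def cone_over_def LO_submanifold_def)
    show "y \<in> range (LO_cone_param f \<theta>)"
    proof (cases "t = 0")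
      case True
      then have "y = LO_cone_param f \<theta> 0" by (simp add: y LO_cone_param_def)
      then show ?thesis by blast
    next
      case False
      with t have "sgn (t *\<^sub>R x) = x" "norm (t *\<^sub>R x) = t" by (auto simp: sgn_div_norm)
      then have "y = LO_cone_param f \<theta> (t *\<^sub>R x)" by (simp add: y LO_cone_param_def)
      then show ?thesis by blast
    qed
  qed
  ultimately show ?thesis by (simp add: bij_betw_def)
qed


section \<open>Differential forms and currents\<close>

text \<open>
  A differential form of degree \<open>k\<close> takes a point and a list of \<open>k\<close> vectors.  Test forms are
  normalised to be zero on lists of any other length.
\<close>

type_synonym 'c form = "'c \<Rightarrow> 'c list \<Rightarrow> real"

definition alternating_form :: "nat \<Rightarrow> ('c::euclidean_space list \<Rightarrow> real) \<Rightarrow> bool" where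
  "alternating_form k A \<longleftrightarrow>
    (\<forall>vs. length vs \<noteq> k \<longrightarrow> A vs = 0) \<and>
    (\<forall>vs i. length vs = k \<and> i < k \<longrightarrow> linear (\<lambda>v. A (vs[i := v]))) \<and>
    (\<forall>vs i j. length vs = k \<and> i < j \<and> j < k \<and> vs ! i = vs ! j \<longrightarrow> A vs = 0)"

definition test_forms :: "nat \<Rightarrow> 'c::euclidean_space form set" where
  "test_forms k = {\<omega>. (\<forall>x. alternating_form k (\<omega> x)) \<and>
      (\<forall>vs. smooth_on UNIV (\<lambda>x. \<omega> x vs)) \<and>
      (\<exists>K. compact K \<and> (\<forall>x vs. x \<notin> K \<longrightarrow> \<omega> x vs = 0))}"

definition ext_deriv :: "'c::euclidean_space form \<Rightarrow> 'c form" where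
  "ext_deriv \<omega> x vs = (\<Sum>i<length vs.
      (-1) ^ i * frechet_derivative (\<lambda>y. \<omega> y (take i vs @ drop (Suc i) vs)) (at x) (vs ! i))"

text \<open>
  A \<open>k\<close>-current is a functional on forms of which only the values on \<open>test_forms k\<close> matter.
\<close>

type_synonym 'c current = "'c form \<Rightarrow> real"

definition boundary :: "'c::euclidean_space current \<Rightarrow> 'c current" where
  "boundary T = (\<lambda>\<omega>. T (ext_deriv \<omega>))"

definition eq_current :: "nat \<Rightarrow> 'c::euclidean_space current \<Rightarrow> 'c current \<Rightarrow> bool" where
  "eq_current k S T \<longleftrightarrow> (\<forall>\<omega> \<in> test_forms k. S \<omega> = T \<omega>)"

definition linear_current :: "nat \<Rightarrow> 'c::euclidean_space current \<Rightarrow> bool" where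
  "linear_current k T \<longleftrightarrow> (\<forall>\<omega> \<in> test_forms k. \<forall>\<eta> \<in> test_forms k. \<forall>a b.
      T (\<lambda>x vs. a * \<omega> x vs + b * \<eta> x vs) = a * T \<omega> + b * T \<eta>)"

text \<open>The comass of \<open>A\<close> is at most one: unit simple \<open>k\<close>-vectors come from orthonormal lists.\<close>

definition comass_le_one :: "nat \<Rightarrow> ('c::euclidean_space list \<Rightarrow> real) \<Rightarrow> bool" where
  "comass_le_one k A \<longleftrightarrow> (\<forall>vs. length vs = k \<and> orthonormal vs \<longrightarrow> \<bar>A vs\<bar> \<le> 1)"

definition mass :: "nat \<Rightarrow> 'c::euclidean_space current \<Rightarrow> ereal" where
  "mass k T = (SUP \<omega> \<in> {\<omega> \<in> test_forms k. \<forall>x. comass_le_one k (\<omega> x)}. ereal (T \<omega>))"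


section \<open>Integral currents\<close>

text \<open>
  The standard cube is \<open>[0,1]\<^sup>k\<close>, with coordinates indexed by \<open>{..<k}\<close>.  The open cube is used
  for integration because the partial derivatives of a map given on the closed cube are
  determined only in the interior; by Rademacher's theorem they exist almost everywhere.
\<close>

definition lipschitz_cube :: "nat \<Rightarrow> 'c::euclidean_space set \<Rightarrow> ((nat \<Rightarrow> real) \<Rightarrow> 'c) \<Rightarrow> bool" where
  "lipschitz_cube k K \<sigma> \<longleftrightarrow> \<sigma> ` ({..<k} \<rightarrow>\<^sub>E {0..1}) \<subseteq> K \<and>
    (\<exists>B. \<forall>s \<in> {..<k} \<rightarrow>\<^sub>E {0..1}. \<forall>t \<in> {..<k} \<rightarrow>\<^sub>E {0..1}.
        norm (\<sigma> s - \<sigma> t) \<le> B * (\<Sum>i<k. \<bar>s i - t i\<bar>))"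

definition cube_current :: "nat \<Rightarrow> ((nat \<Rightarrow> real) \<Rightarrow> 'c::euclidean_space) \<Rightarrow> 'c current" where
  "cube_current k \<sigma> \<omega> =
    (LINT t:({..<k} \<rightarrow>\<^sub>E {0<..<1})|(Pi\<^sub>M {..<k} (\<lambda>_. lborel)).
       \<omega> (\<sigma> t) (map (\<lambda>i. vector_derivative (\<lambda>s. \<sigma> (t(i := s))) (at (t i))) [0..<k]))"

text \<open>Integer combinations of Lipschitz cubes.\<close>

definition chain_current ::
    "nat \<Rightarrow> (int \<times> ((nat \<Rightarrow> real) \<Rightarrow> 'c::euclidean_space)) list \<Rightarrow> 'c current" where
  "chain_current k L \<omega> = (\<Sum>(a, \<sigma>) \<leftarrow> L. of_int a * cube_current k \<sigma> \<omega>)"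

text \<open>
  Federer's definition: a rectifiable current (integer multiplicities, compact support) is a
  limit in mass of integral Lipschitz chains lying in a fixed compact set, and an integral
  current is a rectifiable current with rectifiable boundary.  Cubes generate the same group of
  Lipschitz chains as simplices, since a simplex is a Lipschitz image of degree one of a cube.
\<close>

definition rectifiable_current :: "nat \<Rightarrow> 'c::euclidean_space current \<Rightarrow> bool" where
  "rectifiable_current k T \<longleftrightarrow> linear_current k T \<and>
    (\<exists>K. compact K \<and> (\<forall>\<epsilon>>0. \<exists>L. (\<forall>(a, \<sigma>) \<in> set L. lipschitz_cube k K \<sigma>) \<and>
        mass k (\<lambda>\<omega>. T \<omega> - chain_current k L \<omega>) < ereal \<epsilon>))"

fun integral_current :: "nat \<Rightarrow> 'c::euclidean_space current \<Rightarrow> bool" where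
  "integral_current 0 T \<longleftrightarrow> rectifiable_current 0 T"
| "integral_current (Suc k) T \<longleftrightarrow>
     rectifiable_current (Suc k) T \<and> rectifiable_current k (boundary T)"


section \<open>Area-minimizing cones\<close>

text \<open>The choice of an ordering orients the space; the other orientation changes currents by sign.\<close>

definition ordered_basis :: "'a::euclidean_space list" where
  "ordered_basis = (SOME bs. distinct bs \<and> set bs = Basis)"

text \<open>Integration over the piece of surface parametrized by \<open>\<phi>\<close> on \<open>D\<close>, with multiplicity one.\<close>

definition param_current ::
    "('a::euclidean_space \<Rightarrow> 'c::euclidean_space) \<Rightarrow> 'a set \<Rightarrow> 'c current" where
  "param_current \<phi> D \<omega> =
    (LINT x:D|lborel. \<omega> (\<phi> x) (map (frechet_derivative \<phi> (at x)) ordered_basis))"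

text \<open>
  The argument is an injective homogeneous parametrization of a cone by \<open>\<real>\<^bsup>d\<^esup>\<close> that is a smooth
  embedding off the origin.  As \<open>\<real>\<^bsup>d\<^esup>\<close> without the origin is connected for \<open>d \<ge> 2\<close>, two such
  parametrizations give the same truncated cone up to sign, so the notion depends only on the
  cone.  The mass of the truncated cone is its volume.
\<close>

definition truncated_cone ::
    "('a::euclidean_space \<Rightarrow> 'c::euclidean_space) \<Rightarrow> real \<Rightarrow> 'c current" where
  "truncated_cone \<phi> R = param_current \<phi> {x. \<phi> x \<in> cball 0 R}"

definition area_minimizing_cone :: "('a::euclidean_space \<Rightarrow> 'c::euclidean_space) \<Rightarrow> bool" where
  "area_minimizing_cone \<phi> \<longleftrightarrow> (\<forall>R>0. \<forall>S.
      integral_current (DIM('a)) S \<and>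
      eq_current (DIM('a) - 1) (boundary S) (boundary (truncated_cone \<phi> R)) \<longrightarrow>
      mass (DIM('a)) (truncated_cone \<phi> R) \<le> mass (DIM('a)) S)"

end

theory Submission imports Defs begin

text \<open>
  Writing the Laplacian of \<open>\<bar>f\<bar>\<^sup>2 = 1\<close> for the harmonic components of \<open>f\<close> in two ways gives
  \<open>p \<mu>\<^sup>2 = k (k + n - 1)\<close> for the nonzero singular value \<open>\<mu>\<close>. The volume of an equivariant surface
  \<open>(r, x) \<mapsto> (A(r) x, B(r) f(x))\<close> is then a weighted length of the profile curve \<open>(A, B)\<close>,
  and the cone is the ray at angle \<open>\<theta>\<close>. Either this ray is not critical for the angular weight
  \<open>W\<close>, or \<open>-W''/W\<close> exceeds the Hardy constant \<open>((n + 1)/2)\<^sup>2\<close>; in both cases a compactly supported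
  perturbation of the profile is strictly shorter. The perturbed surface is realised as a
  single smooth cube, which by Stokes has the same boundary as the truncated cone, and the mass of the
  cone is bounded below by a form that calibrates it to first order.
\<close>

section \<open>Calculus of smooth maps\<close>

text \<open>Up to a constant, the surface with angle \<phi>(r) has volume equal to the integral of
  r^n sqrt(1 + (r \<phi>')^2) W(\<phi>). For \<phi> = \<theta> + \<epsilon> u the second variation
  is the integral of r^n (W'' u^2 + W (r u')^2), and ((n+1)/2)^2 is the infimum of the quotient of
  the integrals of r^n (r u')^2 and r^n u^2: this is where Hardy enters. At a critical angle the
  comparison comes down to \<mu>^2 > 9/2 for (3,2) and \<mu>^2 > 25/2 for (5,4), and the formula for
  \<mu> turns the bounds on k into \<mu>^2 at least 12 and 15. The obstacle is the vertex: the
  surfaces are not smooth there, while Stokes is applied to smooth maps of a full cube. Hence the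
  radius is reparametrised: it is 0 near the origin and constant R outside a ball inside the cube.
  The rest of the cube collapses onto the link, where it has no volume, and the faces see only the
  link, so all these cubes have the same boundary. The truncated cone is a weak limit of such cubes,
  which yields its boundary as well.\<close>

lemma Ck_on_subset: "Ck_on k S f \<Longrightarrow> T \<subseteq> S \<Longrightarrow> Ck_on k T f"
  by (induction k arbitrary: f) (auto intro: continuous_on_subset differentiable_on_subset)

lemma Ck_on_cong:
  assumes "open S" "\<And>x. x \<in> S \<Longrightarrow> f x = g x" "Ck_on k S f"
  shows "Ck_on k S g"
  using assms(2,3)
proof (induction k arbitrary: f g)
  case 0
  then show ?case by (auto cong: continuous_on_cong)
next
  case (Suc k)
  have d: "f differentiable (at x)" if "x \<in> S" for x
    using Suc.prems(2) that assms(1) by (auto simp: differentiable_on_eq_differentiable_at)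
  have e: "frechet_derivative g (at x) = frechet_derivative f (at x)" if "x \<in> S" for x
    using frechet_derivative_transform_within_open[OF d[OF that] assms(1) that] Suc.prems(1) by auto
  have "g differentiable_on S"
    using Suc.prems(1,2) by (auto simp: differentiable_on_def intro: differentiable_transform_within[where d=1])
  moreover have "Ck_on k S (\<lambda>x. frechet_derivative g (at x) v)" for v
    by (rule Suc.IH[of "\<lambda>x. frechet_derivative f (at x) v"]) (use e Suc.prems in auto)
  ultimately show ?case by simp
qed

text \<open>\<open>frechet_derivative\<close> is a choice operator, so concrete maps enter the
  recursion of \<open>Ck_on\<close> through an explicit derivative \<open>f'\<close>; uniqueness of
  derivatives at points of an open set identifies the two.\<close>

lemma Ck_on_Suc_I:
  assumes "open S" "\<And>x. x \<in> S \<Longrightarrow> (f has_derivative f' x) (at x)"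
    and "\<And>v. Ck_on k S (\<lambda>x. f' x v)"
  shows "Ck_on (Suc k) S f"
proof -
  have e: "frechet_derivative f (at x) = f' x" if "x \<in> S" for x
    using frechet_derivative_at[OF assms(2)[OF that]] by simp
  have "f differentiable_on S"
    using assms(2) by (auto simp: differentiable_on_def differentiable_def intro: has_derivative_at_withinI)
  moreover have "Ck_on k S (\<lambda>x. frechet_derivative f (at x) v)" for v
    by (rule Ck_on_cong[OF assms(1) _ assms(3)]) (simp add: e)
  ultimately show ?thesis by simp
qed

lemma Ck_on_Suc_D:
  assumes "open S" "Ck_on (Suc k) S f" "x \<in> S"
  shows "(f has_derivative frechet_derivative f (at x)) (at x)"
  using assms by (auto simp: differentiable_on_eq_differentiable_at frechet_derivative_works[symmetric])

lemma Ck_on_Suc: "Ck_on (Suc k) S f \<Longrightarrow> Ck_on k S f"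
  by (induction k arbitrary: f) (auto intro: differentiable_imp_continuous_on)

lemma Ck_on_local:
  assumes "open S" "\<And>x. x \<in> S \<Longrightarrow> \<exists>U. open U \<and> x \<in> U \<and> Ck_on k U f"
  shows "Ck_on k S f"
  using assms(2)
proof (induction k arbitrary: f)
  case 0
  have "continuous (at x) f" if "x \<in> S" for x
    using 0[OF that] by (auto simp: continuous_on_eq_continuous_at)
  then show ?case by (simp add: continuous_at_imp_continuous_on)
next
  case (Suc k)
  have "f differentiable (at x)" if "x \<in> S" for x
    using Suc.prems[OF that] by (auto simp: differentiable_on_eq_differentiable_at)
  moreover have "Ck_on k S (\<lambda>x. frechet_derivative f (at x) v)" for v
    by (rule Suc.IH) (use Suc.prems in fastforce)
  ultimately show ?case using assms(1) by (simp add: differentiable_on_eq_differentiable_at)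
qed

lemma Ck_on_frechet: "Ck_on (Suc k) S f \<Longrightarrow> Ck_on k S (\<lambda>x. frechet_derivative f (at x) v)"
  by simp

declare Ck_on.simps(2) [simp del]

section \<open>Closure rules for maps of class C^k and smooth maps\<close>

lemma Ck_on_const: "open S \<Longrightarrow> Ck_on k S (\<lambda>x. c)"
proof (induction k arbitrary: c)
  case (Suc k)
  show ?case
    by (rule Ck_on_Suc_I[where f'="\<lambda>x v. 0"]) (use Suc in auto)
qed simp

lemma Ck_on_linear:
  fixes L :: "'b::real_normed_vector \<Rightarrow> 'c::real_normed_vector"
  assumes "bounded_linear L" "open S" "Ck_on k S f"
  shows "Ck_on k S (\<lambda>x. L (f x))"
  using assms(3)
proof (induction k arbitrary: f)
  case 0
  then show ?case by (auto intro: bounded_linear.continuous_on[OF assms(1)])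
next
  case (Suc k)
  show ?case
    by (rule Ck_on_Suc_I[where f'="\<lambda>x v. L (frechet_derivative f (at x) v)"])
      (use Suc assms(1,2) Ck_on_Suc_D[OF assms(2) Suc.prems]
        in \<open>auto intro: bounded_linear.has_derivative Ck_on_frechet\<close>)
qed

lemma Ck_on_id: "open S \<Longrightarrow> Ck_on k S (\<lambda>x. x)"
proof (cases k)
  case (Suc k')
  assume "open S"
  then show ?thesis unfolding Suc
    by (intro Ck_on_Suc_I[where f'="\<lambda>x v. v"] Ck_on_const) (auto intro: derivative_eq_intros)
qed simp

lemma Ck_on_add:
  assumes "open S" "Ck_on k S f" "Ck_on k S g"
  shows "Ck_on k S (\<lambda>x. f x + g x)"
  using assms(2,3)
proof (induction k arbitrary: f g)
  case 0
  then show ?case by (auto intro: continuous_on_add)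
next
  case (Suc k)
  note D = Ck_on_Suc_D[OF assms(1)]
  show ?case
    by (rule Ck_on_Suc_I[OF assms(1) has_derivative_add[OF D[OF Suc.prems(1)] D[OF Suc.prems(2)]]])
      (assumption, assumption, intro Suc.IH Ck_on_frechet Suc.prems)
qed

text \<open>By the Leibniz rule the derivative is a sum of two terms of the same bilinear shape with
  one order of differentiability less, so the induction closes. Scalar multiples, products and inner
  products are instances.\<close>

lemma Ck_on_bilinear:
  assumes "bounded_bilinear B" "open S" "Ck_on k S f" "Ck_on k S g"
  shows "Ck_on k S (\<lambda>x. B (f x) (g x))"
  using assms(3,4)
proof (induction k arbitrary: f g)
  case 0
  then show ?case by (auto intro: bounded_bilinear.continuous_on[OF assms(1)])
next
  case (Suc k)
  note D = Ck_on_Suc_D[OF assms(2)]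
  show ?case
    by (rule Ck_on_Suc_I[OF assms(2)
          bounded_bilinear.FDERIV[OF assms(1) D[OF Suc.prems(1)] D[OF Suc.prems(2)]]])
      (assumption, assumption, intro Ck_on_add[OF assms(2)] Suc.IH Ck_on_frechet Suc.prems Ck_on_Suc[OF Suc.prems(1)]
        Ck_on_Suc[OF Suc.prems(2)])
qed

lemma Ck_on_sum:
  assumes "open S" "\<And>i. i \<in> I \<Longrightarrow> Ck_on k S (f i)"
  shows "Ck_on k S (\<lambda>x. \<Sum>i\<in>I. f i x)"
  using assms(2) by (induction I rule: infinite_finite_induct)
    (auto intro: Ck_on_const Ck_on_add assms(1))

text \<open>The chain rule gives g'(f x) (f' x v), where both the linear map and its argument depend
  on x. Expanding the argument in the standard basis leaves a finite sum of scalar functions times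
  partial derivatives of g composed with f, to which the induction hypothesis applies.\<close>

lemma Ck_on_compose:
  fixes f :: "'a::euclidean_space \<Rightarrow> 'b::euclidean_space" and g :: "'b \<Rightarrow> 'c::real_normed_vector"
  assumes "open S" "open T" "f ` S \<subseteq> T" "Ck_on k T g" "Ck_on k S f"
  shows "Ck_on k S (\<lambda>x. g (f x))"
  using assms(4,5)
proof (induction k arbitrary: g)
  case 0
  then show ?case using assms(3) by (auto intro: continuous_on_compose2)
next
  case (Suc k)
  let ?f' = "\<lambda>x. frechet_derivative f (at x)" and ?g' = "\<lambda>y. frechet_derivative g (at y)"
  have d: "((\<lambda>x. g (f x)) has_derivative (\<lambda>v. ?g' (f x) (?f' x v))) (at x)" if "x \<in> S" for x
    by (rule diff_chain_at[unfolded o_def])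
      (use Ck_on_Suc_D[OF assms(1) Suc.prems(2)] Ck_on_Suc_D[OF assms(2) Suc.prems(1)] that assms(3) in auto)
  have e: "?g' (f x) (?f' x v) = (\<Sum>b\<in>Basis. (?f' x v \<bullet> b) *\<^sub>R ?g' (f x) b)" if "x \<in> S" for x v
  proof -
    have lin: "linear (?g' (f x))"
      by (rule has_derivative_linear[OF Ck_on_Suc_D[OF assms(2) Suc.prems(1)]]) (use that assms(3) in auto)
    have "?g' (f x) (\<Sum>b\<in>Basis. (?f' x v \<bullet> b) *\<^sub>R b) = (\<Sum>b\<in>Basis. (?f' x v \<bullet> b) *\<^sub>R ?g' (f x) b)"
      by (simp add: linear_sum[OF lin] linear_cmul[OF lin])
    then show ?thesis by (simp add: euclidean_representation)
  qed
  have "Ck_on k S (\<lambda>x. ?g' (f x) (?f' x v))" for v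
  proof (rule Ck_on_cong[OF assms(1) e[symmetric]])
    show "Ck_on k S (\<lambda>x. \<Sum>b\<in>Basis. (?f' x v \<bullet> b) *\<^sub>R ?g' (f x) b)"
      by (rule Ck_on_sum[OF assms(1)], rule Ck_on_bilinear[OF bounded_bilinear_scaleR assms(1)],
          rule Ck_on_linear[OF bounded_linear_inner_left assms(1)],
          rule Ck_on_frechet[OF Suc.prems(2)],
          rule Suc.IH[OF Ck_on_frechet[OF Suc.prems(1)] Ck_on_Suc[OF Suc.prems(2)]])
  qed auto
  then show ?case using Ck_on_Suc_I[OF assms(1) d] by blast
qed

lemma smooth_onI: "(\<And>k. Ck_on k S f) \<Longrightarrow> smooth_on S f"
  by (simp add: smooth_on_def)

lemma smooth_on_Ck: "smooth_on S f \<Longrightarrow> Ck_on k S f"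
  by (simp add: smooth_on_def)

lemma smooth_on_subset: "smooth_on S f \<Longrightarrow> T \<subseteq> S \<Longrightarrow> smooth_on T f"
  unfolding smooth_on_def by (metis Ck_on_subset)

lemma smooth_on_cong:
  "open S \<Longrightarrow> (\<And>x. x \<in> S \<Longrightarrow> f x = g x) \<Longrightarrow> smooth_on S f \<Longrightarrow> smooth_on S g"
  using Ck_on_cong unfolding smooth_on_def by blast

lemma smooth_on_local:
  assumes "open S" "\<And>x. x \<in> S \<Longrightarrow> \<exists>U. open U \<and> x \<in> U \<and> smooth_on U f"
  shows "smooth_on S f"
  using assms unfolding smooth_on_def by (meson Ck_on_local)

lemma smooth_on_const: "open S \<Longrightarrow> smooth_on S (\<lambda>x. c)"
  by (simp add: smooth_on_def Ck_on_const)

lemma smooth_on_id: "open S \<Longrightarrow> smooth_on S (\<lambda>x. x)"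
  by (simp add: smooth_on_def Ck_on_id)

lemma smooth_on_linear:
  "bounded_linear L \<Longrightarrow> open S \<Longrightarrow> smooth_on S f \<Longrightarrow> smooth_on S (\<lambda>x. L (f x))"
  by (simp add: smooth_on_def Ck_on_linear)

lemma smooth_on_add:
  "open S \<Longrightarrow> smooth_on S f \<Longrightarrow> smooth_on S g \<Longrightarrow> smooth_on S (\<lambda>x. f x + g x)"
  by (simp add: smooth_on_def Ck_on_add)

lemma smooth_on_minus: "open S \<Longrightarrow> smooth_on S f \<Longrightarrow> smooth_on S (\<lambda>x. - f x)"
  by (rule smooth_on_linear[OF bounded_linear_minus[OF bounded_linear_ident]])

lemma smooth_on_diff:
  "open S \<Longrightarrow> smooth_on S f \<Longrightarrow> smooth_on S g \<Longrightarrow> smooth_on S (\<lambda>x. f x - g x)"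
  using smooth_on_add[of S f "\<lambda>x. - g x"] smooth_on_minus[of S g] by simp

lemma smooth_on_sum:
  "open S \<Longrightarrow> (\<And>i. i \<in> I \<Longrightarrow> smooth_on S (f i)) \<Longrightarrow> smooth_on S (\<lambda>x. \<Sum>i\<in>I. f i x)"
  by (simp add: smooth_on_def Ck_on_sum)

lemma smooth_on_bilinear:
  "bounded_bilinear B \<Longrightarrow> open S \<Longrightarrow> smooth_on S f \<Longrightarrow> smooth_on S g \<Longrightarrow>
    smooth_on S (\<lambda>x. B (f x) (g x))"
  by (simp add: smooth_on_def Ck_on_bilinear)

lemmas smooth_on_scaleR = smooth_on_bilinear[OF bounded_bilinear_scaleR]
  and smooth_on_mult = smooth_on_bilinear[OF bounded_bilinear_mult]
  and smooth_on_inner = smooth_on_bilinear[OF bounded_bilinear_inner]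

lemma smooth_on_prod:
  fixes f :: "'i \<Rightarrow> 'a::euclidean_space \<Rightarrow> real"
  assumes "open S" "\<And>i. i \<in> I \<Longrightarrow> smooth_on S (f i)"
  shows "smooth_on S (\<lambda>x. \<Prod>i\<in>I. f i x)"
  using assms(2) by (induction I rule: infinite_finite_induct)
    (auto intro: smooth_on_const smooth_on_mult assms(1))

lemma smooth_on_power:
  fixes f :: "'a::euclidean_space \<Rightarrow> real"
  assumes "open S" "smooth_on S f"
  shows "smooth_on S (\<lambda>x. f x ^ m)"
  by (induction m) (auto intro: smooth_on_const smooth_on_mult assms)

lemma smooth_on_Pair:
  fixes f :: "'a::euclidean_space \<Rightarrow> 'b::euclidean_space" and g :: "'a \<Rightarrow> 'c::euclidean_space"
  assumes "open S" "smooth_on S f" "smooth_on S g"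
  shows "smooth_on S (\<lambda>x. (f x, g x))"
proof -
  have l: "bounded_linear (\<lambda>x::'b. (x, 0::'c))" "bounded_linear (\<lambda>x::'c. (0::'b, x))"
    by (simp_all add: bounded_linear_Pair)
  have "smooth_on S (\<lambda>x. (f x, 0) + (0, g x))"
    by (rule smooth_on_add[OF assms(1) smooth_on_linear[OF l(1) assms(1,2)]
          smooth_on_linear[OF l(2) assms(1,3)]])
  then show ?thesis by (simp only: add_Pair add_0_left add_0_right)
qed

lemma smooth_on_compose:
  fixes f :: "'a::euclidean_space \<Rightarrow> 'b::euclidean_space" and g :: "'b \<Rightarrow> 'c::real_normed_vector"
  assumes "open S" "open T" "\<And>x. x \<in> S \<Longrightarrow> f x \<in> T" "smooth_on T g" "smooth_on S f"
  shows "smooth_on S (\<lambda>x. g (f x))"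
proof (rule smooth_onI)
  fix k
  have "f ` S \<subseteq> T" using assms(3) by blast
  then show "Ck_on k S (\<lambda>x. g (f x))"
    using Ck_on_compose[where f=f and g=g and S=S and T=T and k=k, OF assms(1,2)]
      smooth_on_Ck[OF assms(4), of k] smooth_on_Ck[OF assms(5), of k] by metis
qed

lemma smooth_on_frechet:
  "smooth_on S f \<Longrightarrow> smooth_on S (\<lambda>x. frechet_derivative f (at x) v)"
  by (rule smooth_onI, rule Ck_on_frechet, rule smooth_on_Ck)

lemma smooth_on_has_derivative:
  "open S \<Longrightarrow> smooth_on S f \<Longrightarrow> x \<in> S \<Longrightarrow> (f has_derivative frechet_derivative f (at x)) (at x)"
  by (rule Ck_on_Suc_D[OF _ smooth_on_Ck])

lemma smooth_on_continuous: "smooth_on S f \<Longrightarrow> continuous_on S f"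
  using smooth_on_Ck[of S f 0] by simp

section \<open>Smoothness of elementary functions\<close>

lemma smooth_on_inverse: "smooth_on (- {0}) (inverse :: real \<Rightarrow> real)"
proof -
  have "Ck_on k (- {0}) (inverse :: real \<Rightarrow> real)" for k
  proof (induction k)
    case (Suc k)
    show ?case
      by (rule Ck_on_Suc_I[where f'="\<lambda>x v. - (inverse x * v * inverse x)"])
        (auto intro!: has_derivative_inverse' Ck_on_linear[OF bounded_linear_minus[OF bounded_linear_ident]]
          Ck_on_bilinear[OF bounded_bilinear_mult] Ck_on_const Suc)
  qed (simp, intro continuous_intros, simp?)
  then show ?thesis by (simp add: smooth_on_def)
qed

text \<open>Bootstrapping: the derivative is 1 / (2 sqrt x), which is C^k as soon as the root is,
  because \<open>inverse\<close> is smooth off 0.\<close>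

lemma smooth_on_sqrt: "smooth_on {0<..} (sqrt :: real \<Rightarrow> real)"
proof -
  have "Ck_on k {0<..} (sqrt :: real \<Rightarrow> real)" for k
  proof (induction k)
    case (Suc k)
    have "Ck_on k {0<..} (\<lambda>x::real. inverse (sqrt x))"
      by (rule Ck_on_compose[of _ "- {0}"]) (auto simp: Suc smooth_on_Ck[OF smooth_on_inverse])
    then have "Ck_on k {0<..} (\<lambda>x::real. (v / 2) * inverse (sqrt x))" for v
      by (rule Ck_on_linear[OF bounded_linear_mult_right open_greaterThan])
    then show ?case
      by (rule Ck_on_Suc_I[OF open_greaterThan, rotated])
        (auto intro!: derivative_eq_intros simp: field_simps)
  qed (simp, intro continuous_intros)
  then show ?thesis by (simp add: smooth_on_def)
qed

lemma smooth_on_ln: "smooth_on {0<..} (ln :: real \<Rightarrow> real)"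
proof -
  have "Ck_on (Suc k) {0<..} (ln :: real \<Rightarrow> real)" for k
  proof (rule Ck_on_Suc_I[OF open_greaterThan])
    have "Ck_on k {0<..} (inverse :: real \<Rightarrow> real)"
      by (rule Ck_on_subset[OF smooth_on_Ck[OF smooth_on_inverse]]) auto
    then show "Ck_on k {0<..} (\<lambda>x::real. v * inverse x)" for v
      by (rule Ck_on_linear[OF bounded_linear_mult_right open_greaterThan])
  qed (auto intro!: derivative_eq_intros simp: field_simps)
  then show ?thesis using Ck_on_Suc smooth_onI by blast
qed

lemma smooth_on_sin_cos: "smooth_on UNIV (sin :: real \<Rightarrow> real)" "smooth_on UNIV (cos :: real \<Rightarrow> real)"
proof -
  have "Ck_on k UNIV (sin :: real \<Rightarrow> real) \<and> Ck_on k UNIV (cos :: real \<Rightarrow> real)" for k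
  proof (induction k)
    case (Suc k)
    have "Ck_on (Suc k) UNIV (sin :: real \<Rightarrow> real)"
      by (rule Ck_on_Suc_I[where f'="\<lambda>x v. v * cos x"])
        (auto intro!: Ck_on_bilinear[OF bounded_bilinear_mult] Ck_on_const derivative_eq_intros simp: Suc)
    moreover have "Ck_on (Suc k) UNIV (cos :: real \<Rightarrow> real)"
      by (rule Ck_on_Suc_I[where f'="\<lambda>x v. v * (- sin x)"])
        (auto intro!: Ck_on_bilinear[OF bounded_bilinear_mult] Ck_on_const derivative_eq_intros
           Ck_on_linear[OF bounded_linear_minus[OF bounded_linear_ident]] simp: Suc)
    ultimately show ?case by blast
  qed (simp, intro conjI continuous_intros)
  then show "smooth_on UNIV (sin :: real \<Rightarrow> real)" "smooth_on UNIV (cos :: real \<Rightarrow> real)"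
    by (auto simp: smooth_on_def)
qed

lemma smooth_on_divide:
  fixes f g :: "'a::euclidean_space \<Rightarrow> real"
  assumes "open S" "smooth_on S f" "smooth_on S g" "\<And>x. x \<in> S \<Longrightarrow> g x \<noteq> 0"
  shows "smooth_on S (\<lambda>x. f x / g x)"
proof -
  have "smooth_on S (\<lambda>x. inverse (g x))"
    by (rule smooth_on_compose[OF assms(1) _ _ smooth_on_inverse assms(3)]) (auto simp: assms(4))
  then have "smooth_on S (\<lambda>x. f x * inverse (g x))" by (rule smooth_on_mult[OF assms(1,2)])
  then show ?thesis by (simp add: divide_inverse)
qed

lemma smooth_on_norm: "smooth_on (- {0}) (norm :: 'a::euclidean_space \<Rightarrow> real)"
proof -
  have "smooth_on (- {0}) (\<lambda>x::'a. sqrt (x \<bullet> x))"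
    by (rule smooth_on_compose[OF _ _ _ smooth_on_sqrt smooth_on_inner]) (auto intro: smooth_on_id)
  then show ?thesis by (simp add: norm_eq_sqrt_inner[abs_def])
qed

lemma smooth_on_sgn: "smooth_on (- {0}) (sgn :: 'a::euclidean_space \<Rightarrow> 'a)"
proof -
  have "smooth_on (- {0}) (\<lambda>x::'a. inverse (norm x))"
    by (rule smooth_on_compose[OF _ _ _ smooth_on_inverse smooth_on_norm]) auto
  then have "smooth_on (- {0}) (\<lambda>x::'a. inverse (norm x) *\<^sub>R x)"
    by (rule smooth_on_scaleR[rotated]) (auto intro: smooth_on_id)
  then show ?thesis by (simp add: sgn_div_norm[abs_def])
qed

lemma smooth_on_glue:
  "open S \<Longrightarrow> open T \<Longrightarrow> smooth_on S f \<Longrightarrow> smooth_on T f \<Longrightarrow> smooth_on (S \<union> T) f"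
  by (rule smooth_on_local) auto

text \<open>The family \<open>t\<^sup>-\<^sup>m exp (- 1 / t)\<close> is closed under differentiation up to linear combinations.\<close>

lemma Ck_on_exp_inverse:
  "Ck_on k UNIV (\<lambda>t::real. if t \<le> 0 then 0 else inverse t ^ m * exp (- inverse t))"
proof -
  define E where "E m t = (if t \<le> 0 then 0 else inverse t ^ m * exp (- inverse t))" for m and t :: real
  have lim: "(E m \<longlongrightarrow> 0) (at 0)" for m
  proof (rule filterlim_split_at)
    show "(E m \<longlongrightarrow> 0) (at_left 0)"
      by (rule tendsto_eventually) (auto simp: E_def eventually_at intro: exI[of _ 1])
    have "((\<lambda>y::real. y ^ m / exp y) \<longlongrightarrow> 0) at_top" by (rule tendsto_power_div_exp_0)
    then have "((\<lambda>t::real. inverse t ^ m / exp (inverse t)) \<longlongrightarrow> 0) (at_right 0)"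
      by (rule filterlim_compose[OF _ filterlim_inverse_at_top_right])
    then show "(E m \<longlongrightarrow> 0) (at_right 0)"
      by (rule Lim_transform_eventually)
        (auto simp: E_def eventually_at exp_minus field_simps intro!: exI[of _ 1])
  qed
  have D: "(E m has_real_derivative (E (m + 2) t - of_nat m * E (m + 1) t)) (at t)" for m t
  proof -
    consider "t < 0" | "t = 0" | "t > 0" by linarith
    then show ?thesis
    proof cases
      case 1
      have "(E m has_real_derivative 0) (at t)"
        by (rule has_field_derivative_transform_within_open[where f="\<lambda>_. 0" and S="{..<0}"]) (use 1 in \<open>auto simp: E_def\<close>)
      then show ?thesis using 1 by (simp add: E_def)
    next
      case 2
      \<comment> \<open>Near 0 the difference quotient of \<open>E m\<close> is
        \<open>E (Suc m)\<close>, whose limit is already known.\<close>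
      have "((\<lambda>h. (E m (0 + h) - E m 0) / h) \<longlongrightarrow> 0) (at 0)"
        by (rule Lim_transform_eventually[OF lim[of "Suc m"]])
          (auto simp: E_def eventually_at field_simps intro!: exI[of _ 1])
      then show ?thesis using 2 by (simp add: DERIV_def E_def)
    next
      case 3
      have "((\<lambda>t. inverse t ^ m * exp (- inverse t)) has_real_derivative
          (E (m + 2) t - of_nat m * E (m + 1) t)) (at t)"
      proof -
        have i: "(inverse has_real_derivative - (inverse t ^ 2)) (at t)"
          using DERIV_inverse[of t] 3 by (simp add: numeral_2_eq_2)
        have p: "((\<lambda>t. inverse t ^ m) has_real_derivative - of_nat m * inverse t ^ (m + 1)) (at t)"
        proof (cases m)
          case (Suc j)
          show ?thesis unfolding Suc
            by (rule DERIV_cong[OF DERIV_power_Suc[OF i]]) (simp add: power2_eq_square algebra_simps)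
        qed simp
        have e: "((\<lambda>t. exp (- inverse t)) has_real_derivative exp (- inverse t) * inverse t ^ 2) (at t)"
          by (rule DERIV_cong[OF DERIV_fun_exp[OF DERIV_minus[OF i]]]) simp
        show ?thesis
          by (rule DERIV_cong[OF DERIV_mult[OF p e]])
            (use 3 in \<open>simp add: E_def power_add algebra_simps power2_eq_square\<close>)
      qed
      then show ?thesis
        by (rule has_field_derivative_transform_within_open[where S="{0<..}"]) (use 3 in \<open>auto simp: E_def\<close>)
    qed
  qed
  have "Ck_on k UNIV (E m)" for m
  proof (induction k arbitrary: m)
    case 0
    show ?case using D by (auto intro!: DERIV_isCont continuous_at_imp_continuous_on)
  next
    case (Suc k)
    show ?case
    proof (rule Ck_on_Suc_I[where f'="\<lambda>t v. (E (m + 2) t + - (of_nat m * E (m + 1) t)) * v"])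
      show "(E m has_derivative (*) (E (m + 2) t + - (real m * E (m + 1) t))) (at t)" for t
        using D[of m t] by (simp add: has_field_derivative_def)
      show "Ck_on k UNIV (\<lambda>t. (E (m + 2) t + - (real m * E (m + 1) t)) * v)" for v
        by (intro Ck_on_bilinear[OF bounded_bilinear_mult] Ck_on_add Ck_on_const Suc
           Ck_on_linear[OF bounded_linear_minus[OF bounded_linear_ident]]) auto
    qed auto
  qed
  then have "Ck_on k UNIV (E m)" .
  then show ?thesis by (simp only: E_def[abs_def])
qed

lemma smooth_step_exists:
  obtains h :: "real \<Rightarrow> real" where "smooth_on UNIV h" "\<And>t. t \<le> 0 \<Longrightarrow> h t = 0"
    "\<And>t. t \<ge> 1 \<Longrightarrow> h t = 1" "\<And>t. 0 \<le> h t" "\<And>t. h t \<le> 1"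
proof -
  define E where "E t = (if t \<le> 0 then 0 else exp (- inverse t))" for t :: real
  have E: "smooth_on UNIV E"
    by (rule smooth_onI) (use Ck_on_exp_inverse[of _ 0] in \<open>simp add: E_def[abs_def] cong: if_cong\<close>)
  have pos: "E t \<ge> 0" "E t + E (1 - t) > 0" for t
    by (auto simp: E_def intro: add_pos_nonneg)
  \<comment> \<open>The denominator is positive because t and 1 - t are never both nonpositive; each
    plateau is the region where one summand vanishes.\<close>
  define h where "h t = E t / (E t + E (1 - t))" for t
  have "smooth_on UNIV (\<lambda>t. E (1 - t))"
    by (rule smooth_on_compose[OF _ _ _ E smooth_on_diff]) (auto intro: smooth_on_const smooth_on_id)
  from smooth_on_add[OF _ E this] have "smooth_on UNIV (\<lambda>t. E t + E (1 - t))" by simp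
  from smooth_on_divide[OF _ E this] have "smooth_on UNIV h" unfolding h_def[abs_def]
    using pos(2) by (auto simp: less_le)
  moreover have "h t = 0" if "t \<le> 0" for t using that by (simp add: h_def E_def)
  moreover have "h t = 1" if "t \<ge> 1" for t using that by (simp add: h_def E_def)
  moreover have "0 \<le> h t" "h t \<le> 1" for t
    using pos[of t] pos(1)[of "1 - t"] by (auto simp: h_def divide_simps)
  ultimately show ?thesis using that by blast
qed

subsection \<open>Symmetry of second derivatives\<close>

text \<open>Two mean value theorems: in direction u for the increment of f along v, then in
  direction v for the derivative along u. The left side is symmetric in u and v, the right side is
  not.\<close>

lemma second_difference_mvt:
  fixes f :: "'a::euclidean_space \<Rightarrow> real"
  assumes "smooth_on UNIV f" and "h > 0"
  obtains \<xi> \<eta> where "0 < \<xi>" "\<xi> < h" "0 < \<eta>" "\<eta> < h"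
    "f (x + h *\<^sub>R u + h *\<^sub>R v) - f (x + h *\<^sub>R u) - f (x + h *\<^sub>R v) + f x =
      h * h * frechet_derivative (\<lambda>y. frechet_derivative f (at y) u) (at (x + \<xi> *\<^sub>R u + \<eta> *\<^sub>R v)) v"
proof -
  let ?D = "\<lambda>y. frechet_derivative f (at y) u"
  have lin: "((\<lambda>s. g (a + s *\<^sub>R w)) has_real_derivative frechet_derivative g (at (a + s *\<^sub>R w)) w) (at s)"
    if g: "smooth_on UNIV g" for g :: "'a \<Rightarrow> real" and a w s
  proof -
    have g': "(g has_derivative frechet_derivative g (at (a + s *\<^sub>R w))) (at (a + s *\<^sub>R w))"
      by (rule smooth_on_has_derivative[OF _ g]) auto
    have "((\<lambda>s. a + s *\<^sub>R w) has_derivative (\<lambda>t. t *\<^sub>R w)) (at s)"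
      by (auto intro!: derivative_eq_intros)
    from diff_chain_at[OF this g']
    have "((\<lambda>s. g (a + s *\<^sub>R w)) has_derivative (\<lambda>t. frechet_derivative g (at (a + s *\<^sub>R w)) (t *\<^sub>R w))) (at s)"
      by (simp add: o_def)
    moreover have "frechet_derivative g (at (a + s *\<^sub>R w)) (t *\<^sub>R w)
        = frechet_derivative g (at (a + s *\<^sub>R w)) w * t" for t
      using linear_cmul[OF has_derivative_linear[OF g']] by simp
    ultimately show ?thesis by (simp add: has_field_derivative_def)
  qed
  have "\<exists>\<xi>. 0 < \<xi> \<and> \<xi> < h \<and>
      (f (x + h *\<^sub>R v + h *\<^sub>R u) - f (x + h *\<^sub>R u)) - (f (x + h *\<^sub>R v + 0 *\<^sub>R u) - f (x + 0 *\<^sub>R u))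
       = (h - 0) * (?D (x + h *\<^sub>R v + \<xi> *\<^sub>R u) - ?D (x + \<xi> *\<^sub>R u))"
    by (rule MVT2[OF assms(2)]) (intro DERIV_diff lin assms(1))
  then obtain \<xi> where \<xi>: "0 < \<xi>" "\<xi> < h"
    "f (x + h *\<^sub>R v + h *\<^sub>R u) - f (x + h *\<^sub>R u) - (f (x + h *\<^sub>R v) - f x) = h * (?D (x + h *\<^sub>R v + \<xi> *\<^sub>R u) - ?D (x + \<xi> *\<^sub>R u))"
    by auto
  have "\<exists>\<eta>. 0 < \<eta> \<and> \<eta> < h \<and> ?D (x + \<xi> *\<^sub>R u + h *\<^sub>R v) - ?D (x + \<xi> *\<^sub>R u + 0 *\<^sub>R v)
      = (h - 0) * frechet_derivative ?D (at (x + \<xi> *\<^sub>R u + \<eta> *\<^sub>R v)) v"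
    by (rule MVT2[OF assms(2)]) (intro lin smooth_on_frechet assms(1))
  then obtain \<eta> where "0 < \<eta>" "\<eta> < h"
    "?D (x + \<xi> *\<^sub>R u + h *\<^sub>R v) - ?D (x + \<xi> *\<^sub>R u) = h * frechet_derivative ?D (at (x + \<xi> *\<^sub>R u + \<eta> *\<^sub>R v)) v"
    by auto
  then show ?thesis using \<xi> by (intro that[of \<xi> \<eta>]) (auto simp: add_ac)
qed

text \<open>One second difference equals h^2 times either mixed derivative at points close to x. If
  the two differed at x, continuity would keep their values at these points apart.\<close>

lemma second_derivative_symmetric_real:
  fixes f :: "'a::euclidean_space \<Rightarrow> real"
  assumes "smooth_on UNIV f"
  shows "frechet_derivative (\<lambda>y. frechet_derivative f (at y) u) (at x) v =
    frechet_derivative (\<lambda>y. frechet_derivative f (at y) v) (at x) u"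
proof (rule ccontr)
  let ?D = "\<lambda>u v x. frechet_derivative (\<lambda>y. frechet_derivative f (at y) u) (at x) v"
  assume ne: "?D u v x \<noteq> ?D v u x"
  define e where "e = dist (?D u v x) (?D v u x) / 2"
  have e: "e > 0" using ne by (simp add: e_def)
  have cont: "continuous (at x) (?D u v)" for u v
    using smooth_on_continuous[OF smooth_on_frechet[OF smooth_on_frechet[OF assms]], of u v]
    by (simp add: continuous_on_eq_continuous_at)
  obtain d1 where d1: "d1 > 0" "\<And>y. dist y x < d1 \<Longrightarrow> dist (?D u v y) (?D u v x) < e"
    using cont[of u v] e unfolding continuous_at_eps_delta by meson
  obtain d2 where d2: "d2 > 0" "\<And>y. dist y x < d2 \<Longrightarrow> dist (?D v u y) (?D v u x) < e"
    using cont[of v u] e unfolding continuous_at_eps_delta by meson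
  \<comment> \<open>The intermediate points lie within h (|u| + |v|) of x; the summand 1 covers u =
    v = 0.\<close>
  define h where "h = min d1 d2 / (2 * (norm u + norm v + 1))"
  have h: "h > 0" using d1 d2 by (simp add: h_def add_nonneg_pos)
  have hb: "h * (norm u + norm v) < min d1 d2"
  proof -
    have "h * (norm u + norm v) \<le> h * (norm u + norm v + 1)" using h by simp
    also have "\<dots> = min d1 d2 / 2"
      by (simp add: h_def field_simps add_nonneg_eq_0_iff)
    also have "\<dots> < min d1 d2" using d1(1) d2(1) by (simp add: min_def)
    finally show ?thesis .
  qed
  have near: "dist (x + s *\<^sub>R a + t *\<^sub>R b) x < min d1 d2"
    if "0 < s" "s < h" "0 < t" "t < h" "norm a + norm b = norm u + norm v" for s t a b
  proof -
    have "dist (x + s *\<^sub>R a + t *\<^sub>R b) x \<le> s * norm a + t * norm b"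
      using norm_triangle_ineq[of "s *\<^sub>R a" "t *\<^sub>R b"] that by (simp add: dist_norm add.assoc)
    also have "\<dots> \<le> h * norm a + h * norm b" using that by (intro add_mono mult_right_mono) auto
    also have "\<dots> = h * (norm u + norm v)" using that(5) by (simp flip: distrib_left)
    finally show ?thesis using hb by simp
  qed
  obtain s t where st: "0 < s" "s < h" "0 < t" "t < h"
    "f (x + h *\<^sub>R u + h *\<^sub>R v) - f (x + h *\<^sub>R u) - f (x + h *\<^sub>R v) + f x = h * h * ?D u v (x + s *\<^sub>R u + t *\<^sub>R v)"
    using second_difference_mvt[OF assms h] by metis
  obtain s' t' where st': "0 < s'" "s' < h" "0 < t'" "t' < h"
    "f (x + h *\<^sub>R v + h *\<^sub>R u) - f (x + h *\<^sub>R v) - f (x + h *\<^sub>R u) + f x = h * h * ?D v u (x + s' *\<^sub>R v + t' *\<^sub>R u)"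
    using second_difference_mvt[OF assms h] by metis
  have "h * h * ?D u v (x + s *\<^sub>R u + t *\<^sub>R v) = h * h * ?D v u (x + s' *\<^sub>R v + t' *\<^sub>R u)"
  proof -
    have "x + h *\<^sub>R v + h *\<^sub>R u = x + h *\<^sub>R u + h *\<^sub>R v" by (simp add: add_ac)
    then show ?thesis using st(5) st'(5) by (simp only:)
  qed
  then have eq: "?D u v (x + s *\<^sub>R u + t *\<^sub>R v) = ?D v u (x + s' *\<^sub>R v + t' *\<^sub>R u)"
    using h by simp
  have "dist (?D u v (x + s *\<^sub>R u + t *\<^sub>R v)) (?D u v x) < e"
    using near[of s t u v] st by (intro d1(2)) auto
  moreover have "dist (?D v u (x + s' *\<^sub>R v + t' *\<^sub>R u)) (?D v u x) < e"
    using near[of s' t' v u] st' by (intro d2(2)) auto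
  ultimately have "dist (?D u v x) (?D v u x) < 2 * e"
    using dist_triangle[of "?D u v x" "?D v u x" "?D u v (x + s *\<^sub>R u + t *\<^sub>R v)"] eq
    by (simp add: dist_commute)
  then show False by (simp add: e_def)
qed

lemma second_derivative_symmetric:
  fixes f :: "'a::euclidean_space \<Rightarrow> 'b::euclidean_space"
  assumes "smooth_on UNIV f"
  shows "frechet_derivative (\<lambda>y. frechet_derivative f (at y) u) (at x) v =
    frechet_derivative (\<lambda>y. frechet_derivative f (at y) v) (at x) u"
proof (rule euclidean_eqI)
  fix b :: 'b assume "b \<in> Basis"
  have inner: "frechet_derivative (\<lambda>y. g y \<bullet> b) (at y) = (\<lambda>w. frechet_derivative g (at y) w \<bullet> b)"
    if "smooth_on UNIV g" for g :: "'a \<Rightarrow> 'b" and y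
    by (rule frechet_derivative_at[symmetric])
      (use smooth_on_has_derivative[OF _ that] in \<open>auto intro!: derivative_eq_intros\<close>)
  have s: "smooth_on UNIV (\<lambda>y. f y \<bullet> b)"
    by (intro smooth_on_linear[OF bounded_linear_inner_left] assms) auto
  have "frechet_derivative (\<lambda>y. frechet_derivative f (at y) u) (at x) v \<bullet> b =
      frechet_derivative (\<lambda>y. frechet_derivative (\<lambda>y. f y \<bullet> b) (at y) u) (at x) v" for u v
    by (simp add: inner[OF assms] inner[OF smooth_on_frechet[OF assms]])
  then show "frechet_derivative (\<lambda>y. frechet_derivative f (at y) u) (at x) v \<bullet> b =
      frechet_derivative (\<lambda>y. frechet_derivative f (at y) v) (at x) u \<bullet> b"
    using second_derivative_symmetric_real[OF s] by simp
qed

section \<open>Alternating forms\<close>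

lemma alternating_formD:
  assumes "alternating_form k A"
  shows "length vs \<noteq> k \<Longrightarrow> A vs = 0"
    and "length vs = k \<Longrightarrow> i < k \<Longrightarrow> linear (\<lambda>v. A (vs[i := v]))"
    and "length vs = k \<Longrightarrow> i < k \<Longrightarrow> j < k \<Longrightarrow> i \<noteq> j \<Longrightarrow> vs ! i = vs ! j \<Longrightarrow> A vs = 0"
proof -
  show "length vs \<noteq> k \<Longrightarrow> A vs = 0"
    and "length vs = k \<Longrightarrow> i < k \<Longrightarrow> linear (\<lambda>v. A (vs[i := v]))"
    using assms unfolding alternating_form_def by blast+
  show "A vs = 0" if "length vs = k" "i < k" "j < k" "i \<noteq> j" "vs ! i = vs ! j"
    using assms that unfolding alternating_form_def by (metis nat_neq_iff)
qed

lemma alternating_form_swap: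
  assumes "alternating_form k A" "length vs = k" "i < k" "j < k" "i \<noteq> j"
  shows "A (vs[i := vs ! j, j := vs ! i]) = - A vs"
proof -
  define B where "B x y = A (vs[i := x, j := y])" for x y
  have l1: "linear (\<lambda>x. B x y)" for y
    using alternating_formD(2)[OF assms(1), of "vs[j := y]" i] assms
    by (simp add: B_def[abs_def] list_update_swap[of i j])
  have l2: "linear (B x)" for x
    using alternating_formD(2)[OF assms(1), of "vs[i := x]" j] assms by (simp add: B_def[abs_def])
  have z: "B x x = 0" for x
    unfolding B_def by (rule alternating_formD(3)[OF assms(1), of _ i j]) (use assms in auto)
  let ?x = "vs ! i" and ?y = "vs ! j"
  have "0 = B (?x + ?y) (?x + ?y)" by (simp add: z)
  also have "\<dots> = B ?x ?y + B ?y ?x"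
    by (simp only: linear_add[OF l1] linear_add[OF l2]) (simp add: z)
  finally have "B ?y ?x = - B ?x ?y" by linarith
  then show ?thesis by (simp add: B_def)
qed

lemma alternating_form_permute:
  assumes "alternating_form k A" "length vs = k" "p permutes {..<k}"
  shows "A (map (\<lambda>i. vs ! p i) [0..<k]) = of_int (sign p) * A vs"
  using finite_lessThan assms(3)
proof (induction rule: permutes_rev_induct)
  case id
  have "map ((!) vs) [0..<k] = vs" using assms(2) by (metis map_nth)
  then show ?case by simp
next
  case (swap a b p)
  let ?ws = "map (\<lambda>i. vs ! p i) [0..<k]"
  have "map (\<lambda>i. vs ! (p \<circ> Transposition.transpose a b) i) [0..<k] = ?ws[a := ?ws ! b, b := ?ws ! a]"
    using swap by (intro nth_equalityI) (auto simp: nth_list_update Transposition.transpose_def)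
  then have "A (map (\<lambda>i. vs ! (p \<circ> Transposition.transpose a b) i) [0..<k]) = - A ?ws"
    using alternating_form_swap[OF assms(1), of ?ws a b] swap by simp
  also have "\<dots> = of_int (sign (p \<circ> Transposition.transpose a b)) * A vs"
    using swap permutes_imp_permutation[OF finite_lessThan \<open>p permutes {..<k}\<close>]
    by (simp add: sign_compose permutation_swap_id sign_swap_id)
  finally show ?case .
qed

text \<open>Each exchange of neighbours costs one sign. This produces the signs between lists from
  which different entries were omitted.\<close>

lemma alternating_form_move:
  assumes "alternating_form k A"
  shows "A (xs @ v # ys @ zs) = (- 1) ^ length ys * A (xs @ ys @ v # zs)"
proof (induction ys arbitrary: xs)
  case (Cons y ys)
  show ?case
  proof (cases "length (xs @ v # (y # ys) @ zs) = k")
    case True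
    let ?ws = "xs @ v # (y # ys) @ zs" and ?i = "length xs"
    have "xs @ y # v # ys @ zs = ?ws[?i := ?ws ! Suc ?i, Suc ?i := ?ws ! ?i]"
      by (simp add: nth_append list_update_append)
    then have "A (xs @ y # v # ys @ zs) = - A ?ws"
      using alternating_form_swap[OF assms True, of ?i "Suc ?i"] True by simp
    then show ?thesis using Cons[of "xs @ [y]"] by simp
  next
    case False
    then show ?thesis by (simp add: alternating_formD(1)[OF assms])
  qed
qed simp

lemma alternating_form_map:
  assumes "linear L" "alternating_form k A"
  shows "alternating_form k (\<lambda>vs. A (map L vs))"
  unfolding alternating_form_def
proof (intro conjI allI impI; (elim conjE)?)
  fix vs :: "'a list" and i assume "length vs = k" "i < k"
  then show "linear (\<lambda>v. A (map L (vs[i := v])))"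
    using linear_compose[OF assms(1) alternating_formD(2)[OF assms(2), of "map L vs" i]]
    by (simp add: map_update o_def)
next
  fix vs :: "'a list" and i j assume "length vs = k" "i < j" "j < k" "vs ! i = vs ! j"
  then show "A (map L vs) = 0"
    by (intro alternating_formD(3)[OF assms(2), of _ i j]) auto
qed (simp add: alternating_formD(1)[OF assms(2)])

lemma alternating_form_combination:
  assumes "alternating_form k A" "alternating_form k B"
  shows "alternating_form k (\<lambda>vs. a * A vs + b * B vs)"
  unfolding alternating_form_def
proof (intro conjI allI impI; (elim conjE)?)
  fix vs :: "'a list" and i assume *: "length vs = k" "i < k"
  note l = alternating_formD(2)[OF assms(1) *] alternating_formD(2)[OF assms(2) *]
  show "linear (\<lambda>v. a * A (vs[i := v]) + b * B (vs[i := v]))"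
    by (rule linearI) (simp_all add: linear_add[OF l(1)] linear_add[OF l(2)] linear_cmul[OF l(1)]
      linear_cmul[OF l(2)] algebra_simps)
next
  fix vs :: "'a list" and i j assume *: "length vs = k" "i < j" "j < k" "vs ! i = vs ! j"
  then have "A vs = 0" "B vs = 0"
    by (auto intro!: alternating_formD(3)[OF assms(1), of _ i j] alternating_formD(3)[OF assms(2), of _ i j])
  then show "a * A vs + b * B vs = 0" by simp
qed (simp add: alternating_formD(1)[OF assms(1)] alternating_formD(1)[OF assms(2)])

subsection \<open>Orthonormal lists and the volume form\<close>

lemma orthonormal_distinct:
  assumes "orthonormal es" shows "distinct es"
proof (unfold distinct_conv_nth, intro allI impI notI)
  fix i j assume *: "i < length es" "j < length es" "i \<noteq> j" "es ! i = es ! j"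
  have "es ! i \<bullet> es ! j = 0" "es ! i \<bullet> es ! i = 1" 
    using assms *(1-3) unfolding orthonormal_def by auto
  then show False using *(4) by simp
qed

text \<open>A nonzero remainder would be orthogonal to all of \<open>es\<close> and give more
  independent vectors than the dimension allows.\<close>

lemma orthonormal_expand:
  fixes es :: "'a::euclidean_space list"
  assumes "orthonormal es" "length es = DIM('a)"
  shows "v = (\<Sum>j<DIM('a). (v \<bullet> es ! j) *\<^sub>R es ! j)"
proof (rule ccontr)
  define w where "w = v - (\<Sum>j<DIM('a). (v \<bullet> es ! j) *\<^sub>R es ! j)"
  assume "\<not> ?thesis"
  then have w: "w \<noteq> 0" by (simp add: w_def)
  have on: "es ! i \<bullet> es ! j = (if i = j then 1 else 0)" if "i < DIM('a)" "j < DIM('a)" for i j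
    using assms that unfolding orthonormal_def by auto
  have orth: "w \<bullet> es ! i = 0" if "i < DIM('a)" for i
    using that by (simp add: w_def inner_diff_left inner_sum_left on if_distrib[of "\<lambda>x. _ * x"] sum.delta' cong: if_cong)
  have nz: "es ! i \<noteq> 0" if "i < DIM('a)" for i using on[OF that that] by auto
  have "pairwise orthogonal (insert w (set es))"
    unfolding pairwise_insert orthogonal_def
    using orth assms(2) on by (auto simp: in_set_conv_nth pairwise_def orthogonal_def inner_commute)
  moreover have "0 \<notin> insert w (set es)" using w nz assms(2) by (auto simp: in_set_conv_nth)
  ultimately have "independent (insert w (set es))" by (rule pairwise_orthogonal_independent)
  then have "card (insert w (set es)) \<le> DIM('a)" using independent_bound by blast
  moreover have "w \<notin> set es"
  proof
    assume "w \<in> set es"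
    then obtain i where "i < DIM('a)" "es ! i = w" using assms(2) by (auto simp: in_set_conv_nth)
    then show False using orth[of i] w by simp
  qed
  ultimately show False using distinct_card[OF orthonormal_distinct[OF assms(1)]] assms(2) by simp
qed

lemma ordered_basis:
  "distinct (ordered_basis :: 'a::euclidean_space list)" "set (ordered_basis :: 'a list) = Basis"
  "length (ordered_basis :: 'a list) = DIM('a)" "orthonormal (ordered_basis :: 'a list)"
proof -
  have "\<exists>bs::'a list. distinct bs \<and> set bs = Basis" using finite_distinct_list[OF finite_Basis] by blast
  from someI_ex[OF this] show d: "distinct (ordered_basis :: 'a list)"
    and s: "set (ordered_basis :: 'a list) = Basis"
    unfolding ordered_basis_def by auto
  show "length (ordered_basis :: 'a list) = DIM('a)" using distinct_card[OF d] s by simp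
  show "orthonormal (ordered_basis :: 'a list)"
    unfolding orthonormal_def
  proof (intro allI impI)
    fix i j assume "i < length (ordered_basis :: 'a list)" "j < length (ordered_basis :: 'a list)"
    then show "(ordered_basis :: 'a list) ! i \<bullet> ordered_basis ! j = (if i = j then 1 else 0)"
      using s d nth_mem[of i "ordered_basis :: 'a list"] nth_mem[of j "ordered_basis :: 'a list"]
      by (auto simp: inner_Basis nth_eq_iff_index_eq)
  qed
qed

text \<open>The Leibniz determinant of the matrix of inner products of \<open>vs\<close> with
  \<open>es\<close>. The value 0 on lists of other lengths matches the normalisation in
  \<open>alternating_form\<close>.\<close>

definition vol :: "'a::euclidean_space list \<Rightarrow> 'a list \<Rightarrow> real" where
  "vol es vs = (if length vs = length es then
     (\<Sum>p | p permutes {..<length es}. of_int (sign p) * (\<Prod>i<length es. vs ! i \<bullet> es ! p i)) else 0)"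

lemma alternating_form_vol: "alternating_form (length es) (vol es)"
  unfolding alternating_form_def
proof (intro conjI allI impI; (elim conjE)?)
  fix vs :: "'a list" and i assume *: "length vs = length es" "i < length es"
  have "(\<Prod>j<length es. vs[i := v] ! j \<bullet> es ! p j) =
      (v \<bullet> es ! p i) * (\<Prod>j\<in>{..<length es} - {i}. vs ! j \<bullet> es ! p j)" for v p
    using * by (subst prod.remove[of _ i]) (auto intro!: prod.cong)
  then have "vol es (vs[i := v]) = (\<Sum>p | p permutes {..<length es}. of_int (sign p) *
      ((v \<bullet> es ! p i) * (\<Prod>j\<in>{..<length es} - {i}. vs ! j \<bullet> es ! p j)))" for v
    using * by (simp add: vol_def)
  then show "linear (\<lambda>v. vol es (vs[i := v]))"
    by (simp add: linear_iff inner_add_left algebra_simps sum.distrib sum_distrib_left)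
next
  fix vs :: "'a list" and i j assume *: "length vs = length es" "i < j" "j < length es" "vs ! i = vs ! j"
  let ?P = "{p. p permutes {..<length es}}" and ?t = "Transposition.transpose i j"
  let ?f = "\<lambda>p. of_int (sign p) * (\<Prod>l<length es. vs ! l \<bullet> es ! p l)"
  have t: "?t permutes {..<length es}" using * by (intro permutes_swap_id) auto
  have "?f (p \<circ> ?t) = - ?f p" if "p permutes {..<length es}" for p
  proof -
    have "(\<Prod>l<length es. vs ! l \<bullet> es ! (p \<circ> ?t) l) = (\<Prod>l<length es. vs ! l \<bullet> es ! p l)"
      by (subst prod.permute[OF t]) (rule prod.cong[OF refl], use * in \<open>auto simp: Transposition.transpose_def\<close>)
    moreover have "sign (p \<circ> ?t) = - sign p"
      using permutes_imp_permutation[OF _ that] *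
      by (simp add: sign_compose permutation_swap_id sign_swap_id)
    ultimately show ?thesis by simp
  qed
  then have "sum ?f ?P = - sum ?f ?P"
    using sum_permutations_compose_right[OF t, of ?f] by (simp add: sum_negf)
  then show "vol es vs = 0" using * by (simp add: vol_def)
qed (simp add: vol_def)

lemma vol_self:
  assumes "orthonormal es" shows "vol es es = 1"
proof -
  have z: "(\<Prod>i<length es. es ! i \<bullet> es ! p i) = 0" if p: "p permutes {..<length es}" "p \<noteq> id" for p
  proof -
    obtain i where i: "p i \<noteq> i" using p(2) by (auto simp: fun_eq_iff)
    then have "i < length es" "p i < length es"
      using p(1) permutes_not_in[of p "{..<length es}" i] permutes_in_image[OF p(1), of i] by auto
    then show ?thesis using assms i unfolding orthonormal_def
      by (intro prod_zero) (auto intro!: bexI[of _ i])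
  qed
  have o: "(\<Prod>i<length es. es ! i \<bullet> es ! i) = 1"
    using assms unfolding orthonormal_def by (intro prod.neutral) auto
  have "vol es es = (\<Sum>p | p permutes {..<length es}. if p = id then 1 else 0)"
    unfolding vol_def using z o by (simp, intro sum.cong) (auto simp: sign_id)
  also have "\<dots> = 1"
    by (simp add: finite_permutations permutes_id)
  finally show ?thesis .
qed

text \<open>A determinant equals that of the transpose: replace each permutation by its
  inverse.\<close>

lemma vol_commute:
  assumes "length es = length fs" shows "vol es fs = vol fs es"
proof -
  have "(\<Prod>i<length fs. fs ! i \<bullet> es ! inv p i) = (\<Prod>i<length fs. es ! i \<bullet> fs ! p i)"
    if "p permutes {..<length fs}" for p
    by (subst prod.permute[OF that])
      (rule prod.cong[OF refl], simp add: permutes_inverses[OF that] inner_commute)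
  moreover have "sign (inv p) = sign p" if "p permutes {..<length fs}" for p
    by (simp add: sign_inverse permutes_imp_permutation[OF finite_lessThan that])
  ultimately have "(\<Sum>p | p permutes {..<length fs}. of_int (sign p) * (\<Prod>i<length fs. fs ! i \<bullet> es ! p i))
      = (\<Sum>p | p permutes {..<length fs}. of_int (sign p) * (\<Prod>i<length fs. es ! i \<bullet> fs ! p i))"
    by (subst sum_permutations_inverse) (auto intro!: sum.cong)
  then show ?thesis using assms by (simp add: vol_def)
qed

text \<open>Induction on the number \<open>m\<close> of leading entries that are not known to be
  frame vectors; one of them is expanded in the frame at a time. At the end the list either has a
  repetition or is a permutation of \<open>es\<close>.\<close>

lemma alternating_form_eq_0:
  fixes es :: "'a::euclidean_space list"
  assumes A: "alternating_form DIM('a) A" and es: "orthonormal es" "length es = DIM('a)" and "A es = 0"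
  shows "A vs = 0"
proof -
  have "A vs = 0" if "length vs = DIM('a)" "m \<le> DIM('a)" "\<And>i. m \<le> i \<Longrightarrow> i < DIM('a) \<Longrightarrow> vs ! i \<in> set es" for vs m
    using that
  proof (induction m arbitrary: vs)
    case 0
    show ?case
    proof (cases "distinct vs")
      case True
      have "set vs \<subseteq> set es" using 0 by (auto simp: in_set_conv_nth)
      moreover have "card (set vs) = card (set es)"
        using True 0(1) es orthonormal_distinct[OF es(1)] by (simp add: distinct_card)
      ultimately have "set vs = set es" by (simp add: card_subset_eq)
      then have "mset vs = mset es"
        using True orthonormal_distinct[OF es(1)] by (simp add: set_eq_iff_mset_eq_distinct)
      then obtain p where p: "p permutes {..<length es}" "permute_list p es = vs"
        using mset_eq_permutation by metis
      then have "vs = map (\<lambda>i. es ! p i) [0..<DIM('a)]"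
        using es by (simp add: permute_list_def)
      then show ?thesis using alternating_form_permute[OF A es(2), of p] p(1) es(2) assms(4) by simp
    next
      case False
      then show ?thesis using 0(1) alternating_formD(3)[OF A, of vs]
        by (auto simp: distinct_conv_nth)
    qed
  next
    case (Suc m)
    have m: "m < DIM('a)" using Suc by simp
    have l: "linear (\<lambda>v. A (vs[m := v]))" by (rule alternating_formD(2)[OF A]) (use Suc m in auto)
    have "A vs = A (vs[m := \<Sum>j<DIM('a). (vs ! m \<bullet> es ! j) *\<^sub>R es ! j])"
      using orthonormal_expand[OF es, of "vs ! m"] by simp
    also have "\<dots> = (\<Sum>j<DIM('a). (vs ! m \<bullet> es ! j) * A (vs[m := es ! j]))"
      by (simp add: linear_sum[OF l] linear_cmul[OF l])
    also have "\<dots> = 0"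
    proof (intro sum.neutral ballI)
      fix j assume "j \<in> {..<DIM('a)}"
      then have "A (vs[m := es ! j]) = 0"
        using Suc.prems(1,2) es m by (intro Suc.IH) (auto simp: nth_list_update intro!: Suc.prems(3))
      then show "(vs ! m \<bullet> es ! j) * A (vs[m := es ! j]) = 0" by simp
    qed
    finally show ?case .
  qed
  from this[of vs "DIM('a)"] show ?thesis
    using alternating_formD(1)[OF A] by (cases "length vs = DIM('a)") auto
qed

text \<open>Forms of top degree form a line. Applied to a determinant composed with a linear map,
  this replaces the product rule for determinants.\<close>

lemma alternating_form_eq_vol:
  fixes es :: "'a::euclidean_space list"
  assumes A: "alternating_form DIM('a) A" and es: "orthonormal es" "length es = DIM('a)"
  shows "A vs = A es * vol es vs"
proof -
  have "alternating_form DIM('a) (\<lambda>vs. 1 * A vs + (- A es) * vol es vs)"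
    by (rule alternating_form_combination[OF A alternating_form_vol[of es, unfolded es(2)]])
  moreover have "1 * A es + (- A es) * vol es es = 0" by (simp add: vol_self[OF es(1)])
  ultimately have "1 * A vs + (- A es) * vol es vs = 0" by (rule alternating_form_eq_0[OF _ es])
  then show ?thesis by simp
qed

text \<open>An orthogonal matrix has determinant 1 or -1: expanding \<open>vol es\<close> in the
  frame \<open>fs\<close> gives 1 = vol es fs * vol fs es, and the two factors agree.\<close>

lemma abs_vol_orthonormal:
  fixes es :: "'a::euclidean_space list"
  assumes es: "orthonormal es" "length es = DIM('a)" and fs: "orthonormal fs" "length fs = DIM('a)"
  shows "\<bar>vol es fs\<bar> = 1"
proof -
  have "vol es es = vol es fs * vol fs es"
    by (rule alternating_form_eq_vol[OF alternating_form_vol[of es, unfolded es(2)] fs])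
  then have "vol es fs * vol es fs = 1" using vol_self[OF es(1)] vol_commute[of es fs] es fs by simp
  then show ?thesis by (simp add: abs_square_eq_1[symmetric] power2_eq_square)
qed

lemma abs_alternating_form_orthonormal:
  fixes es :: "'a::euclidean_space list"
  assumes A: "alternating_form DIM('a) A"
    and es: "orthonormal es" "length es = DIM('a)" and fs: "orthonormal fs" "length fs = DIM('a)"
  shows "\<bar>A es\<bar> = \<bar>A fs\<bar>"
  using alternating_form_eq_vol[OF A fs, of es] abs_vol_orthonormal[OF fs es] by (simp add: abs_mult)

text \<open>Gram-Schmidt: replacing an entry by its component orthogonal to the previous ones does not
  change the value of the form.\<close>

lemma hadamard:
  fixes A :: "'a::euclidean_space list \<Rightarrow> real"
  assumes A: "alternating_form k A" and c: "comass_le_one k A" and vs: "length vs = k"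
  shows "\<bar>A vs\<bar> \<le> (\<Prod>i<k. norm (vs ! i))"
proof -
  \<comment> \<open>Here \<open>j\<close> counts the trailing entries still to be orthonormalised:
    \<open>j = 0\<close> is the comass bound, and \<open>j = k\<close> is the claim for arbitrary
    lists.\<close>
  have "\<bar>A vs\<bar> \<le> (\<Prod>i<k. norm (vs ! i))"
    if "j \<le> k" "length vs = k" "orthonormal (take (k - j) vs)" for j vs
    using that
  proof (induction j arbitrary: vs)
    case 0
    then have "\<bar>A vs\<bar> \<le> 1" using c by (simp add: comass_le_one_def)
    moreover have "norm (vs ! i) = 1" if "i < k" for i
      using 0 that by (simp add: orthonormal_def norm_eq_1)
    ultimately show ?case by simp
  next
    case (Suc j)
    define m where "m = k - Suc j"
    have m: "m < k" "k - j = Suc m" "k - Suc j = m" using Suc.prems by (auto simp: m_def)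
    have on: "vs ! i \<bullet> vs ! l = (if i = l then 1 else 0)" if "i < m" "l < m" for i l
      using Suc.prems that m unfolding orthonormal_def by auto
    define w where "w = vs ! m - (\<Sum>i<m. (vs ! m \<bullet> vs ! i) *\<^sub>R vs ! i)"
    have orth: "w \<bullet> vs ! i = 0" if "i < m" for i
      using that by (simp add: w_def inner_diff_left inner_sum_left on if_distrib[of "\<lambda>x. _ * x"] sum.delta' cong: if_cong)
    have "w \<bullet> (\<Sum>i<m. (vs ! m \<bullet> vs ! i) *\<^sub>R vs ! i) = 0"
      by (simp add: inner_sum_right orth)
    then have "vs ! m \<bullet> vs ! m = w \<bullet> w + (\<Sum>i<m. (vs ! m \<bullet> vs ! i) *\<^sub>R vs ! i) \<bullet> (\<Sum>i<m. (vs ! m \<bullet> vs ! i) *\<^sub>R vs ! i)"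
      by (simp add: w_def inner_diff_left inner_diff_right inner_commute algebra_simps)
    then have nw: "norm w \<le> norm (vs ! m)"
      by (simp add: norm_eq_sqrt_inner)
    have l: "linear (\<lambda>v. A (vs[m := v]))" by (rule alternating_formD(2)[OF A]) (use Suc.prems m in auto)
    have zero: "A (vs[m := vs ! i]) = 0" if "i < m" for i
      by (rule alternating_formD(3)[OF A, of _ i m]) (use that m Suc.prems in auto)
    have "A (vs[m := w]) = A (vs[m := vs ! m])"
      unfolding w_def by (simp only: linear_diff[OF l] linear_sum[OF l] linear_cmul[OF l]) (simp add: zero)
    then have Aw: "A vs = A (vs[m := w])" by simp
    have split: "(\<Prod>i<k. norm (vs[m := v] ! i)) = norm v * (\<Prod>i\<in>{..<k} - {m}. norm (vs ! i))" for v
      using m Suc.prems by (subst prod.remove[of _ m]) (auto intro!: prod.cong)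
    have split': "(\<Prod>i<k. norm (vs ! i)) = norm (vs ! m) * (\<Prod>i\<in>{..<k} - {m}. norm (vs ! i))"
      using m by (subst prod.remove[of _ m]) auto
    show ?case
    proof (cases "w = 0")
      case True
      then have "A vs = 0" using Aw linear_0[OF l] by simp
      then show ?thesis by (simp add: prod_nonneg)
    next
      case False
      let ?u = "vs[m := sgn w]"
      have nth: "?u ! i = (if i = m then sgn w else vs ! i)" if "i < k" for i
        using that Suc.prems by (simp add: nth_list_update)
      have ww: "sgn w \<bullet> sgn w = 1" using False norm_eq_1[of "sgn w"] by (simp add: norm_sgn)
      have ow: "sgn w \<bullet> vs ! i = 0" "vs ! i \<bullet> sgn w = 0" if "i < m" for i
        using orth[OF that] by (simp_all add: sgn_div_norm inner_commute)
      have "orthonormal (take (k - j) ?u)"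
        unfolding orthonormal_def using m Suc.prems(2)
        by (auto simp: nth less_Suc_eq ww on ow)
      then have "\<bar>A ?u\<bar> \<le> (\<Prod>i<k. norm (?u ! i))"
        using Suc.prems by (intro Suc.IH) auto
      also have "\<dots> = (\<Prod>i\<in>{..<k} - {m}. norm (vs ! i))" using False by (simp add: split norm_sgn)
      finally have le: "\<bar>A ?u\<bar> \<le> (\<Prod>i\<in>{..<k} - {m}. norm (vs ! i))" .
      have "A (vs[m := w]) = norm w * A ?u"
        using linear_cmul[OF l, of "norm w" "sgn w"] False by (simp add: sgn_div_norm)
      then have "\<bar>A vs\<bar> = norm w * \<bar>A ?u\<bar>" by (simp add: Aw abs_mult)
      also have "\<dots> \<le> norm (vs ! m) * (\<Prod>i\<in>{..<k} - {m}. norm (vs ! i))"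
        by (rule mult_mono[OF nw le]) auto
      finally show ?thesis by (simp add: split')
    qed
  qed
  from this[of k vs] vs show ?thesis by (simp add: orthonormal_def)
qed

text \<open>Changing the orthonormal basis of the domain alters the value only by a sign, so the
  frame can be chosen such that its images under \<open>L\<close> are orthogonal. Hadamard's bound
  is then the Jacobian.\<close>

lemma abs_form_le_prod_norm:
  fixes L :: "'a::euclidean_space \<Rightarrow> 'c::euclidean_space"
  assumes "linear L" "alternating_form DIM('a) A" "comass_le_one DIM('a) A"
    and es: "orthonormal es" "length es = DIM('a)"
  shows "\<bar>A (map L ordered_basis)\<bar> \<le> (\<Prod>i<DIM('a). norm (L (es ! i)))"
proof -
  have "\<bar>A (map L ordered_basis)\<bar> = \<bar>A (map L es)\<bar>"
    by (rule abs_alternating_form_orthonormal[OF alternating_form_map[OF assms(1,2)] ordered_basis(4,3) es])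
  also have "\<dots> \<le> (\<Prod>i<DIM('a). norm (map L es ! i))"
    by (rule hadamard[OF assms(2,3)]) (simp add: es)
  finally show ?thesis by (simp add: es)
qed

text \<open>The inner product of the multivector of \<open>vs\<close> with the image under
  \<open>L\<close> of the unit multivector of the domain. Divided by the Jacobian of
  \<open>L\<close>, it is the covector of comass one that calibrates the plane
  \<open>range L\<close>.\<close>

definition covolume :: "('a::euclidean_space \<Rightarrow> 'c::euclidean_space) \<Rightarrow> 'c list \<Rightarrow> real" where
  "covolume L vs = vol ordered_basis (map (adjoint L) vs)"

lemma alternating_form_covolume:
  fixes L :: "'a::euclidean_space \<Rightarrow> 'c::euclidean_space"
  assumes "linear L" shows "alternating_form DIM('a) (covolume L)"
  unfolding covolume_def[abs_def]
  by (rule alternating_form_map[OF adjoint_linear[OF assms]])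
    (rule alternating_form_vol[of ordered_basis, unfolded ordered_basis(3)])

lemma covolume_eq:
  fixes L :: "'a::euclidean_space \<Rightarrow> 'c::euclidean_space"
  assumes "linear L" 
  shows "covolume L vs = (if length vs = DIM('a) then \<Sum>p | p permutes {..<DIM('a)}.
    of_int (sign p) * (\<Prod>i<DIM('a). vs ! i \<bullet> L (ordered_basis ! p i)) else 0)"
  using adjoint_works[OF assms]
  by (auto simp: covolume_def vol_def ordered_basis inner_commute intro!: sum.cong prod.cong)

text \<open>In the singular frame \<open>es\<close>, the first claim is that the Gram determinant of
  \<open>L\<close> is the squared product of singular values. For the second, the adjoint is the
  projection onto the range of \<open>L\<close> followed by scaling with the singular values, and a
  projection does not increase norms, so Hadamard's bound applies.\<close>

lemma covolume_bounds:
  fixes L :: "'a::euclidean_space \<Rightarrow> 'c::euclidean_space"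
  assumes L: "linear L" and es: "orthonormal es" "length es = DIM('a)"
    and s: "\<And>i. i < DIM('a) \<Longrightarrow> s i > 0"
    and orth: "\<And>i j. i < DIM('a) \<Longrightarrow> j < DIM('a) \<Longrightarrow> L (es ! i) \<bullet> L (es ! j) = (if i = j then (s i)\<^sup>2 else 0)"
  shows "covolume L (map L ordered_basis) = (\<Prod>i<DIM('a). s i)\<^sup>2"
    and "length vs = DIM('a) \<Longrightarrow> orthonormal vs \<Longrightarrow> \<bar>covolume L vs\<bar> \<le> (\<Prod>i<DIM('a). s i)"
proof -
  let ?k = "DIM('a)" and ?bs = "ordered_basis :: 'a list" and ?P = "\<Prod>i<DIM('a). s i"
  let ?M = "\<lambda>v. adjoint L (L v)"
  have adj: "adjoint L y \<bullet> x = y \<bullet> L x" for x y using adjoint_works[OF L, of x y] by (simp add: inner_commute)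
  have ME: "?M (es ! i) = (s i)\<^sup>2 *\<^sub>R es ! i" if "i < ?k" for i
  proof -
    have "?M (es ! i) = (\<Sum>j<?k. (?M (es ! i) \<bullet> es ! j) *\<^sub>R es ! j)" by (rule orthonormal_expand[OF es])
    also have "\<dots> = (\<Sum>j<?k. if j = i then (s i)\<^sup>2 *\<^sub>R es ! i else 0)"
      using that by (intro sum.cong) (auto simp: adj orth)
    finally show ?thesis using that by simp
  qed
  have altbs: "alternating_form ?k (vol ?bs)" by (rule alternating_form_vol[of ordered_basis, unfolded ordered_basis(3)])
  have M: "linear ?M" using linear_compose[OF L adjoint_linear[OF L]] by (simp add: o_def)
  have nz: "vol ?bs es \<noteq> 0" using abs_vol_orthonormal[OF ordered_basis(4,3) es] by auto
  \<comment> \<open>\<open>vol ?bs\<close> after \<open>?M\<close> is a form of top degree, hence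
    determined by its value on the standard basis; on \<open>es\<close>, where \<open>?M\<close> is
    diagonal, it can be computed.\<close>
  have "vol ?bs (map ?M es) = vol ?bs (map ?M ?bs) * vol ?bs es"
    by (rule alternating_form_eq_vol[OF alternating_form_map[OF M altbs] ordered_basis(4,3)])
  moreover have "vol ?bs (map ?M es) = ?P\<^sup>2 * vol ?bs es"
  proof -
    have "(\<Prod>i<?k. map ?M es ! i \<bullet> ?bs ! p i) = ?P\<^sup>2 * (\<Prod>i<?k. es ! i \<bullet> ?bs ! p i)" for p
      unfolding prod_power_distrib prod.distrib[symmetric]
      by (rule prod.cong[OF refl]) (simp add: es ME)
    then show ?thesis by (simp add: vol_def es ordered_basis sum_distrib_left mult_ac)
  qed
  ultimately have "vol ?bs (map ?M ?bs) = ?P\<^sup>2" using nz by simp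
  then show "covolume L (map L ?bs) = ?P\<^sup>2" by (simp add: covolume_def o_def)
  assume vs: "length vs = DIM('a)" "orthonormal vs"
  define w where "w i = (1 / s i) *\<^sub>R L (es ! i)" for i
  have w: "w i \<bullet> w j = (if i = j then 1 else 0)" if "i < ?k" "j < ?k" for i j
    using that s[of i] by (auto simp: w_def orth power2_eq_square)
  have Lw: "L (es ! i) = s i *\<^sub>R w i" if "i < ?k" for i using s[OF that] by (simp add: w_def)
  \<comment> \<open>The orthogonal projections of \<open>vs\<close> onto the range of
    \<open>L\<close>, carried back to the domain by the isometry that sends \<open>w j\<close> to
    \<open>es ! j\<close>.\<close>
  define us where "us = map (\<lambda>v. \<Sum>j<?k. (v \<bullet> w j) *\<^sub>R es ! j) vs"
  have on: "es ! i \<bullet> es ! j = (if i = j then 1 else 0)" if "i < ?k" "j < ?k" for i j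
    using es that unfolding orthonormal_def by auto
  have us_inner: "us ! i \<bullet> es ! j = vs ! i \<bullet> w j" if "i < ?k" "j < ?k" for i j
    using that vs by (simp add: us_def inner_sum_left on if_distrib[of "\<lambda>x. _ * x"] sum.delta' cong: if_cong)
  have us_norm: "norm (us ! i) \<le> 1" if i: "i < ?k" for i
  proof -
    let ?v = "vs ! i" and ?q = "\<Sum>j<?k. (vs ! i \<bullet> w j) *\<^sub>R w j"
    have qq: "?q \<bullet> ?q = (\<Sum>j<?k. (?v \<bullet> w j)\<^sup>2)"
      by (simp add: inner_sum_left inner_sum_right w if_distrib[of "\<lambda>x. _ * x"] sum.delta power2_eq_square cong: if_cong)
    have vq: "?v \<bullet> ?q = (\<Sum>j<?k. (?v \<bullet> w j)\<^sup>2)"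
      by (simp add: inner_sum_right power2_eq_square)
    have uu: "us ! i \<bullet> us ! i = (\<Sum>j<?k. (?v \<bullet> w j)\<^sup>2)"
      using i vs by (simp add: us_def inner_sum_left inner_sum_right on if_distrib[of "\<lambda>x. _ * x"] sum.delta power2_eq_square cong: if_cong)
    have "0 \<le> (?v - ?q) \<bullet> (?v - ?q)" by simp
    also have "\<dots> = ?v \<bullet> ?v - us ! i \<bullet> us ! i"
      by (simp only: inner_diff_left inner_diff_right inner_commute[of ?q ?v] qq vq uu)
    also have "?v \<bullet> ?v = 1" using vs i unfolding orthonormal_def by auto
    finally show ?thesis by (simp add: norm_eq_sqrt_inner)
  qed
  have altes: "alternating_form ?k (vol es)" by (rule alternating_form_vol[of es, unfolded es(2)])
  have "\<bar>covolume L vs\<bar> = \<bar>vol es (map (adjoint L) vs)\<bar>"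
    unfolding covolume_def using alternating_form_eq_vol[OF altbs es, of "map (adjoint L) vs"]
      abs_vol_orthonormal[OF ordered_basis(4,3) es] by (simp add: abs_mult)
  also have "vol es (map (adjoint L) vs) = ?P * vol es us"
  proof -
    have "(\<Prod>i<?k. adjoint L (vs ! i) \<bullet> es ! p i) = ?P * (\<Prod>i<?k. us ! i \<bullet> es ! p i)"
      if p: "p permutes {..<?k}" for p
    proof -
      have pin: "p i < ?k" if "i < ?k" for i using permutes_in_image[OF p, of i] that by simp
      have "(\<Prod>i<?k. adjoint L (vs ! i) \<bullet> es ! p i) = (\<Prod>i<?k. s (p i) * (us ! i \<bullet> es ! p i))"
        by (intro prod.cong refl) (simp add: adj Lw pin us_inner)
      also have "\<dots> = (\<Prod>i<?k. (s \<circ> p) i) * (\<Prod>i<?k. us ! i \<bullet> es ! p i)"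
        by (simp add: prod.distrib)
      finally show ?thesis by (simp only: prod.permute[OF p, of s, symmetric])
    qed
    moreover have "length us = ?k" using vs by (simp add: us_def)
    ultimately show ?thesis using vs
      by (simp add: vol_def es sum_distrib_left mult_ac)
  qed
  also have "\<bar>?P * vol es us\<bar> \<le> ?P * 1"
  proof -
    have "\<bar>vol es us\<bar> \<le> (\<Prod>i<?k. norm (us ! i))"
    proof (rule hadamard[OF altes])
      show "comass_le_one ?k (vol es)"
        using abs_vol_orthonormal[OF es] by (auto simp: comass_le_one_def)
    qed (simp add: us_def vs)
    also have "\<dots> \<le> 1" by (rule prod_le_1) (simp add: us_norm)
    finally have le: "\<bar>vol es us\<bar> \<le> 1" .
    have "0 \<le> ?P" using s by (intro prod_nonneg) (auto intro: less_imp_le)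
    then show ?thesis using mult_left_mono[OF le] by (simp add: abs_mult)
  qed
  finally show "\<bar>covolume L vs\<bar> \<le> ?P" by simp
qed

section \<open>Test forms and pullback\<close>

lemma test_formsD:
  assumes "\<omega> \<in> test_forms k"
  shows "alternating_form k (\<omega> x)" "smooth_on UNIV (\<lambda>x. \<omega> x vs)"
  using assms by (auto simp: test_forms_def)

lemma frechet_derivative_smooth_add:
  assumes "smooth_on UNIV f" "smooth_on UNIV g"
  shows "frechet_derivative (\<lambda>y. f y + g y) (at x) v =
    frechet_derivative f (at x) v + frechet_derivative g (at x) v"
  using frechet_derivative_at[OF has_derivative_add[OF smooth_on_has_derivative[OF open_UNIV assms(1) UNIV_I]
        smooth_on_has_derivative[OF open_UNIV assms(2) UNIV_I]]]
  by metis

lemma frechet_derivative_smooth_cmult: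
  fixes f :: "'a::euclidean_space \<Rightarrow> real"
  assumes "smooth_on UNIV f"
  shows "frechet_derivative (\<lambda>y. c * f y) (at x) v = c * frechet_derivative f (at x) v"
  using frechet_derivative_at[OF has_derivative_mult_right[OF smooth_on_has_derivative[OF open_UNIV assms UNIV_I]], of c]
  by metis

lemma frechet_derivative_smooth_linear:
  assumes "smooth_on UNIV f"
  shows "linear (frechet_derivative f (at x))"
  by (rule has_derivative_linear[OF smooth_on_has_derivative[OF open_UNIV assms UNIV_I]])

lemma frechet_derivative_zero:
  assumes "open S" "x \<in> S" "\<And>y. y \<in> S \<Longrightarrow> f y = 0"
  shows "frechet_derivative f (at x) v = 0"
proof -
  have "(f has_derivative (\<lambda>_. 0)) (at x)"
    by (rule has_derivative_transform_within_open[of "\<lambda>_. 0" _ _ _ S]) (use assms in auto)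
  from frechet_derivative_at[OF this] show ?thesis by metis
qed

abbreviation omit :: "nat \<Rightarrow> 'c list \<Rightarrow> 'c list" where
  "omit i vs \<equiv> take i vs @ drop (Suc i) vs"

lemma omit_update_other:
  assumes "i \<noteq> j" "i < length vs" "j < length vs"
  shows "omit j (vs[i := v]) = (omit j vs)[(if i < j then i else i - 1) := v]"
proof (rule nth_equalityI)
  fix l assume "l < length (omit j (vs[i := v]))"
  then show "omit j (vs[i := v]) ! l = (omit j vs)[(if i < j then i else i - 1) := v] ! l"
    using assms by (auto simp: nth_append nth_list_update min_def)
qed simp

text \<open>Both lists carry the same entries, with \<open>v\<close> standing in for the one of
  positions i, j that survives. They differ by moving \<open>v\<close> across the j - 1 - i entries
  in between.\<close>

lemma omit_swap:
  assumes "alternating_form k A" "i < j" "j < length vs"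
  shows "A ((omit i vs)[j - 1 := v]) = (- 1) ^ (j - 1 - i) * A ((omit j vs)[i := v])"
proof -
  obtain xs a ws where ws: "vs = xs @ a # ws" "length xs = i"
    using id_take_nth_drop[of i vs] assms by (metis length_take less_trans min.absorb4)
  then have "j - 1 - i < length ws" using assms by simp
  then obtain ys b zs where "ws = ys @ b # zs" "length ys = j - 1 - i"
    using id_take_nth_drop[of "j - 1 - i" ws] by (metis length_take min.absorb4)
  note vs = ws(1)[unfolded this(1)] ws(2) this(2)
  have j: "j = Suc (length xs + length ys)" using vs assms(2) by simp
  have "(omit i vs)[j - 1 := v] = xs @ ys @ v # zs"
    using vs(1,2) j by (simp add: list_update_append)
  moreover have "(omit j vs)[i := v] = xs @ v # ys @ zs"
    using vs(1,2) j by (simp add: list_update_append)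
  moreover have "A (xs @ v # ys @ zs) = (- 1) ^ length ys * A (xs @ ys @ v # zs)"
    by (rule alternating_form_move[OF assms(1)])
  ultimately show ?thesis using vs(3) by (simp flip: power_add mult.assoc mult_2)
qed

lemma linear_weighted_sum:
  fixes g :: "'i \<Rightarrow> 'a::real_vector \<Rightarrow> real"
  assumes "\<And>j. j \<in> I \<Longrightarrow> linear (g j)"
  shows "linear (\<lambda>v. \<Sum>j\<in>I. c j * g j v)"
proof (rule linearI)
  show "(\<Sum>j\<in>I. c j * g j (x + y)) = (\<Sum>j\<in>I. c j * g j x) + (\<Sum>j\<in>I. c j * g j y)" for x y
    unfolding sum.distrib[symmetric]
    by (rule sum.cong) (simp_all add: linear_add[OF assms] distrib_left)
  show "(\<Sum>j\<in>I. c j * g j (r *\<^sub>R x)) = r *\<^sub>R (\<Sum>j\<in>I. c j * g j x)" for r x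
    unfolding scaleR_sum_right
    by (rule sum.cong) (simp_all add: linear_cmul[OF assms])
qed

text \<open>For alternation, let the vectors at positions i < j agree. Every other term keeps the
  repeated pair and vanishes, and the terms i and j cancel because (-1)^i (-1)^(j-1-i) =
  -(-1)^j.\<close>

lemma ext_deriv_test_form:
  assumes \<omega>: "\<omega> \<in> test_forms k"
  shows "ext_deriv \<omega> \<in> test_forms (Suc k)"
proof -
  note sm = test_formsD(2)[OF \<omega>] and alt = test_formsD(1)[OF \<omega>]
  let ?F = "\<lambda>us x v. frechet_derivative (\<lambda>y. \<omega> y us) (at x) v"
  have lin_form: "linear (\<lambda>v. ?F (us[i := v]) x w)" if us: "length us = k" "i < k" for us i x w
  proof (rule linearI)
    fix v1 v2 :: 'a and r :: real
    note l = alternating_formD(2)[OF alt us]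
    show "?F (us[i := v1 + v2]) x w = ?F (us[i := v1]) x w + ?F (us[i := v2]) x w"
      using frechet_derivative_smooth_add[OF sm sm] by (simp add: linear_add[OF l])
    show "?F (us[i := r *\<^sub>R v1]) x w = r *\<^sub>R ?F (us[i := v1]) x w"
      using frechet_derivative_smooth_cmult[OF sm] by (simp add: linear_cmul[OF l])
  qed
  have "alternating_form (Suc k) (ext_deriv \<omega> x)" for x
    unfolding alternating_form_def
  proof (intro conjI allI impI; (elim conjE)?)
    fix vs :: "'a list" assume *: "length vs \<noteq> Suc k"
    then have "\<omega> y (omit i vs) = 0" if "i < length vs" for i y
      using that by (intro alternating_formD(1)[OF alt]) auto
    then show "ext_deriv \<omega> x vs = 0"
      by (simp add: ext_deriv_def frechet_derivative_zero[OF open_UNIV])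
  next
    fix vs :: "'a list" and i assume *: "length vs = Suc k" "i < Suc k"
    have "linear (\<lambda>v. ?F (omit j (vs[i := v])) x (vs[i := v] ! j))" if "j < Suc k" for j
    proof (cases "j = i")
      case True
      then show ?thesis using * frechet_derivative_smooth_linear[OF sm, of "omit i vs" x]
        by simp
    next
      case False
      define l where "l = (if i < j then i else i - 1)"
      have "l < k" "length (omit j vs) = k" using * that False by (auto simp: l_def)
      from lin_form[OF this(2,1), of x "vs ! j"] show ?thesis
        using omit_update_other[of i j vs] * that False by (simp add: l_def)
    qed
    then show "linear (\<lambda>v. ext_deriv \<omega> x (vs[i := v]))"
      unfolding ext_deriv_def length_list_update *(1) by (intro linear_weighted_sum) simp
  next
    fix vs :: "'a list" and i j assume *: "length vs = Suc k" "i < j" "j < Suc k" "vs ! i = vs ! j"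
    let ?t = "\<lambda>l. (- 1) ^ l * ?F (omit l vs) x (vs ! l)"
    have z: "?t l = 0" if l: "l < Suc k" "l \<noteq> i" "l \<noteq> j" for l
    proof -
      have "\<omega> y (omit l vs) = 0" for y
        by (rule alternating_formD(3)[OF alt, of _ "if i < l then i else i - 1" "if j < l then j else j - 1"])
          (use * l in \<open>auto simp: nth_append min_def\<close>)
      then show ?thesis by (simp add: frechet_derivative_zero[OF open_UNIV])
    qed
    have e: "\<omega> y (omit i vs) = (- 1) ^ (j - 1 - i) * \<omega> y (omit j vs)" for y
    proof -
      have "(omit i vs)[j - 1 := vs ! j] = omit i vs" "(omit j vs)[i := vs ! j] = omit j vs"
        using * by (auto simp: list_update_same_conv nth_append min_def) 
      then show ?thesis using omit_swap[OF alt, of i j vs y "vs ! j"] * by simp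
    qed
    have "ext_deriv \<omega> x vs = (\<Sum>l<Suc k. ?t l)" using * by (simp add: ext_deriv_def)
    also have "\<dots> = (\<Sum>l\<in>{i, j}. ?t l)"
      by (rule sum.mono_neutral_right) (use * z in auto)
    also have "\<dots> = ((- 1) ^ i * (- 1) ^ (j - 1 - i) + (- 1) ^ j) * ?F (omit j vs) x (vs ! j)"
      using * by (simp add: e frechet_derivative_smooth_cmult[OF sm] algebra_simps)
    also have "(- 1) ^ i * (- 1) ^ (j - 1 - i) + (- 1::real) ^ j = 0"
    proof -
      have "j = Suc (i + (j - 1 - i))" using * by simp
      then have "(- 1::real) ^ j = - ((- 1) ^ (i + (j - 1 - i)))" by (metis power_Suc mult_minus1)
      then show ?thesis by (simp add: power_add)
    qed
    finally show "ext_deriv \<omega> x vs = 0" by simp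
  qed
  moreover have "smooth_on UNIV (\<lambda>x. ext_deriv \<omega> x vs)" for vs
    unfolding ext_deriv_def
    by (rule smooth_on_sum[OF open_UNIV], rule smooth_on_linear[OF bounded_linear_mult_right open_UNIV],
        rule smooth_on_frechet, rule sm)
  moreover obtain K where K: "compact K" "\<And>x vs. x \<notin> K \<Longrightarrow> \<omega> x vs = 0"
    using \<omega> unfolding test_forms_def by blast
  have "ext_deriv \<omega> x vs = 0" if "x \<notin> K" for x vs
  proof -
    have "open (- K)" using K(1) by (simp add: compact_imp_closed open_Compl)
    then have "frechet_derivative (\<lambda>y. \<omega> y us) (at x) v = 0" for us v
      by (rule frechet_derivative_zero) (use that K(2) in auto)
    then show ?thesis by (simp add: ext_deriv_def)
  qed
  ultimately show ?thesis using K(1) unfolding test_forms_def by blast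
qed

lemma form_expand_slot:
  assumes "alternating_form k A" "length vs = k" "m < k"
  shows "A (vs[m := v]) = (\<Sum>b\<in>Basis. (v \<bullet> b) * A (vs[m := b]))"
proof -
  note l = alternating_formD(2)[OF assms]
  have "A (vs[m := v]) = A (vs[m := \<Sum>b\<in>Basis. (v \<bullet> b) *\<^sub>R b])" by (simp add: euclidean_representation)
  also have "\<dots> = (\<Sum>b\<in>Basis. (v \<bullet> b) * A (vs[m := b]))"
    by (simp add: linear_sum[OF l] linear_cmul[OF l])
  finally show ?thesis .
qed

text \<open>Both following proofs expand one vector argument after the other in the standard basis, which
  leaves finitely many smooth coefficient functions.\<close>

lemma smooth_on_form:
  fixes p :: "'a::euclidean_space \<Rightarrow> 'c::euclidean_space"
  assumes \<omega>: "\<omega> \<in> test_forms k" and S: "open S" and p: "smooth_on S p"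
    and v: "\<And>i. i < k \<Longrightarrow> smooth_on S (v i)"
  shows "smooth_on S (\<lambda>y. \<omega> (p y) (map (\<lambda>i. v i y) [0..<k]))"
proof -
  \<comment> \<open>The first \<open>m\<close> slots vary with \<open>y\<close>, the others are
    frozen at constant vectors \<open>w\<close>; the induction releases one slot at a time.\<close>
  define L where "L m w y = map (\<lambda>i. if i < m then v i y else w i) [0..<k]" for m w y
  have L: "smooth_on S (\<lambda>y. \<omega> (p y) (L m w y))" if "m \<le> k" for m w
    using that
  proof (induction m arbitrary: w)
    case 0
    have L0: "L 0 w y = map w [0..<k]" for y by (simp add: L_def)
    show ?case unfolding L0
      by (rule smooth_on_compose[OF S open_UNIV _ test_formsD(2)[OF \<omega>] p]) simp
  next
    case (Suc m)
    have e: "L (Suc m) w y = (L m w y)[m := v m y]" "(L m w y)[m := b] = L m (w(m := b)) y" for y b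
      using Suc.prems by (auto simp: L_def intro!: nth_equalityI simp: nth_list_update)
    have "\<omega> (p y) (L (Suc m) w y) = (\<Sum>b\<in>Basis. (v m y \<bullet> b) * \<omega> (p y) (L m (w(m := b)) y))" for y
      unfolding e(1) e(2)[symmetric]
      by (rule form_expand_slot[OF test_formsD(1)[OF \<omega>]]) (use Suc.prems in \<open>auto simp: L_def\<close>)
    then show ?case using Suc.prems
      by (auto intro!: smooth_on_sum[OF S] smooth_on_mult[OF S] Suc.IH
          smooth_on_linear[OF bounded_linear_inner_left S] v)
  qed
  have "L k w y = map (\<lambda>i. v i y) [0..<k]" for w y by (auto simp: L_def)
  note Lk = this
  show ?thesis using L[of k] unfolding Lk by simp
qed

lemma form_has_derivative:
  fixes p :: "'a::euclidean_space \<Rightarrow> 'c::euclidean_space"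
  assumes \<omega>: "\<omega> \<in> test_forms k" and p: "(p has_derivative p') (at x)"
    and v: "\<And>i. i < k \<Longrightarrow> (v i has_derivative v' i) (at x)"
  shows "((\<lambda>y. \<omega> (p y) (map (\<lambda>i. v i y) [0..<k])) has_derivative
    (\<lambda>h. frechet_derivative (\<lambda>q. \<omega> q (map (\<lambda>i. v i x) [0..<k])) (at (p x)) (p' h)
       + (\<Sum>i<k. \<omega> (p x) ((map (\<lambda>i. v i x) [0..<k])[i := v' i h])))) (at x)"
proof -
  define L where "L m w y = map (\<lambda>i. if i < m then v i y else w i) [0..<k]" for m w y
  let ?F = "\<lambda>us h. frechet_derivative (\<lambda>q. \<omega> q us) (at (p x)) h"
  note sm = test_formsD(2)[OF \<omega>] and alt = test_formsD(1)[OF \<omega>]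
  have len: "length (L m w y) = k" for m w y by (simp add: L_def)
  have L: "((\<lambda>y. \<omega> (p y) (L m w y)) has_derivative
      (\<lambda>h. ?F (L m w x) (p' h) + (\<Sum>i<m. \<omega> (p x) ((L m w x)[i := v' i h])))) (at x)" if "m \<le> k" for m w
    using that
  proof (induction m arbitrary: w)
    case 0
    have L0: "L 0 w y = map w [0..<k]" for y by (simp add: L_def)
    show ?case unfolding L0
      using diff_chain_at[OF p smooth_on_has_derivative[OF open_UNIV sm UNIV_I]] by (simp add: o_def)
  next
    case (Suc m)
    let ?u = "\<lambda>b. w(m := b)"
    have m: "m < k" using Suc.prems by simp
    have e: "L (Suc m) w y = (L m w y)[m := v m y]" "(L m w y)[m := b] = L m (?u b) y" for y b
      using m by (auto simp: L_def intro!: nth_equalityI simp: nth_list_update)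
    have ex: "\<omega> q (L (Suc m) w y) = (\<Sum>b\<in>Basis. (v m y \<bullet> b) * \<omega> q (L m (?u b) y))" for y q
      unfolding e(1) e(2)[symmetric] by (rule form_expand_slot[OF alt len m])
    have Fex: "?F (L (Suc m) w x) h = (\<Sum>b\<in>Basis. (v m x \<bullet> b) * ?F (L m (?u b) x) h)" for h
    proof -
      have "((\<lambda>q. \<Sum>b\<in>Basis. (v m x \<bullet> b) * \<omega> q (L m (?u b) x)) has_derivative
          (\<lambda>h. \<Sum>b\<in>Basis. (v m x \<bullet> b) * ?F (L m (?u b) x) h)) (at (p x))"
        by (intro has_derivative_sum has_derivative_mult_right smooth_on_has_derivative[OF open_UNIV sm UNIV_I])
      from fun_cong[OF frechet_derivative_at[OF this], of h] show ?thesis unfolding ex by (rule sym)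
    qed
    have i_ex: "\<omega> (p x) ((L (Suc m) w x)[i := z]) = (\<Sum>b\<in>Basis. (v m x \<bullet> b) * \<omega> (p x) ((L m (?u b) x)[i := z]))"
      if "i < m" for i z
    proof -
      have sw: "(L m w x)[m := b, i := z] = (L m w x)[i := z, m := b]" for b
        by (rule list_update_swap) (use that in simp)
      show ?thesis unfolding e(1) e(2)[symmetric] sw
        by (rule form_expand_slot[OF alt _ m]) (simp add: len)
    qed
    have m_ex: "\<omega> (p x) ((L (Suc m) w x)[m := z]) = (\<Sum>b\<in>Basis. (z \<bullet> b) * \<omega> (p x) (L m (?u b) x))" for z
      unfolding e(1) e(2)[symmetric] list_update_overwrite by (rule form_expand_slot[OF alt len m])
    have "((\<lambda>y. \<Sum>b\<in>Basis. (v m y \<bullet> b) * \<omega> (p y) (L m (?u b) y)) has_derivative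
        (\<lambda>h. \<Sum>b\<in>Basis. (v m x \<bullet> b) * (?F (L m (?u b) x) (p' h) + (\<Sum>i<m. \<omega> (p x) ((L m (?u b) x)[i := v' i h])))
           + (v' m h \<bullet> b) * \<omega> (p x) (L m (?u b) x))) (at x)"
      by (rule has_derivative_sum, rule has_derivative_mult[OF has_derivative_inner_left[OF v[OF m]]])
        (rule Suc.IH[OF less_imp_le[OF m]])
    moreover have "(\<Sum>b\<in>Basis. (v m x \<bullet> b) * (?F (L m (?u b) x) (p' h) + (\<Sum>i<m. \<omega> (p x) ((L m (?u b) x)[i := v' i h])))
           + (v' m h \<bullet> b) * \<omega> (p x) (L m (?u b) x))
        = ?F (L (Suc m) w x) (p' h) + (\<Sum>i<Suc m. \<omega> (p x) ((L (Suc m) w x)[i := v' i h]))" for h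
    proof -
      have "(\<Sum>i<m. \<omega> (p x) ((L (Suc m) w x)[i := v' i h])) =
          (\<Sum>b\<in>Basis. (v m x \<bullet> b) * (\<Sum>i<m. \<omega> (p x) ((L m (?u b) x)[i := v' i h])))"
        by (simp add: i_ex sum_distrib_left) (rule sum.swap)
      then show ?thesis by (simp add: Fex m_ex sum.distrib distrib_left)
    qed
    ultimately show ?case unfolding ex by simp
  qed
  have "L k w y = map (\<lambda>i. v i y) [0..<k]" for w y by (auto simp: L_def)
  note Lk = this
  show ?thesis using L[of k] unfolding Lk by simp
qed

text \<open>The order embedding that misses i; it indexes both the arguments left after an omission
  and the coordinates of a face.\<close>

definition skip :: "nat \<Rightarrow> nat \<Rightarrow> nat" where
  "skip i l = (if l < i then l else Suc l)"

lemma bij_betw_skip: "i < Suc n \<Longrightarrow> bij_betw (skip i) {..<n} ({..<Suc n} - {i})"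
  by (rule bij_betw_byWitness[where f'="\<lambda>j. if j < i then j else j - 1"]) (auto simp: skip_def)

lemma omit_map: "i < Suc n \<Longrightarrow> omit i (map f [0..<Suc n]) = map (\<lambda>l. f (skip i l)) [0..<n]"
  by (rule nth_equalityI) (auto simp: nth_append min_def skip_def simp del: upt_Suc)

text \<open>Exterior differentiation commutes with pullback; the second derivatives of \<open>\<Psi>\<close> cancel in
  pairs by symmetry.\<close>

lemma ext_deriv_pullback:
  fixes \<Psi> :: "'a::euclidean_space \<Rightarrow> 'c::euclidean_space"
  assumes \<omega>: "\<omega> \<in> test_forms n" and \<Psi>: "smooth_on UNIV \<Psi>" and bs: "length bs = Suc n"
  shows "(\<Sum>i<Suc n. (- 1) ^ i * frechet_derivative
      (\<lambda>y. \<omega> (\<Psi> y) (map (\<lambda>l. frechet_derivative \<Psi> (at y) (bs ! skip i l)) [0..<n])) (at x) (bs ! i))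
    = ext_deriv \<omega> (\<Psi> x) (map (frechet_derivative \<Psi> (at x)) bs)"
proof -
  let ?D = "\<lambda>j y. frechet_derivative \<Psi> (at y) (bs ! j)"
  define dl where "dl = map (\<lambda>j. ?D j x) [0..<Suc n]"
  define H where "H i j = frechet_derivative (?D j) (at x) (bs ! i)" for i j
  define pos where "pos i j = (if j < i then j else j - 1 :: nat)" for i j :: nat
  \<comment> \<open>The term that arises when the i-th partial derivative hits the vector with
    original index j, whose position after omitting i is \<open>pos i j\<close>.\<close>
  define T where "T i j = \<omega> (\<Psi> x) ((omit i dl)[pos i j := H i j])" for i j
  note alt = test_formsD(1)[OF \<omega>]
  have Hsym: "H i j = H j i" for i j
    unfolding H_def by (rule second_derivative_symmetric[OF \<Psi>])
  have om: "omit i dl = map (\<lambda>l. ?D (skip i l) x) [0..<n]" if "i < Suc n" for i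
    unfolding dl_def by (rule omit_map[OF that])
  have dl: "dl = map (frechet_derivative \<Psi> (at x)) bs"
    unfolding dl_def by (rule nth_equalityI) (simp_all add: bs del: upt_Suc)
  have der: "frechet_derivative (\<lambda>y. \<omega> (\<Psi> y) (map (\<lambda>l. ?D (skip i l) y) [0..<n])) (at x) (bs ! i)
      = frechet_derivative (\<lambda>q. \<omega> q (omit i dl)) (at (\<Psi> x)) (?D i x) + (\<Sum>j\<in>{..<Suc n} - {i}. T i j)"
    if i: "i < Suc n" for i
  proof -
    have "((\<lambda>y. \<omega> (\<Psi> y) (map (\<lambda>l. ?D (skip i l) y) [0..<n])) has_derivative
      (\<lambda>h. frechet_derivative (\<lambda>q. \<omega> q (map (\<lambda>l. ?D (skip i l) x) [0..<n])) (at (\<Psi> x)) (frechet_derivative \<Psi> (at x) h)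
       + (\<Sum>l<n. \<omega> (\<Psi> x) ((map (\<lambda>l. ?D (skip i l) x) [0..<n])[l := frechet_derivative (?D (skip i l)) (at x) h])))) (at x)"
      by (intro form_has_derivative[OF \<omega>] smooth_on_has_derivative[OF open_UNIV _ UNIV_I] smooth_on_frechet \<Psi>)
    from frechet_derivative_at[OF this, symmetric]
    have "frechet_derivative (\<lambda>y. \<omega> (\<Psi> y) (map (\<lambda>l. ?D (skip i l) y) [0..<n])) (at x) (bs ! i) =
        frechet_derivative (\<lambda>q. \<omega> q (omit i dl)) (at (\<Psi> x)) (?D i x)
        + (\<Sum>l<n. \<omega> (\<Psi> x) ((omit i dl)[l := H i (skip i l)]))"
      unfolding om[OF i] H_def by simp
    also have "(\<Sum>l<n. \<omega> (\<Psi> x) ((omit i dl)[l := H i (skip i l)])) = (\<Sum>l<n. T i (skip i l))"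
      by (rule sum.cong) (auto simp: T_def pos_def skip_def)
    also have "\<dots> = (\<Sum>j\<in>{..<Suc n} - {i}. T i j)"
      by (rule sum.reindex_bij_betw[OF bij_betw_skip[OF i]])
    finally show ?thesis .
  qed
  \<comment> \<open>With the signs of the exterior derivative this matrix is antisymmetric, so its
    entries sum to 0.\<close>
  define a where "a i j = (if i = j then 0 else (- 1) ^ i * T i j)" for i j
  have anti_less: "a j i = - a i j" if "i < j" "j < Suc n" for i j
  proof -
    have "T i j = (- 1) ^ (j - 1 - i) * T j i"
      using omit_swap[OF alt that(1), of dl "\<Psi> x" "H i j"] that
      by (simp add: T_def pos_def dl_def Hsym[of j i] del: upt_Suc)
    moreover have "j = Suc (i + (j - 1 - i))" using that by simp
    then have "(- 1::real) ^ j = - ((- 1) ^ i * (- 1) ^ (j - 1 - i))" by (metis power_Suc mult_minus1 power_add)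
    ultimately show ?thesis using that by (simp add: a_def)
  qed
  have anti: "a j i = - a i j" if "i < Suc n" "j < Suc n" for i j
    using anti_less[of i j] anti_less[of j i] that by (cases i j rule: linorder_cases) (auto simp: a_def)
  have "(\<Sum>i<Suc n. \<Sum>j<Suc n. a i j) = (\<Sum>j<Suc n. \<Sum>i<Suc n. a i j)" by (rule sum.swap)
  also have "\<dots> = - (\<Sum>j<Suc n. \<Sum>i<Suc n. a j i)"
    unfolding sum_negf[symmetric] by (intro sum.cong refl) (rule anti; simp)
  finally have z: "(\<Sum>i<Suc n. \<Sum>j<Suc n. a i j) = 0" by linarith
  have ra: "(\<Sum>j<Suc n. a i j) = (- 1) ^ i * (\<Sum>j\<in>{..<Suc n} - {i}. T i j)" if "i < Suc n" for i
    using that by (subst sum.remove[of _ i]) (auto simp: a_def sum_distrib_left simp del: sum.lessThan_Suc intro!: sum.cong)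
  have "(\<Sum>i<Suc n. (- 1) ^ i * frechet_derivative (\<lambda>y. \<omega> (\<Psi> y) (map (\<lambda>l. ?D (skip i l) y) [0..<n])) (at x) (bs ! i))
      = (\<Sum>i<Suc n. (- 1) ^ i * frechet_derivative (\<lambda>q. \<omega> q (omit i dl)) (at (\<Psi> x)) (?D i x)
          + (\<Sum>j<Suc n. a i j))"
    by (rule sum.cong) (simp_all add: der ra distrib_left del: sum.lessThan_Suc)
  also have "\<dots> = (\<Sum>i<Suc n. (- 1) ^ i * frechet_derivative (\<lambda>q. \<omega> q (omit i dl)) (at (\<Psi> x)) (?D i x))"
    by (simp only: sum.distrib z add_0_right)
  also have "\<dots> = ext_deriv \<omega> (\<Psi> x) dl"
    unfolding ext_deriv_def by (rule sum.cong) (simp_all add: dl_def del: upt_Suc)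
  finally show ?thesis by (simp add: dl)
qed

section \<open>Stokes' theorem for smooth cubes\<close>

lemma product_sigma_finite_lborel: "product_sigma_finite (\<lambda>_. lborel :: real measure)"
  by (simp add: product_sigma_finite_def lborel.sigma_finite_measure_axioms)

text \<open>Serves twice: to number the coordinates that \<open>lborel\<close> indexes by
  \<open>Basis\<close>, and to renumber the coordinates left after one has been integrated
  out.\<close>

lemma distr_PiM_lborel_reindex:
  assumes "finite I" "bij_betw h I K"
  shows "distr (PiM K (\<lambda>_. lborel :: real measure)) (PiM I (\<lambda>_. lborel)) (\<lambda>t. \<lambda>j\<in>I. t (h j))
    = PiM I (\<lambda>_. lborel)"
proof -
  interpret I: product_sigma_finite "\<lambda>_::'a. lborel :: real measure" by (rule product_sigma_finite_lborel)
  interpret K: product_sigma_finite "\<lambda>_::'b. lborel :: real measure" by (rule product_sigma_finite_lborel)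
  have K: "finite K" using assms bij_betw_finite by blast
  have hK: "h j \<in> K" if "j \<in> I" for j using assms(2) that by (auto simp: bij_betw_def)
  have meas: "(\<lambda>t. \<lambda>j\<in>I. t (h j)) \<in> measurable (PiM K (\<lambda>_. lborel :: real measure)) (PiM I (\<lambda>_. lborel))"
    by (intro measurable_restrict measurable_component_singleton hK)
  show ?thesis
  proof (rule I.PiM_eqI[OF assms(1)])
    fix A :: "'a \<Rightarrow> real set" assume A: "\<And>i. i \<in> I \<Longrightarrow> A i \<in> sets lborel"
    let ?g = "the_inv_into I h"
    have g: "?g (h j) = j" if "j \<in> I" for j
      using assms(2) that by (auto simp: bij_betw_def intro: the_inv_into_f_f)
    have gI: "?g k \<in> I" "h (?g k) = k" if "k \<in> K" for k
      using assms(2) that by (auto simp: bij_betw_def intro: the_inv_into_into f_the_inv_into_f)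
    have "(\<lambda>t. \<lambda>j\<in>I. t (h j)) -` (Pi\<^sub>E I A) \<inter> space (PiM K (\<lambda>_. lborel)) = Pi\<^sub>E K (\<lambda>k. A (?g k))"
    proof (intro equalityI subsetI)
      fix t assume t: "t \<in> (\<lambda>t. \<lambda>j\<in>I. t (h j)) -` (Pi\<^sub>E I A) \<inter> space (PiM K (\<lambda>_. lborel :: real measure))"
      show "t \<in> Pi\<^sub>E K (\<lambda>k. A (?g k))"
      proof (rule PiE_I)
        fix k assume k: "k \<in> K"
        have "(\<lambda>j\<in>I. t (h j)) (?g k) \<in> A (?g k)" using t gI[OF k] by (auto simp: PiE_def Pi_def)
        then show "t k \<in> A (?g k)" using gI[OF k] by simp
      qed (use t in \<open>auto simp: space_PiM PiE_def extensional_def\<close>)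
    next
      fix t assume t: "t \<in> Pi\<^sub>E K (\<lambda>k. A (?g k))"
      then have "t (h j) \<in> A j" if "j \<in> I" for j using PiE_mem[OF t hK[OF that]] g[OF that] by simp
      then show "t \<in> (\<lambda>t. \<lambda>j\<in>I. t (h j)) -` (Pi\<^sub>E I A) \<inter> space (PiM K (\<lambda>_. lborel :: real measure))"
        using t by (auto simp: space_PiM PiE_def)
    qed
    then have "emeasure (distr (PiM K (\<lambda>_. lborel)) (PiM I (\<lambda>_. lborel)) (\<lambda>t. \<lambda>j\<in>I. t (h j))) (Pi\<^sub>E I A)
        = emeasure (PiM K (\<lambda>_. lborel)) (Pi\<^sub>E K (\<lambda>k. A (?g k)))"
      using A assms(1) by (subst emeasure_distr[OF meas]) (auto intro!: sets_PiM_I_finite)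
    also have "\<dots> = (\<Prod>k\<in>K. emeasure lborel (A (?g k)))"
      by (rule K.emeasure_PiM[OF K]) (use A gI in auto)
    also have "\<dots> = (\<Prod>j\<in>I. emeasure lborel (A (?g (h j))))"
      by (rule prod.reindex_bij_betw[OF assms(2), symmetric])
    also have "\<dots> = (\<Prod>j\<in>I. emeasure lborel (A j))" by (rule prod.cong) (simp_all add: g)
    finally show "emeasure (distr (PiM K (\<lambda>_. lborel)) (PiM I (\<lambda>_. lborel)) (\<lambda>t. \<lambda>j\<in>I. t (h j))) (Pi\<^sub>E I A)
        = (\<Prod>j\<in>I. emeasure lborel (A j))" .
  qed simp
qed

text \<open>The shift by 1/2 puts the centre of the cube at the origin, where the vertex of the cone
  will be; every face then has distance 1/2 from it.\<close>

definition emb :: "(nat \<Rightarrow> real) \<Rightarrow> 'a::euclidean_space" where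
  "emb t = (\<Sum>j<DIM('a). (t j - 1 / 2) *\<^sub>R ordered_basis ! j)"

definition ubox :: "'a::euclidean_space set" where
  "ubox = box (- (1 / 2) *\<^sub>R One) ((1 / 2) *\<^sub>R One)"

abbreviation ucube :: "nat \<Rightarrow> (nat \<Rightarrow> real) set" where
  "ucube n \<equiv> {..<n} \<rightarrow>\<^sub>E {0<..<1}"

text \<open>Lebesgue measure on the whole coordinate space; the cube itself enters only as a domain
  of set integrals.\<close>

abbreviation lebesgue_cube :: "nat \<Rightarrow> (nat \<Rightarrow> real) measure" where
  "lebesgue_cube n \<equiv> Pi\<^sub>M {..<n} (\<lambda>_. lborel)"

lemma emb_inner: "j < DIM('a) \<Longrightarrow> (emb t :: 'a::euclidean_space) \<bullet> ordered_basis ! j = t j - 1 / 2"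
proof -
  assume j: "j < DIM('a)"
  have "(ordered_basis ! i :: 'a) \<bullet> ordered_basis ! j = (if i = j then 1 else 0)" if "i < DIM('a)" for i
    using ordered_basis(3,4)[where 'a='a] that j unfolding orthonormal_def by simp
  then have "(emb t :: 'a) \<bullet> ordered_basis ! j = (\<Sum>i<DIM('a). if i = j then t i - 1 / 2 else 0)"
    unfolding emb_def inner_sum_left by (intro sum.cong) auto
  then show ?thesis using j by simp
qed

lemma emb_update:
  assumes "i < DIM('a)"
  shows "(emb (t(i := s)) :: 'a::euclidean_space) = emb t + (s - t i) *\<^sub>R ordered_basis ! i"
proof -
  have r: "(emb t :: 'a) = (t i - 1 / 2) *\<^sub>R ordered_basis ! i
      + (\<Sum>j\<in>{..<DIM('a)} - {i}. (t j - 1 / 2) *\<^sub>R ordered_basis ! j)" for t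
    unfolding emb_def using assms by (subst sum.remove[of _ i]) auto
  have "(\<Sum>j\<in>{..<DIM('a)} - {i}. ((t(i := s)) j - 1 / 2) *\<^sub>R ordered_basis ! j)
      = (\<Sum>j\<in>{..<DIM('a)} - {i}. (t j - 1 / 2) *\<^sub>R (ordered_basis ! j :: 'a))"
    by (rule sum.cong) auto
  then show ?thesis unfolding r[of t] r[of "t(i := s)"] by (simp add: algebra_simps)
qed

lemma Basis_ordered_basis: "(\<forall>b\<in>(Basis :: 'a::euclidean_space set). P b) \<longleftrightarrow> (\<forall>j<DIM('a). P (ordered_basis ! j))"
  using all_set_conv_all_nth[of "ordered_basis :: 'a list" P] by (simp only: ordered_basis(2,3))

lemma mem_ubox: "x \<in> ubox \<longleftrightarrow> (\<forall>b\<in>Basis. \<bar>x \<bullet> b\<bar> < 1 / 2)"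
  by (auto simp: ubox_def mem_box abs_less_iff) 

lemma emb_in_ubox:
  assumes "t \<in> extensional {..<DIM('a)}"
  shows "(emb t :: 'a::euclidean_space) \<in> ubox \<longleftrightarrow> t \<in> ucube DIM('a)"
proof -
  have "(emb t :: 'a) \<in> ubox \<longleftrightarrow> (\<forall>j<DIM('a). \<bar>t j - 1 / 2\<bar> < 1 / 2)"
    unfolding mem_ubox Basis_ordered_basis by (simp add: emb_inner)
  also have "\<dots> \<longleftrightarrow> (\<forall>j<DIM('a). t j \<in> {0<..<1})"
    unfolding abs_less_iff greaterThanLessThan_iff by auto
  also have "\<dots> \<longleftrightarrow> t \<in> ucube DIM('a)" using assms by (auto simp: PiE_def Pi_def)
  finally show ?thesis .
qed

lemma measurable_component_lborel: "j \<in> I \<Longrightarrow> (\<lambda>t. t j) \<in> borel_measurable (PiM I (\<lambda>_. lborel :: real measure))"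
  using measurable_component_singleton[of j I "\<lambda>_. lborel :: real measure"] by simp

lemma measurable_emb_compose:
  assumes "\<And>j. j < DIM('a) \<Longrightarrow> (\<lambda>x. g x j) \<in> borel_measurable M"
  shows "(\<lambda>x. emb (g x) :: 'a::euclidean_space) \<in> borel_measurable M"
  unfolding emb_def using assms
  by (intro borel_measurable_sum borel_measurable_scaleR borel_measurable_diff) auto

lemma measurable_emb: "(emb :: _ \<Rightarrow> 'a::euclidean_space) \<in> borel_measurable (lebesgue_cube DIM('a))"
  using measurable_emb_compose[of "\<lambda>t. t", where 'a='a] measurable_component_lborel by force

text \<open>Lebesgue measure is by construction the image of the product measure over
  \<open>Basis\<close>. What remains is the numbering of the basis and a translation by the centre
  \<open>c\<close> of the cube.\<close>

lemma distr_emb: "distr (lebesgue_cube DIM('a)) borel (emb :: _ \<Rightarrow> 'a::euclidean_space) = lborel"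
proof -
  let ?k = "DIM('a)" and ?bs = "ordered_basis :: 'a list"
  let ?P = "lebesgue_cube ?k"
  have b: "bij_betw ((!) ?bs) {..<?k} Basis"
    using bij_betw_nth[OF ordered_basis(1)] ordered_basis(2,3)[where 'a='a] by metis
  define h where "h = the_inv_into {..<?k} ((!) ?bs)"
  have h: "bij_betw h Basis {..<?k}" unfolding h_def by (rule bij_betw_the_inv_into[OF b])
  have hb: "h (?bs ! j) = j" if "j < ?k" for j
    unfolding h_def using b that by (auto simp: bij_betw_def intro: the_inv_into_f_f)
  have hk: "h i \<in> {..<?k}" if "i \<in> Basis" for i using h that by (auto simp: bij_betw_def)
  define c :: 'a where "c = (\<Sum>j<?k. (1 / 2) *\<^sub>R ?bs ! j)"
  let ?T = "\<lambda>t::nat \<Rightarrow> real. \<lambda>i\<in>Basis::'a set. t (h i)" and ?S = "\<lambda>f::'a \<Rightarrow> real. \<Sum>i\<in>Basis. f i *\<^sub>R i"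
  have S: "?S (?T t) = emb t + c" for t
  proof -
    have "?S (?T t) = (\<Sum>i\<in>Basis. t (h i) *\<^sub>R i)" by (rule sum.cong) auto
    also have "\<dots> = (\<Sum>j<?k. t (h (?bs ! j)) *\<^sub>R ?bs ! j)" by (rule sum.reindex_bij_betw[OF b, symmetric])
    also have "\<dots> = (\<Sum>j<?k. (t j - 1 / 2) *\<^sub>R ?bs ! j + (1 / 2) *\<^sub>R ?bs ! j)"
      by (rule sum.cong) (auto simp: hb simp flip: scaleR_add_left)
    finally show ?thesis by (simp only: sum.distrib emb_def c_def)
  qed
  have mT: "?T \<in> measurable ?P (PiM Basis (\<lambda>_. lborel))"
    by (intro measurable_restrict measurable_component_singleton hk)
  have mS: "?S \<in> borel_measurable (PiM Basis (\<lambda>_. lborel))"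
    by (intro borel_measurable_sum borel_measurable_scaleR measurable_component_lborel) auto
  have "lborel = distr (PiM Basis (\<lambda>_. lborel)) borel ?S" by (rule lborel_eq)
  also have "PiM Basis (\<lambda>_. lborel) = distr ?P (PiM Basis (\<lambda>_. lborel)) ?T"
    by (rule distr_PiM_lborel_reindex[OF finite_Basis h, symmetric])
  also have "distr \<dots> borel ?S = distr ?P borel (\<lambda>t. emb t + c)"
    by (subst distr_distr[OF mS mT]) (simp only: o_def S)
  finally have l: "lborel = distr ?P borel (\<lambda>t. emb t + c)" .
  have "lborel = distr lborel borel ((+) (- c))" by (rule lborel_distr_plus[symmetric])
  also have "\<dots> = distr (distr ?P borel (\<lambda>t. emb t + c)) borel ((+) (- c))" using l by simp
  also have "\<dots> = distr ?P borel emb"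
    by (subst distr_distr) (auto intro!: borel_measurable_add measurable_emb simp: o_def)
  finally show ?thesis by simp
qed

lemma ucube_sets: "ucube n \<in> sets (lebesgue_cube n)"
  by (intro sets_PiM_I_finite) auto

lemma emeasure_ucube: "emeasure (lebesgue_cube n) (ucube n) = 1"
proof -
  interpret product_sigma_finite "\<lambda>_::nat. lborel :: real measure" by (rule product_sigma_finite_lborel)
  show ?thesis by (subst emeasure_PiM) auto
qed

lemma set_integral_emb:
  fixes F :: "'a::euclidean_space \<Rightarrow> real"
  assumes "F \<in> borel_measurable borel"
  shows "(LINT t:ucube DIM('a)|lebesgue_cube DIM('a). F (emb t)) = (LINT x:ubox|lborel. F x)"
proof -
  have "(LINT x:ubox|lborel. F x) = (\<integral>x. indicator ubox x *\<^sub>R F x \<partial>distr (lebesgue_cube DIM('a)) borel emb)"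
    unfolding set_lebesgue_integral_def distr_emb ..
  also have "\<dots> = (\<integral>t. indicator ubox (emb t :: 'a) *\<^sub>R F (emb t) \<partial>lebesgue_cube DIM('a))"
    by (rule integral_distr[OF measurable_emb]) (use assms in \<open>auto simp: ubox_def\<close>)
  also have "\<dots> = (LINT t:ucube DIM('a)|lebesgue_cube DIM('a). F (emb t))"
    unfolding set_lebesgue_integral_def
    by (rule Bochner_Integration.integral_cong[OF refl])
      (use emb_in_ubox in \<open>auto simp: space_PiM PiE_def indicator_def\<close>)
  finally show ?thesis by simp
qed

definition cubox :: "'a::euclidean_space set" where
  "cubox = cbox (- (1 / 2) *\<^sub>R One) ((1 / 2) *\<^sub>R One)"

lemma cubox: "compact (cubox :: 'a::euclidean_space set)" "convex (cubox :: 'a set)"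
  "(ubox :: 'a set) \<subseteq> cubox"
  by (auto simp: cubox_def ubox_def mem_box less_imp_le)

lemma mem_cubox: "x \<in> cubox \<longleftrightarrow> (\<forall>b\<in>Basis. \<bar>x \<bullet> b\<bar> \<le> 1 / 2)"
  by (auto simp: cubox_def mem_box abs_le_iff)

lemma emb_in_cubox: "(\<And>j. j < DIM('a) \<Longrightarrow> t j \<in> {0..1}) \<Longrightarrow> (emb t :: 'a::euclidean_space) \<in> cubox"
  unfolding mem_cubox Basis_ordered_basis abs_le_iff by (auto simp: emb_inner)

lemma ucube_01: "t \<in> ucube n \<Longrightarrow> j < n \<Longrightarrow> t j \<in> {0..1}"
  by (auto simp: PiE_def Pi_def less_imp_le)

lemma set_integrable_emb:
  fixes F :: "'a::euclidean_space \<Rightarrow> real"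
  assumes F: "continuous_on UNIV F" 
    and g: "\<And>j. j < DIM('a) \<Longrightarrow> (\<lambda>t. g t j) \<in> borel_measurable (lebesgue_cube n)"
    and g01: "\<And>t j. t \<in> ucube n \<Longrightarrow> j < DIM('a) \<Longrightarrow> g t j \<in> {0..1}"
  shows "set_integrable (lebesgue_cube n) (ucube n) (\<lambda>t. F (emb (g t)))"
proof -
  have "bounded (F ` cubox)"
    using F cubox(1) by (intro compact_imp_bounded compact_continuous_image) (auto intro: continuous_on_subset)
  then obtain B where B: "\<And>x. x \<in> cubox \<Longrightarrow> norm (F x) \<le> B"
    by (auto simp: bounded_iff)
  show ?thesis unfolding set_integrable_def
  proof (rule integrableI_bounded_set_indicator[where B=B])
    show "(\<lambda>t. F (emb (g t))) \<in> borel_measurable (lebesgue_cube n)"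
      using measurable_compose[OF measurable_emb_compose[OF g] borel_measurable_continuous_onI[OF F]] .
    show "AE t\<in>ucube n in lebesgue_cube n. norm (F (emb (g t))) \<le> B"
      using g01 emb_in_cubox B by (intro AE_I2) blast
  qed (use ucube_sets emeasure_ucube in auto)
qed

text \<open>Parametrises the hyperplane on which coordinate i is frozen at \<open>s\<close>, in the
  numbering given by \<open>skip\<close>.\<close>

definition ins :: "nat \<Rightarrow> real \<Rightarrow> (nat \<Rightarrow> real) \<Rightarrow> nat \<Rightarrow> real" where
  "ins i s t j = (if j < i then t j else if j = i then s else t (j - 1))"

lemma ins_skip: "ins i s t (skip i l) = t l" "ins i s t i = s"
  by (auto simp: ins_def skip_def)

lemma ins_update: "(ins i s t)(skip i l := r) = ins i s (t(l := r))"
  by (auto simp: ins_def skip_def fun_eq_iff)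

lemma ins_measurable: "j < Suc n \<Longrightarrow> i < Suc n \<Longrightarrow> (\<lambda>t. ins i s t j) \<in> borel_measurable (lebesgue_cube n)"
  by (cases "j < i"; cases "j = i") (auto simp: ins_def intro: measurable_component_lborel)

lemma ins_01: "t \<in> {..<n} \<rightarrow>\<^sub>E {0..1} \<Longrightarrow> s \<in> {0..1} \<Longrightarrow> i < Suc n \<Longrightarrow> j < Suc n \<Longrightarrow> ins i s t j \<in> {0..1}"
  by (auto simp: ins_def PiE_def Pi_def)

lemma ucube_subset: "ucube n \<subseteq> {..<n} \<rightarrow>\<^sub>E {0..1}"
  by (rule PiE_mono) auto

lemma smooth_has_vector_derivative_line:
  assumes "smooth_on UNIV F"
  shows "((\<lambda>s. F (a + s *\<^sub>R w)) has_vector_derivative frechet_derivative F (at (a + r *\<^sub>R w)) w) (at r)"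
proof -
  have F': "(F has_derivative frechet_derivative F (at (a + r *\<^sub>R w))) (at (a + r *\<^sub>R w))"
    by (rule smooth_on_has_derivative[OF open_UNIV assms UNIV_I])
  have "((\<lambda>s. a + s *\<^sub>R w) has_derivative (\<lambda>s. s *\<^sub>R w)) (at r)" by (auto intro!: derivative_eq_intros)
  from diff_chain_at[OF this F'] show ?thesis
    by (simp add: o_def has_vector_derivative_def linear_cmul[OF has_derivative_linear[OF F']])
qed

lemma emb_line_derivative:
  fixes F :: "'a::euclidean_space \<Rightarrow> 'b::euclidean_space"
  assumes F: "smooth_on UNIV F" and i: "i < DIM('a)"
  shows "((\<lambda>s. F (emb (t(i := s)))) has_vector_derivative
    frechet_derivative F (at (emb (t(i := r)))) (ordered_basis ! i)) (at r)"
proof -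
  define a :: 'a where "a = emb t - t i *\<^sub>R ordered_basis ! i"
  have "(emb (t(i := s)) :: 'a) = a + s *\<^sub>R ordered_basis ! i" for s
    unfolding emb_update[OF i] a_def by (simp add: algebra_simps)
  then show ?thesis using smooth_has_vector_derivative_line[OF F, of a "ordered_basis ! i" r]
    by (simp only:)
qed

lemma integral_Ioo_FTC:
  fixes F :: "real \<Rightarrow> real"
  assumes "\<And>x. (F has_real_derivative f x) (at x)" "continuous_on UNIV f"
  shows "(LINT x:{0<..<1}|lborel. f x) = F 1 - F 0"
proof -
  have "has_bochner_integral lborel (\<lambda>x. f x * indicator {0..1} x) (F 1 - F 0)"
    by (rule has_bochner_integral_FTC_Icc_real)
      (use assms in \<open>auto simp: continuous_on_eq_continuous_at\<close>)
  then have "(\<integral>x. f x * indicator {0..1} x \<partial>lborel) = F 1 - F 0"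
    by (rule has_bochner_integral_integral_eq)
  moreover have "(LINT x:{0<..<1}|lborel. f x) = (\<integral>x. f x * indicator {0..1} x \<partial>lborel)"
    unfolding set_lebesgue_integral_def
  proof (rule integral_cong_AE)
    have f: "f \<in> borel_measurable borel" using assms(2) by (rule borel_measurable_continuous_onI)
    then show "(\<lambda>x. indicator {0<..<1} x *\<^sub>R f x) \<in> borel_measurable lborel"
      "(\<lambda>x. f x * indicator {0..1} x) \<in> borel_measurable lborel" by auto
    show "AE x in lborel. indicator {0<..<1} x *\<^sub>R f x = f x * indicator {0..1} x"
      using AE_lborel_singleton[of "0::real"] AE_lborel_singleton[of "1::real"]
      by eventually_elim (auto simp: indicator_def)
  qed
  ultimately show ?thesis by simp
qed

text \<open>By Fubini, coordinate i is integrated first. The fundamental theorem of calculus leaves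
  the difference over two opposite faces, and the remaining index set \<open>I\<close> is renumbered
  to an initial segment.\<close>

lemma cube_ftc:
  fixes F :: "'a::euclidean_space \<Rightarrow> real"
  assumes n: "DIM('a) = Suc n" and F: "smooth_on UNIV F" and i: "i < Suc n"
  shows "(LINT t:ucube (Suc n)|lebesgue_cube (Suc n). frechet_derivative F (at (emb t)) (ordered_basis ! i))
    = (LINT t:ucube n|lebesgue_cube n. F (emb (ins i 1 t)) - F (emb (ins i 0 t)))"
proof -
  interpret product_sigma_finite "\<lambda>_::nat. lborel :: real measure" by (rule product_sigma_finite_lborel)
  define I where "I = {..<Suc n} - {i}"
  have I: "{..<Suc n} = insert i I" "finite I" "i \<notin> I" using i by (auto simp: I_def)
  let ?F' = "\<lambda>x. frechet_derivative F (at x) (ordered_basis ! i)"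
  have contF': "continuous_on UNIV ?F'" by (rule smooth_on_continuous[OF smooth_on_frechet[OF F]])
  have contF: "continuous_on UNIV F" by (rule smooth_on_continuous[OF F])
  let ?g = "\<lambda>t. indicator (ucube (Suc n)) t *\<^sub>R ?F' (emb t)"
  have int: "integrable (PiM (insert i I) (\<lambda>_. lborel)) ?g"
    unfolding set_integrable_def[symmetric] I(1)[symmetric]
    by (rule set_integrable_emb[OF contF', of "\<lambda>t. t"]) (simp_all only: n measurable_component_lborel lessThan_iff ucube_01)
  let ?O = "Pi\<^sub>E I (\<lambda>_. {0<..<1::real})"
  let ?d = "\<lambda>x. F (emb (x(i := 1))) - F (emb (x(i := 0)))"
  have inner: "(\<integral>y. ?g (x(i := y)) \<partial>lborel) = indicator ?O x *\<^sub>R ?d x"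
    if x: "x \<in> space (PiM I (\<lambda>_. lborel :: real measure))" for x
  proof -
    have "x \<in> extensional I" using x by (simp add: space_PiM PiE_def)
    then have "indicator (ucube (Suc n)) (x(i := y)) = indicator ?O x * (indicator {0<..<1} y :: real)" for y
      unfolding I(1) using I(3)
      by (auto simp: indicator_def PiE_def Pi_def extensional_def split: if_splits)
    then have "(\<integral>y. ?g (x(i := y)) \<partial>lborel) = indicator ?O x * (LINT y:{0<..<1}|lborel. ?F' (emb (x(i := y))))"
      by (simp add: set_lebesgue_integral_def mult.assoc)
    also have "(LINT y:{0<..<1}|lborel. ?F' (emb (x(i := y)))) = F (emb (x(i := 1))) - F (emb (x(i := 0)))"
    proof (rule integral_Ioo_FTC)
      show "((\<lambda>y. F (emb (x(i := y)))) has_real_derivative ?F' (emb (x(i := y)))) (at y)" for y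
        using emb_line_derivative[OF F, of i x y] i n
        by (simp add: has_real_derivative_iff_has_vector_derivative)
      have "continuous_on UNIV (\<lambda>y. emb (x(i := y)) :: 'a)"
        unfolding emb_update[OF i[folded n]] by (intro continuous_intros)
      then show "continuous_on UNIV (\<lambda>y. ?F' (emb (x(i := y))))"
        by (rule continuous_on_compose2[OF contF']) auto
    qed
    finally show ?thesis by (simp only: real_scaleR_def)
  qed
  define pos where "pos j = (if j < i then j else j - 1)" for j
  have pos: "bij_betw pos I {..<n}"
    by (rule bij_betw_byWitness[where f'="skip i"]) (use i in \<open>auto simp: I_def pos_def skip_def\<close>)
  let ?T = "\<lambda>t::nat \<Rightarrow> real. \<lambda>j\<in>I. t (pos j)"
  have posn: "pos j \<in> {..<n}" if "j \<in> I" for j using pos that by (auto simp: bij_betw_def)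
  have mT: "?T \<in> measurable (lebesgue_cube n) (PiM I (\<lambda>_. lborel))"
    by (intro measurable_restrict measurable_component_singleton posn)
  have T: "emb ((?T t)(i := s)) = (emb (ins i s t) :: 'a)" for t s
    unfolding emb_def by (rule sum.cong) (auto simp: n I_def pos_def ins_def)
  have TO: "indicator ?O (?T t) = (indicator (ucube n) t :: real)"
    if "t \<in> space (lebesgue_cube n)" for t
  proof -
    have "?T t \<in> ?O \<longleftrightarrow> (\<forall>j\<in>I. t (pos j) \<in> {0<..<1})" by (auto simp: PiE_def Pi_def)
    also have "\<dots> \<longleftrightarrow> (\<forall>l\<in>pos ` I. t l \<in> {0<..<1})" by simp
    also have "\<dots> \<longleftrightarrow> (\<forall>l\<in>{..<n}. t l \<in> {0<..<1})"
      by (simp only: bij_betw_imp_surj_on[OF pos])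
    also have "\<dots> \<longleftrightarrow> t \<in> ucube n" using that by (auto simp: space_PiM PiE_def Pi_def)
    finally show ?thesis by (simp add: indicator_def)
  qed
  have md: "(\<lambda>x. F (emb (x(i := s)) :: 'a)) \<in> borel_measurable (PiM I (\<lambda>_. lborel))" for s
  proof (rule measurable_compose[OF measurable_emb_compose borel_measurable_continuous_onI[OF contF]])
    fix j assume "j < DIM('a)"
    then show "(\<lambda>x. (x(i := s)) j) \<in> borel_measurable (PiM I (\<lambda>_. lborel :: real measure))"
      using n by (cases "j = i") (auto simp: I_def intro!: measurable_component_lborel)
  qed
  have O: "?O \<in> sets (PiM I (\<lambda>_. lborel))" by (intro sets_PiM_I_finite I) auto
  have "(LINT t:ucube (Suc n)|lebesgue_cube (Suc n). ?F' (emb t)) = (\<integral>x. (\<integral>y. ?g (x(i := y)) \<partial>lborel) \<partial>PiM I (\<lambda>_. lborel))"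
    unfolding set_lebesgue_integral_def I(1) by (rule product_integral_insert[OF I(2,3) int[unfolded I(1)]])
  also have "\<dots> = (\<integral>x. indicator ?O x *\<^sub>R ?d x \<partial>PiM I (\<lambda>_. lborel))"
    by (rule Bochner_Integration.integral_cong[OF refl inner])
  also have "\<dots> = (\<integral>x. indicator ?O x *\<^sub>R ?d x \<partial>distr (lebesgue_cube n) (PiM I (\<lambda>_. lborel)) ?T)"
    unfolding distr_PiM_lborel_reindex[OF I(2) pos] ..
  also have "\<dots> = (\<integral>t. indicator ?O (?T t) *\<^sub>R ?d (?T t) \<partial>lebesgue_cube n)"
    by (rule integral_distr[OF mT])
      (intro borel_measurable_scaleR borel_measurable_indicator O borel_measurable_diff md)
  also have "\<dots> = (LINT t:ucube n|lebesgue_cube n. F (emb (ins i 1 t)) - F (emb (ins i 0 t)))"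
    unfolding set_lebesgue_integral_def T
    by (rule Bochner_Integration.integral_cong[OF refl]) (simp add: TO)
  finally show ?thesis .
qed

lemma cube_current_emb:
  fixes \<Psi> :: "'a::euclidean_space \<Rightarrow> 'c::euclidean_space"
  assumes \<Psi>: "smooth_on UNIV \<Psi>"
  shows "cube_current DIM('a) (\<lambda>t. \<Psi> (emb t)) \<omega> = (LINT t:ucube DIM('a)|lebesgue_cube DIM('a).
      \<omega> (\<Psi> (emb t)) (map (frechet_derivative \<Psi> (at (emb t))) ordered_basis))"
proof -
  have "map (\<lambda>i. vector_derivative (\<lambda>s. \<Psi> (emb (t(i := s)))) (at (t i))) [0..<DIM('a)]
      = map (frechet_derivative \<Psi> (at (emb t))) ordered_basis" for t
  proof (rule nth_equalityI)
    fix i assume "i < length (map (\<lambda>i. vector_derivative (\<lambda>s. \<Psi> (emb (t(i := s)))) (at (t i))) [0..<DIM('a)])"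
    then have i: "i < DIM('a)" by simp
    show "map (\<lambda>i. vector_derivative (\<lambda>s. \<Psi> (emb (t(i := s)))) (at (t i))) [0..<DIM('a)] ! i
        = map (frechet_derivative \<Psi> (at (emb t))) ordered_basis ! i"
      using vector_derivative_at[OF emb_line_derivative[OF \<Psi> i, of t "t i"]] i by (simp add: ordered_basis(3))
  qed (simp add: ordered_basis(3))
  then show ?thesis by (simp add: cube_current_def)
qed

definition face :: "('a::euclidean_space \<Rightarrow> 'c) \<Rightarrow> nat \<Rightarrow> real \<Rightarrow> (nat \<Rightarrow> real) \<Rightarrow> 'c" where
  "face \<Psi> i s t = \<Psi> (emb (ins i s t))"

lemma cube_current_face:
  fixes \<Psi> :: "'a::euclidean_space \<Rightarrow> 'c::euclidean_space"
  assumes n: "DIM('a) = Suc n" and \<Psi>: "smooth_on UNIV \<Psi>"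
  shows "cube_current n (face \<Psi> i s) \<omega> = (LINT t:ucube n|lebesgue_cube n. \<omega> (\<Psi> (emb (ins i s t)))
      (map (\<lambda>l. frechet_derivative \<Psi> (at (emb (ins i s t))) (ordered_basis ! skip i l)) [0..<n]))"
proof -
  have "map (\<lambda>l. vector_derivative (\<lambda>r. face \<Psi> i s (t(l := r))) (at (t l))) [0..<n]
      = map (\<lambda>l. frechet_derivative \<Psi> (at (emb (ins i s t))) (ordered_basis ! skip i l)) [0..<n]" for t
  proof (rule map_cong[OF refl])
    fix l assume "l \<in> set [0..<n]"
    then have l: "skip i l < DIM('a)" using n by (auto simp: skip_def)
    have "ins i s t = (ins i s t)(skip i l := t l)" using ins_skip(1)[of i s t l] by (auto simp: fun_eq_iff)
    then show "vector_derivative (\<lambda>r. face \<Psi> i s (t(l := r))) (at (t l))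
        = frechet_derivative \<Psi> (at (emb (ins i s t))) (ordered_basis ! skip i l)"
      using vector_derivative_at[OF emb_line_derivative[OF \<Psi> l, of "ins i s t" "t l"]]
      by (simp add: face_def ins_update)
  qed
  note e = this
  show ?thesis unfolding cube_current_def e unfolding face_def ..
qed

lemma smooth_on_form_derivatives:
  fixes \<Psi> :: "'a::euclidean_space \<Rightarrow> 'c::euclidean_space"
  assumes "\<omega> \<in> test_forms n" "smooth_on UNIV \<Psi>"
  shows "smooth_on UNIV (\<lambda>y. \<omega> (\<Psi> y) (map (\<lambda>l. frechet_derivative \<Psi> (at y) (w l)) [0..<n]))"
  by (rule smooth_on_form[OF assms(1) open_UNIV assms(2)]) (rule smooth_on_frechet[OF assms(2)])

lemma continuous_on_form_ordered_basis:
  fixes \<Psi> :: "'a::euclidean_space \<Rightarrow> 'c::euclidean_space"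
  assumes "\<omega> \<in> test_forms DIM('a)" "smooth_on UNIV \<Psi>"
  shows "continuous_on UNIV (\<lambda>y. \<omega> (\<Psi> y) (map (frechet_derivative \<Psi> (at y)) ordered_basis))"
proof -
  have "map (frechet_derivative \<Psi> (at y)) ordered_basis
      = map (\<lambda>l. frechet_derivative \<Psi> (at y) (ordered_basis ! l)) [0..<DIM('a)]" for y
    by (rule nth_equalityI) (simp_all add: ordered_basis(3))
  then show ?thesis using smooth_on_continuous[OF smooth_on_form_derivatives[OF assms]] by simp
qed

text \<open>Links the two descriptions of the competitor: integrality is a statement about cubes,
  while mass is estimated with the radial structure of Euclidean space.\<close>

lemma cube_current_eq_param_current:
  fixes \<Psi> :: "'a::euclidean_space \<Rightarrow> 'c::euclidean_space"
  assumes "\<omega> \<in> test_forms DIM('a)" "smooth_on UNIV \<Psi>"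
  shows "cube_current DIM('a) (\<lambda>t. \<Psi> (emb t)) \<omega> = param_current \<Psi> ubox \<omega>"
  unfolding cube_current_emb[OF assms(2)] param_current_def
  by (rule set_integral_emb[OF borel_measurable_continuous_onI[OF continuous_on_form_ordered_basis[OF assms]]])

text \<open>The oriented boundary of the cube. Coordinates are counted from 0, so the front face of
  the first pair is positive.\<close>

definition face_chain :: "nat \<Rightarrow> ('a::euclidean_space \<Rightarrow> 'c) \<Rightarrow> (int \<times> ((nat \<Rightarrow> real) \<Rightarrow> 'c)) list" where
  "face_chain n \<Psi> = map (\<lambda>i. ((- 1) ^ i, face \<Psi> i 1)) [0..<n] @ map (\<lambda>i. (- ((- 1) ^ i), face \<Psi> i 0)) [0..<n]"

text \<open>\<open>G i\<close> is the coefficient of the pulled back form that omits direction i.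
  The exterior derivative becomes an alternating sum of partial derivatives, each of which
  integrates to a difference of two faces.\<close>

theorem boundary_cube:
  fixes \<Psi> :: "'a::euclidean_space \<Rightarrow> 'c::euclidean_space"
  assumes n: "DIM('a) = Suc n" and \<Psi>: "smooth_on UNIV \<Psi>" and \<omega>: "\<omega> \<in> test_forms n"
  shows "boundary (cube_current (Suc n) (\<lambda>t. \<Psi> (emb t))) \<omega> = chain_current n (face_chain (Suc n) \<Psi>) \<omega>"
proof -
  define G where "G i y = \<omega> (\<Psi> y) (map (\<lambda>l. frechet_derivative \<Psi> (at y) (ordered_basis ! skip i l)) [0..<n])" for i y
  have G: "smooth_on UNIV (G i)" for i
    unfolding G_def[abs_def] by (rule smooth_on_form_derivatives[OF \<omega> \<Psi>])
  let ?G' = "\<lambda>i t. frechet_derivative (G i) (at (emb t)) (ordered_basis ! i)"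
  have int': "integrable (lebesgue_cube (Suc n)) (\<lambda>t. indicator (ucube (Suc n)) t *\<^sub>R ?G' i t)" for i
    unfolding set_integrable_def[symmetric]
    by (rule set_integrable_emb[OF smooth_on_continuous[OF smooth_on_frechet[OF G]], of "\<lambda>t. t"])
      (simp_all only: n measurable_component_lborel lessThan_iff ucube_01)
  have intf: "set_integrable (lebesgue_cube n) (ucube n) (\<lambda>t. G i (emb (ins i s t)))"
    if "i < Suc n" "s \<in> {0..1}" for i s
    by (rule set_integrable_emb[OF smooth_on_continuous[OF G]])
      (use n ins_measurable ins_01 ucube_subset[of n] that in auto)
  have "boundary (cube_current (Suc n) (\<lambda>t. \<Psi> (emb t))) \<omega>
      = (LINT t:ucube (Suc n)|lebesgue_cube (Suc n). (\<Sum>i<Suc n. (- 1) ^ i * ?G' i t))"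
    unfolding boundary_def cube_current_emb[OF \<Psi>, unfolded n] G_def
    by (subst ext_deriv_pullback[OF \<omega> \<Psi>]) (simp_all add: ordered_basis(3) n)
  also have "\<dots> = (\<Sum>i<Suc n. (- 1) ^ i * (LINT t:ucube (Suc n)|lebesgue_cube (Suc n). ?G' i t))"
  proof -
    have e: "indicator (ucube (Suc n)) t *\<^sub>R (\<Sum>i<Suc n. (- 1) ^ i * ?G' i t)
        = (\<Sum>i<Suc n. (- 1) ^ i * (indicator (ucube (Suc n)) t *\<^sub>R ?G' i t))" for t
      by (simp add: sum_distrib_left mult_ac del: sum.lessThan_Suc)
    have "(\<integral>t. (\<Sum>i<Suc n. (- 1) ^ i * (indicator (ucube (Suc n)) t *\<^sub>R ?G' i t)) \<partial>lebesgue_cube (Suc n))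
        = (\<Sum>i<Suc n. (\<integral>t. (- 1) ^ i * (indicator (ucube (Suc n)) t *\<^sub>R ?G' i t) \<partial>lebesgue_cube (Suc n)))"
      by (rule Bochner_Integration.integral_sum) (rule integrable_mult_right[OF int'])
    then show ?thesis unfolding set_lebesgue_integral_def e by (simp only: integral_mult_right_zero)
  qed
  also have "\<dots> = (\<Sum>i<Suc n. (- 1) ^ i * (cube_current n (face \<Psi> i 1) \<omega> - cube_current n (face \<Psi> i 0) \<omega>))"
  proof (rule sum.cong[OF refl])
    fix i assume "i \<in> {..<Suc n}"
    then have i: "i < Suc n" by simp
    have "(LINT t:ucube (Suc n)|lebesgue_cube (Suc n). ?G' i t)
        = (LINT t:ucube n|lebesgue_cube n. G i (emb (ins i 1 t)) - G i (emb (ins i 0 t)))"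
      by (rule cube_ftc[OF n G i])
    also have "\<dots> = (LINT t:ucube n|lebesgue_cube n. G i (emb (ins i 1 t))) - (LINT t:ucube n|lebesgue_cube n. G i (emb (ins i 0 t)))"
      by (rule set_integral_diff(2)[OF intf[OF i] intf[OF i]]) auto
    also have "\<dots> = cube_current n (face \<Psi> i 1) \<omega> - cube_current n (face \<Psi> i 0) \<omega>"
      unfolding cube_current_face[OF n \<Psi>] G_def ..
    finally show "(- 1) ^ i * (LINT t:ucube (Suc n)|lebesgue_cube (Suc n). ?G' i t)
        = (- 1) ^ i * (cube_current n (face \<Psi> i 1) \<omega> - cube_current n (face \<Psi> i 0) \<omega>)" by simp
  qed
  also have "\<dots> = chain_current n (face_chain (Suc n) \<Psi>) \<omega>"
    by (simp add: chain_current_def face_chain_def o_def interv_sum_list_conv_sum_set_nat atLeast0LessThan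
        sum_subtractf right_diff_distrib sum_negf del: sum.lessThan_Suc upt_Suc)
  finally show ?thesis .
qed

subsection \<open>Smooth cubes are integral currents\<close>

lemma smooth_lipschitz_cubox:
  fixes \<Psi> :: "'a::euclidean_space \<Rightarrow> 'c::euclidean_space"
  assumes \<Psi>: "smooth_on UNIV \<Psi>"
  obtains B where "B \<ge> 0" "\<And>x y. x \<in> cubox \<Longrightarrow> y \<in> cubox \<Longrightarrow> norm (\<Psi> x - \<Psi> y) \<le> B * norm (x - y)"
proof -
  have "\<exists>C. \<forall>x\<in>cubox. norm (frechet_derivative \<Psi> (at x) b) \<le> C" for b
  proof -
    have "bounded ((\<lambda>x. frechet_derivative \<Psi> (at x) b) ` cubox)"
      using smooth_on_continuous[OF smooth_on_frechet[OF \<Psi>]] cubox(1)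
      by (intro compact_imp_bounded compact_continuous_image) (auto intro: continuous_on_subset)
    then show ?thesis by (auto simp: bounded_iff)
  qed
  then obtain C where C: "\<And>b x. x \<in> cubox \<Longrightarrow> norm (frechet_derivative \<Psi> (at x) b) \<le> C b" by metis
  define B where "B = (\<Sum>b\<in>Basis. \<bar>C b\<bar>)"
  have "norm (\<Psi> x - \<Psi> y) \<le> B * norm (x - y)" if "x \<in> cubox" "y \<in> cubox" for x y
  proof (rule differentiable_bound[OF cubox(2) _ _ that])
    fix z :: 'a assume z: "z \<in> cubox"
    have D: "(\<Psi> has_derivative frechet_derivative \<Psi> (at z)) (at z)"
      by (rule smooth_on_has_derivative[OF open_UNIV \<Psi> UNIV_I])
    then show "(\<Psi> has_derivative frechet_derivative \<Psi> (at z)) (at z within cubox)"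
      by (rule has_derivative_at_withinI)
    show "onorm (frechet_derivative \<Psi> (at z)) \<le> B"
    proof (rule onorm_bound)
      fix v :: 'a
      note l = has_derivative_linear[OF D]
      have "frechet_derivative \<Psi> (at z) v = frechet_derivative \<Psi> (at z) (\<Sum>b\<in>Basis. (v \<bullet> b) *\<^sub>R b)"
        by (simp add: euclidean_representation)
      also have "\<dots> = (\<Sum>b\<in>Basis. (v \<bullet> b) *\<^sub>R frechet_derivative \<Psi> (at z) b)"
        by (simp add: linear_sum[OF l] linear_cmul[OF l])
      also have "norm \<dots> \<le> (\<Sum>b\<in>Basis. norm v * \<bar>C b\<bar>)"
        by (rule sum_norm_le) (use C[OF z] Basis_le_norm abs_ge_self order_trans in \<open>fastforce intro!: mult_mono\<close>)
      finally show "norm (frechet_derivative \<Psi> (at z) v) \<le> B * norm v"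
        by (simp add: B_def sum_distrib_left mult.commute)
    qed (simp add: B_def sum_nonneg)
  qed
  moreover have "B \<ge> 0" by (simp add: B_def sum_nonneg)
  ultimately show ?thesis using that by blast
qed

lemma norm_emb_diff: "norm (emb s - emb t :: 'a::euclidean_space) \<le> (\<Sum>j<DIM('a). \<bar>s j - t j\<bar>)"
proof -
  have "emb s - emb t = (\<Sum>j<DIM('a). (s j - t j) *\<^sub>R (ordered_basis ! j :: 'a))"
    by (simp add: emb_def sum_subtractf[symmetric] algebra_simps)
  also have "norm \<dots> \<le> (\<Sum>j<DIM('a). \<bar>s j - t j\<bar>)"
  proof (rule sum_norm_le)
    fix j assume "j \<in> {..<DIM('a)}"
    then have "ordered_basis ! j \<in> (Basis :: 'a set)" using ordered_basis(2,3)[where 'a='a] nth_mem by (metis lessThan_iff)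
    then show "norm ((s j - t j) *\<^sub>R (ordered_basis ! j :: 'a)) \<le> \<bar>s j - t j\<bar>" by simp
  qed
  finally show ?thesis .
qed

lemma lipschitz_cube_emb:
  fixes \<Psi> :: "'a::euclidean_space \<Rightarrow> 'c::euclidean_space"
  assumes \<Psi>: "smooth_on UNIV \<Psi>"
  shows "lipschitz_cube DIM('a) (\<Psi> ` cubox) (\<lambda>t. \<Psi> (emb t))"
    and "DIM('a) = Suc n \<Longrightarrow> i < Suc n \<Longrightarrow> r \<in> {0..1} \<Longrightarrow> lipschitz_cube n (\<Psi> ` cubox) (face \<Psi> i r)"
proof -
  obtain B where B: "B \<ge> 0" "\<And>x y. x \<in> cubox \<Longrightarrow> y \<in> cubox \<Longrightarrow> norm (\<Psi> x - \<Psi> y) \<le> B * norm (x - y)"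
    using smooth_lipschitz_cubox[OF \<Psi>] by blast
  have c: "(emb t :: 'a) \<in> cubox" if "t \<in> {..<DIM('a)} \<rightarrow>\<^sub>E {0..1}" for t
    using that by (intro emb_in_cubox) (auto simp: PiE_def Pi_def)
  have "norm (\<Psi> (emb s) - \<Psi> (emb t)) \<le> B * (\<Sum>j<DIM('a). \<bar>s j - t j\<bar>)"
    if "s \<in> {..<DIM('a)} \<rightarrow>\<^sub>E {0..1}" "t \<in> {..<DIM('a)} \<rightarrow>\<^sub>E {0..1}" for s t
    using order_trans[OF B(2)[OF c[OF that(1)] c[OF that(2)]] mult_left_mono[OF norm_emb_diff B(1)]] .
  then show "lipschitz_cube DIM('a) (\<Psi> ` cubox) (\<lambda>t. \<Psi> (emb t))"
    unfolding lipschitz_cube_def using c by blast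
  assume n: "DIM('a) = Suc n" and i: "i < Suc n" and r: "r \<in> {0..1}"
  have c': "(emb (ins i r t) :: 'a) \<in> cubox" if "t \<in> {..<n} \<rightarrow>\<^sub>E {0..1}" for t
    using ins_01[OF that r i] n by (intro emb_in_cubox) auto
  have "(\<Sum>j<Suc n. \<bar>ins i r s j - ins i r t j\<bar>) = (\<Sum>l<n. \<bar>s l - t l\<bar>)" for s t
  proof -
    have "(\<Sum>j<Suc n. \<bar>ins i r s j - ins i r t j\<bar>) = (\<Sum>j\<in>{..<Suc n} - {i}. \<bar>ins i r s j - ins i r t j\<bar>)"
      using i by (subst sum.remove[of _ i]) (auto simp: ins_skip simp del: sum.lessThan_Suc)
    also have "\<dots> = (\<Sum>l<n. \<bar>ins i r s (skip i l) - ins i r t (skip i l)\<bar>)"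
      by (rule sum.reindex_bij_betw[OF bij_betw_skip[OF i], symmetric])
    finally show ?thesis by (simp add: ins_skip)
  qed
  then have "norm (face \<Psi> i r s - face \<Psi> i r t) \<le> B * (\<Sum>l<n. \<bar>s l - t l\<bar>)"
    if "s \<in> {..<n} \<rightarrow>\<^sub>E {0..1}" "t \<in> {..<n} \<rightarrow>\<^sub>E {0..1}" for s t
    unfolding face_def
    using order_trans[OF B(2)[OF c'[OF that(1)] c'[OF that(2)]] mult_left_mono[OF norm_emb_diff B(1)]] n by simp
  then show "lipschitz_cube n (\<Psi> ` cubox) (face \<Psi> i r)"
    unfolding lipschitz_cube_def face_def using c' by blast
qed

lemma mass_zero:
  assumes "\<And>\<omega>. \<omega> \<in> test_forms k \<Longrightarrow> T \<omega> = 0"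
  shows "mass k T \<le> 0"
  unfolding mass_def using assms by (auto intro!: SUP_least)

lemma ext_deriv_combination:
  assumes "\<omega> \<in> test_forms k" "\<eta> \<in> test_forms k"
  shows "ext_deriv (\<lambda>x vs. a * \<omega> x vs + b * \<eta> x vs) = (\<lambda>x vs. a * ext_deriv \<omega> x vs + b * ext_deriv \<eta> x vs)"
proof (intro ext)
  fix x and vs :: "'a list"
  note s = test_formsD(2)[OF assms(1)] test_formsD(2)[OF assms(2)]
  have "frechet_derivative (\<lambda>y. a * \<omega> y us + b * \<eta> y us) (at x) v
      = a * frechet_derivative (\<lambda>y. \<omega> y us) (at x) v + b * frechet_derivative (\<lambda>y. \<eta> y us) (at x) v" for us v
    by (subst frechet_derivative_smooth_add)
      (auto simp: frechet_derivative_smooth_cmult s intro!: smooth_on_linear[OF bounded_linear_mult_right] s)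
  then show "ext_deriv (\<lambda>x vs. a * \<omega> x vs + b * \<eta> x vs) x vs = a * ext_deriv \<omega> x vs + b * ext_deriv \<eta> x vs"
    by (simp add: ext_deriv_def sum.distrib sum_distrib_left algebra_simps)
qed

text \<open>Both the cube and, by Stokes, its boundary are Lipschitz chains on the nose, so the
  approximation error in \<open>rectifiable_current\<close> is 0 for every \<epsilon>.\<close>

theorem integral_current_cube:
  fixes \<Psi> :: "'a::euclidean_space \<Rightarrow> 'c::euclidean_space"
  assumes n: "DIM('a) = Suc n" and \<Psi>: "smooth_on UNIV \<Psi>"
  shows "integral_current DIM('a) (cube_current DIM('a) (\<lambda>t. \<Psi> (emb t)))"
proof -
  let ?S = "cube_current DIM('a) (\<lambda>t. \<Psi> (emb t))"
  have lin: "?S (\<lambda>x vs. a * \<omega> x vs + b * \<eta> x vs) = a * ?S \<omega> + b * ?S \<eta>"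
    if "\<omega> \<in> test_forms DIM('a)" "\<eta> \<in> test_forms DIM('a)" for \<omega> \<eta> a b
  proof -
    have int: "set_integrable (lebesgue_cube DIM('a)) (ucube DIM('a))
        (\<lambda>t. \<omega> (\<Psi> (emb t)) (map (frechet_derivative \<Psi> (at (emb t))) ordered_basis))"
      if "\<omega> \<in> test_forms DIM('a)" for \<omega>
      by (rule set_integrable_emb[OF continuous_on_form_ordered_basis[OF that \<Psi>], of "\<lambda>t. t"])
       (simp_all only: measurable_component_lborel lessThan_iff ucube_01)
    show ?thesis unfolding cube_current_emb[OF \<Psi>]
      using int[OF that(1)] int[OF that(2)] by (simp add: set_integral_add set_integral_mult_right)
  qed
  have compact: "compact (\<Psi> ` cubox)"
    by (intro compact_continuous_image cubox continuous_on_subset[OF smooth_on_continuous[OF \<Psi>]]) auto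
  have "rectifiable_current DIM('a) ?S"
    unfolding rectifiable_current_def
  proof (intro conjI exI[of _ "\<Psi> ` cubox"] allI impI exI[of _ "[(1, \<lambda>t. \<Psi> (emb t))]"])
    show "linear_current DIM('a) ?S" unfolding linear_current_def using lin by blast
    fix \<epsilon> :: real assume e: "\<epsilon> > 0"
    have "mass DIM('a) (\<lambda>\<omega>. ?S \<omega> - chain_current DIM('a) [(1, \<lambda>t. \<Psi> (emb t))] \<omega>) \<le> 0"
      by (rule mass_zero) (simp add: chain_current_def)
    then show "mass DIM('a) (\<lambda>\<omega>. ?S \<omega> - chain_current DIM('a) [(1, \<lambda>t. \<Psi> (emb t))] \<omega>) < ereal \<epsilon>"
      using e by (simp add: le_less_trans zero_ereal_def)
  qed (use compact lipschitz_cube_emb(1)[OF \<Psi>] in auto)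
  moreover have "rectifiable_current n (boundary ?S)"
    unfolding rectifiable_current_def
  proof (intro conjI exI[of _ "\<Psi> ` cubox"] allI impI exI[of _ "face_chain (Suc n) \<Psi>"])
    show "linear_current n (boundary ?S)"
      unfolding linear_current_def boundary_def
    proof (intro ballI allI)
      fix \<omega> \<eta> :: "'c form" and a b :: real
      assume "\<omega> \<in> test_forms n" "\<eta> \<in> test_forms n"
      note t = this[THEN ext_deriv_test_form, folded n]
      show "?S (ext_deriv (\<lambda>x vs. a * \<omega> x vs + b * \<eta> x vs)) = a * ?S (ext_deriv \<omega>) + b * ?S (ext_deriv \<eta>)"
        unfolding ext_deriv_combination[OF \<open>\<omega> \<in> _\<close> \<open>\<eta> \<in> _\<close>] by (rule lin[OF t])
    qed
    fix \<epsilon> :: real assume e: "\<epsilon> > 0"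
    have "mass n (\<lambda>\<omega>. boundary ?S \<omega> - chain_current n (face_chain (Suc n) \<Psi>) \<omega>) \<le> 0"
      by (rule mass_zero) (simp add: boundary_cube[OF n \<Psi>] n)
    then show "mass n (\<lambda>\<omega>. boundary ?S \<omega> - chain_current n (face_chain (Suc n) \<Psi>) \<omega>) < ereal \<epsilon>"
      using e by (simp add: le_less_trans zero_ereal_def)
  qed (use compact lipschitz_cube_emb(2)[OF \<Psi> n] in \<open>auto simp: face_chain_def\<close>)
  ultimately show ?thesis unfolding n by simp
qed

section \<open>Adapted frames\<close>

lemma quadratic_nonpos_linear_coeff:
  fixes c d :: real
  assumes "\<And>t. 2 * t * c + t\<^sup>2 * d \<le> 0"
  shows "c = 0"
proof (rule ccontr)
  assume "c \<noteq> 0"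
  \<comment> \<open>At t = c / m the quadratic term is too small to outweigh the linear one, because
    2m + d > 0.\<close>
  define m where "m = \<bar>d\<bar> + 1"
  have m: "m > 0" by (simp add: m_def)
  have "2 * (c / m) * c + (c / m)\<^sup>2 * d = c\<^sup>2 * (2 * m + d) / m\<^sup>2"
    using m by (simp add: field_simps power2_eq_square)
  moreover have "2 * m + d > 0" by (simp add: m_def)
  ultimately have "2 * (c / m) * c + (c / m)\<^sup>2 * d > 0" using m \<open>c \<noteq> 0\<close> by simp
  then show False using assms[of "c / m"] by simp
qed

lemma subspace_orthonormal_list:
  fixes S :: "'a::euclidean_space set"
  assumes "subspace S"
  obtains es where "orthonormal es" "set es \<subseteq> S" "length es = dim S"
proof -
  obtain B where B: "B \<subseteq> S" "pairwise orthogonal B" "\<And>x. x \<in> B \<Longrightarrow> norm x = 1" "independent B" "card B = dim S"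
    using orthonormal_basis_subspace[OF assms] by metis
  obtain es where es: "set es = B" "distinct es"
    using finite_distinct_list[OF independent_imp_finite[OF B(4)]] by blast
  have "orthonormal es"
    unfolding orthonormal_def
  proof (intro allI impI)
    fix i j assume ij: "i < length es" "j < length es"
    then have m: "es ! i \<in> B" "es ! j \<in> B" using es by auto
    show "es ! i \<bullet> es ! j = (if i = j then 1 else 0)"
      using B(2,3) m ij es(2)
      by (auto simp: norm_eq_1 pairwise_def orthogonal_def nth_eq_iff_index_eq)
  qed
  moreover have "length es = dim S" using distinct_card[OF es(2)] es(1) B(5) by simp
  ultimately show ?thesis using that B(1) es(1) by blast
qed

text \<open>A maximizer of \<open>\<bar>A v\<bar>\<close> on the unit sphere of \<open>U\<close> is a singular vector of \<open>A\<close> restricted to \<open>U\<close>.\<close>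

lemma max_singular_vector:
  fixes A :: "'a::euclidean_space \<Rightarrow> 'b::euclidean_space"
  assumes A: "linear A" and U: "subspace U" and v: "v \<in> U" "A v \<noteq> 0"
  obtains v0 s where "v0 \<in> U" "norm v0 = 1" "s > 0" "\<And>w. w \<in> U \<Longrightarrow> A v0 \<bullet> A w = s * (v0 \<bullet> w)"
proof -
  let ?K = "U \<inter> sphere 0 1"
  have cK: "compact ?K" by (rule closed_Int_compact[OF closed_subspace[OF U] compact_sphere])
  have v0: "v \<noteq> 0" using v(2) linear_0[OF A] by auto
  then have vK: "sgn v \<in> ?K" using v(1) U by (simp add: norm_sgn sgn_div_norm subspace_scale)
  have contA: "continuous_on ?K (\<lambda>w. A w \<bullet> A w)"
    by (intro continuous_intros linear_continuous_on A[unfolded linear_conv_bounded_linear])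
  obtain v0 where v0: "v0 \<in> ?K" "\<And>w. w \<in> ?K \<Longrightarrow> A w \<bullet> A w \<le> A v0 \<bullet> A v0"
    using continuous_attains_sup[OF cK _ contA] vK by blast
  define s where "s = A v0 \<bullet> A v0"
  have "A (sgn v) \<noteq> 0" using v(2) linear_cmul[OF A, of "inverse (norm v)" v] \<open>v \<noteq> 0\<close> by (simp add: sgn_div_norm)
  then have s: "s > 0" using v0(2)[OF vK] by (simp add: s_def) (metis inner_gt_zero_iff less_le_trans inner_eq_zero_iff)
  have le: "A w \<bullet> A w \<le> s * (w \<bullet> w)" if "w \<in> U" for w
  proof (cases "w = 0")
    case False
    then have "sgn w \<in> ?K" using that U by (simp add: norm_sgn sgn_div_norm subspace_scale)
    from v0(2)[OF this] have "A (sgn w) \<bullet> A (sgn w) \<le> s" by (simp add: s_def)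
    then have "(norm w)\<^sup>2 * (A (sgn w) \<bullet> A (sgn w)) \<le> (norm w)\<^sup>2 * s"
      by (intro mult_left_mono) auto
    moreover have "A w = norm w *\<^sub>R A (sgn w)"
      using False linear_cmul[OF A, of "norm w" "sgn w"] by (simp add: sgn_div_norm)
    ultimately show ?thesis by (simp add: dot_square_norm power_mult_distrib mult.commute)
  qed (simp add: linear_0[OF A])
  have "A v0 \<bullet> A w = s * (v0 \<bullet> w)" if w: "w \<in> U" for w
  proof -
    have "2 * t * (A v0 \<bullet> A w - s * (v0 \<bullet> w)) + t\<^sup>2 * (A w \<bullet> A w - s * (w \<bullet> w)) \<le> 0" for t
    proof -
      have "v0 + t *\<^sub>R w \<in> U" using v0(1) w U by (simp add: subspace_add subspace_scale)
      from le[OF this] have "A v0 \<bullet> A v0 + 2 * t * (A v0 \<bullet> A w) + t\<^sup>2 * (A w \<bullet> A w)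
          \<le> s * (v0 \<bullet> v0 + 2 * t * (v0 \<bullet> w) + t\<^sup>2 * (w \<bullet> w))"
        by (simp add: linear_add[OF A] linear_cmul[OF A] inner_add_left inner_add_right inner_commute
            power2_eq_square algebra_simps)
      moreover have "v0 \<bullet> v0 = 1" using v0(1) by (simp add: norm_eq_1)
      ultimately show ?thesis by (simp add: s_def algebra_simps)
    qed
    then show ?thesis using quadratic_nonpos_linear_coeff by fastforce
  qed
  then show ?thesis using that[of v0 s] v0(1) s by auto
qed

text \<open>The frame consists of x, a basis of the singular space of \<mu>, and a basis of its
  complement \<open>U\<close> in the tangent space. The differential is 0 on \<open>U\<close>:
  otherwise a maximal singular vector in \<open>U\<close> would produce a nonzero singular value
  whose singular space is not that of \<mu>.\<close>

lemma adapted_frame: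
  fixes f :: "'a::euclidean_space \<Rightarrow> 'b::euclidean_space"
  assumes n: "DIM('a) = n + 1" and x: "norm x = 1" and A: "linear (sphere_deriv f x)"
    and mu: "\<mu> > 0" "singular_mult f x \<mu> = p"
    and only: "\<And>\<sigma>. singular_value f x \<sigma> \<Longrightarrow> \<sigma> \<noteq> 0 \<Longrightarrow> \<sigma> = \<mu>"
  obtains es where "orthonormal es" "length es = n + 1" "es ! 0 = x" "p \<le> n"
    "\<And>i j. i < n \<Longrightarrow> j < n \<Longrightarrow> sphere_deriv f x (es ! Suc i) \<bullet> sphere_deriv f x (es ! Suc j) =
      (if i = j \<and> i < p then \<mu>\<^sup>2 else 0)"
proof -
  let ?A = "sphere_deriv f x" and ?T = "sphere_tangent x"
  have T: "subspace ?T" by (auto simp: sphere_tangent_def subspace_def inner_add_left)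
  have "?T = {v. x \<bullet> v = 0}" by (auto simp: sphere_tangent_def inner_commute)
  moreover have x0: "x \<noteq> 0" using x by auto
  ultimately have dT: "dim ?T = n" using dim_hyperplane[OF x0] n by simp
  define V where "V = singular_space f x \<mu>"
  have V: "subspace V" "V \<subseteq> ?T"
    using T by (auto simp: V_def singular_space_def subspace_def linear_0[OF A] linear_add[OF A] linear_cmul[OF A]
      inner_add_left algebra_simps)
  have dV: "dim V = p" using mu(2) by (simp add: singular_mult_def V_def)
  define U where "U = {y \<in> ?T. \<forall>w\<in>V. orthogonal w y}"
  have U: "subspace U" "U \<subseteq> ?T"
    using T by (auto simp: U_def subspace_def orthogonal_def inner_add_right)
  have dU: "dim U + p = n"
    using dim_subspace_orthogonal_to_vectors[OF V(1) T V(2)] dT dV by (simp add: U_def)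
  have AU: "?A v = 0" if v: "v \<in> U" for v
  proof (rule ccontr)
    assume "?A v \<noteq> 0"
    then obtain v0 s where v0: "v0 \<in> U" "norm v0 = 1" "s > 0"
      "\<And>w. w \<in> U \<Longrightarrow> ?A v0 \<bullet> ?A w = s * (v0 \<bullet> w)"
      using max_singular_vector[OF A U(1) v] by metis
    \<comment> \<open>The singular equation extends from \<open>U\<close> to all tangent vectors,
      since for the component in \<open>V\<close> both sides vanish by orthogonality to
      \<open>v0\<close>.\<close>
    have "?A v0 \<bullet> ?A w = s * (v0 \<bullet> w)" if w: "w \<in> ?T" for w
    proof -
      obtain y z where yz: "y \<in> span V" "\<And>u. u \<in> span V \<Longrightarrow> orthogonal z u" "w = y + z"
        using orthogonal_subspace_decomp_exists[of V w] by metis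
      have y: "y \<in> V" using yz(1) span_subspace[OF subset_refl span_superset V(1)] by simp
      have "z \<in> ?T" using yz(3) y V(2) w T subspace_diff[OF T, of w y] by auto
      then have z: "z \<in> U" using yz(2) V(1) by (auto simp: U_def orthogonal_commute span_base)
      have v0T: "v0 \<in> ?T" using v0(1) U(2) by auto
      have "y \<bullet> v0 = 0" using v0(1) y by (auto simp: U_def orthogonal_def)
      moreover have "?A y \<bullet> ?A v0 = \<mu>\<^sup>2 * (y \<bullet> v0)" using y v0T by (auto simp: V_def singular_space_def)
      ultimately show ?thesis using v0(4)[OF z]
        by (simp add: yz(3) linear_add[OF A] inner_add_right inner_commute)
    qed
    then have sv: "v0 \<in> singular_space f x (sqrt s)"
      using v0 U(2) by (auto simp: singular_space_def)
    moreover have "v0 \<noteq> 0" using v0(2) by auto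
    ultimately have "dim (singular_space f x (sqrt s)) > 0"
      using dim_eq_0[of "singular_space f x (sqrt s)"] by blast
    then have "singular_value f x (sqrt s)" using v0(3) by (simp only: singular_value_def singular_mult_def) simp
    \<comment> \<open>Uniqueness of the nonzero singular value puts \<open>v0\<close> into
      \<open>V\<close>, to which it is orthogonal.\<close>
    then have "sqrt s = \<mu>" using only v0(3) by simp
    then have "v0 \<in> V" using sv by (simp add: V_def)
    then have "v0 \<bullet> v0 = 0" using v0(1) by (auto simp: U_def orthogonal_def)
    then show False using v0(2) by (simp add: norm_eq_sqrt_inner)
  qed
  obtain E1 where E1: "orthonormal E1" "set E1 \<subseteq> V" "length E1 = p"
    using subspace_orthonormal_list[OF V(1)] dV by metis
  obtain E2 where E2: "orthonormal E2" "set E2 \<subseteq> U" "length E2 = n - p"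
    using subspace_orthonormal_list[OF U(1)] dU by (metis add_diff_cancel_right')
  let ?es = "x # E1 @ E2"
  have pn: "p \<le> n" using dU by simp
  have nthV: "E1 ! i \<in> V" if "i < p" for i using E1 that by auto
  have nthU: "E2 ! i \<in> U" if "i < n - p" for i using E2 that by auto
  have mem: "?es ! Suc i \<in> ?T" if "i < n" for i
    using that nthV[of i] nthU[of "i - p"] V(2) U(2) E1(3) by (auto simp: nth_append)
  have inner: "?es ! Suc i \<bullet> ?es ! Suc j = (if i = j then 1 else 0)" if ij: "i < n" "j < n" for i j
  proof -
    have VU: "v \<bullet> u = 0" "u \<bullet> v = 0" if "v \<in> V" "u \<in> U" for u v
      using that by (auto simp: U_def orthogonal_def inner_commute)
    show ?thesis
      using ij E1(1,3) E2(1,3) VU[OF nthV nthU, of i "j - p"] VU[OF nthV nthU, of j "i - p"] pn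
      by (auto simp: nth_append orthonormal_def)
  qed
  have "orthonormal ?es"
    unfolding orthonormal_def
  proof (intro allI impI)
    fix i j assume ij: "i < length ?es" "j < length ?es"
    have len: "length ?es = Suc n" using E1(3) E2(3) pn by simp
    show "?es ! i \<bullet> ?es ! j = (if i = j then 1 else 0)"
      using ij[unfolded len] inner[of "i - 1" "j - 1"] mem[of "i - 1"] mem[of "j - 1"] x
      by (cases i; cases j) (auto simp: sphere_tangent_def inner_commute norm_eq_1)
  qed
  moreover have "length ?es = n + 1" using E1(3) E2(3) pn by simp
  moreover have "?A (?es ! Suc i) \<bullet> ?A (?es ! Suc j) = (if i = j \<and> i < p then \<mu>\<^sup>2 else 0)"
    if ij: "i < n" "j < n" for i j
  proof (cases "i < p")
    case True
    then have "?es ! Suc i \<in> V" using nthV E1(3) by (simp add: nth_append)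
    then have "?A (?es ! Suc i) \<bullet> ?A (?es ! Suc j) = \<mu>\<^sup>2 * (?es ! Suc i \<bullet> ?es ! Suc j)"
      using mem[OF ij(2)] unfolding V_def singular_space_def by blast
    then show ?thesis using inner[OF ij] True by simp
  next
    case False
    then have "?A (?es ! Suc i) = 0" using nthU[of "i - p"] AU E1(3) ij by (simp add: nth_append)
    then show ?thesis using False by simp
  qed
  ultimately show ?thesis using that[of ?es] pn by simp
qed

subsection \<open>The radially constant extension\<close>

lemma smooth_sphere_has_derivative:
  assumes "smooth_on_sphere f" "y \<noteq> 0"
  shows "((\<lambda>y. f (sgn y)) has_derivative sphere_deriv f y) (at y)"
  using smooth_on_has_derivative[of "- {0}" "\<lambda>y. f (sgn y)" y] assms
  by (simp add: smooth_on_sphere_def sphere_deriv_def open_Compl)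

lemma sphere_deriv_linear: "smooth_on_sphere f \<Longrightarrow> y \<noteq> 0 \<Longrightarrow> linear (sphere_deriv f y)"
  using smooth_sphere_has_derivative has_derivative_linear by blast

text \<open>The extension of f is constant on rays, so its derivative is homogeneous of degree -1.
  This reduces all derivatives to points of the unit sphere.\<close>

lemma sphere_deriv_scale:
  assumes f: "smooth_on_sphere f" and x: "x \<noteq> 0" and r: "r > 0"
  shows "sphere_deriv f (r *\<^sub>R x) v = (1 / r) *\<^sub>R sphere_deriv f x v"
proof -
  have s: "sgn ((1 / r) *\<^sub>R y) = sgn y" for y :: 'a using r by (simp add: sgn_scaleR)
  have "((\<lambda>y. (1 / r) *\<^sub>R y) has_derivative (\<lambda>v. (1 / r) *\<^sub>R v)) (at (r *\<^sub>R x))"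
    by (auto intro!: derivative_eq_intros)
  moreover have "((\<lambda>y. f (sgn y)) has_derivative sphere_deriv f x) (at ((1 / r) *\<^sub>R r *\<^sub>R x))"
    using smooth_sphere_has_derivative[OF f x] r by simp
  ultimately have "((\<lambda>y. f (sgn ((1 / r) *\<^sub>R y))) has_derivative (\<lambda>v. sphere_deriv f x ((1 / r) *\<^sub>R v))) (at (r *\<^sub>R x))"
    using diff_chain_at by (fastforce simp: o_def)
  then have "((\<lambda>y. f (sgn y)) has_derivative (\<lambda>v. sphere_deriv f x ((1 / r) *\<^sub>R v))) (at (r *\<^sub>R x))"
    unfolding s .
  from fun_cong[OF frechet_derivative_at[OF this], of v]
  have "sphere_deriv f (r *\<^sub>R x) v = sphere_deriv f x ((1 / r) *\<^sub>R v)"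
    unfolding sphere_deriv_def by simp
  then show ?thesis by (simp add: linear_cmul[OF sphere_deriv_linear[OF f x]])
qed

lemma sphere_deriv_radial:
  assumes f: "smooth_on_sphere f" and x: "norm x = 1"
  shows "sphere_deriv f x x = 0"
proof -
  have x0: "x \<noteq> 0" using x by auto
  have "((\<lambda>t. x + t *\<^sub>R x) has_derivative (\<lambda>t. t *\<^sub>R x)) (at 0)"
    by (auto intro!: derivative_eq_intros)
  moreover have "((\<lambda>y. f (sgn y)) has_derivative sphere_deriv f x) (at (x + 0 *\<^sub>R x))"
    using smooth_sphere_has_derivative[OF f x0] by simp
  ultimately have "((\<lambda>t::real. f (sgn (x + t *\<^sub>R x))) has_derivative (\<lambda>t. sphere_deriv f x (t *\<^sub>R x))) (at 0)"
    using diff_chain_at by (fastforce simp: o_def)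
  moreover have "((\<lambda>t::real. f (sgn (x + t *\<^sub>R x))) has_derivative (\<lambda>t. 0)) (at 0)"
  proof (rule has_derivative_transform_within_open[of "\<lambda>_. f (sgn x)" _ _ _ "{-1<..<1}"])
    fix t :: real assume "t \<in> {-1<..<1}"
    then have "1 + t > 0" by simp
    then have "sgn ((1 + t) *\<^sub>R x) = sgn x" by (simp add: sgn_scaleR)
    then show "f (sgn x) = f (sgn (x + t *\<^sub>R x))" by (simp add: algebra_simps)
  qed auto
  ultimately have "(\<lambda>t::real. sphere_deriv f x (t *\<^sub>R x)) = (\<lambda>t. 0)" by (rule has_derivative_unique)
  from fun_cong[OF this, of 1] show ?thesis by simp
qed

lemma sphere_deriv_orthogonal:
  assumes f: "smooth_on_sphere f" "f ` sphere 0 1 \<subseteq> sphere 0 1" and x: "x \<noteq> 0"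
  shows "f (sgn x) \<bullet> sphere_deriv f x v = 0"
proof -
  note d = smooth_sphere_has_derivative[OF f(1) x]
  have "((\<lambda>y. f (sgn y) \<bullet> f (sgn y)) has_derivative
      (\<lambda>v. f (sgn x) \<bullet> sphere_deriv f x v + sphere_deriv f x v \<bullet> f (sgn x))) (at x)"
    by (rule has_derivative_inner[OF d d])
  moreover have "((\<lambda>y. f (sgn y) \<bullet> f (sgn y)) has_derivative (\<lambda>_. 0)) (at x)"
  proof (rule has_derivative_transform_within_open[of "\<lambda>_. 1" _ _ _ "- {0}"])
    fix y :: 'a assume "y \<in> - {0}"
    then have "norm (f (sgn y)) = 1" using f(2) by (auto simp: image_subset_iff norm_sgn)
    then show "1 = f (sgn y) \<bullet> f (sgn y)" by (simp add: norm_eq_1)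
  qed (use x in auto)
  ultimately have "(\<lambda>v. f (sgn x) \<bullet> sphere_deriv f x v + sphere_deriv f x v \<bullet> f (sgn x)) = (\<lambda>_. 0)"
    by (rule has_derivative_unique)
  from fun_cong[OF this, of v] show ?thesis by (simp add: inner_commute)
qed

subsection \<open>The singular value of an eigenmap\<close>

lemma smooth_real_polynomial_function: "real_polynomial_function P \<Longrightarrow> smooth_on UNIV P"
proof (induction rule: real_polynomial_function.induct)
  case (linear h)
  then show ?case using smooth_on_linear[OF linear open_UNIV smooth_on_id[OF open_UNIV]] by simp
qed (auto intro: smooth_on_const smooth_on_add smooth_on_mult)

text \<open>Both sides are the squared norm of the vector that represents \<open>l\<close>.\<close>

lemma sum_sq_orthonormal:
  fixes l :: "'a::euclidean_space \<Rightarrow> real"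
  assumes l: "linear l" and es: "orthonormal es" "length es = DIM('a)"
  shows "(\<Sum>b\<in>Basis. (l b)\<^sup>2) = (\<Sum>i<DIM('a). (l (es ! i))\<^sup>2)"
proof -
  define w where "w = adjoint l 1"
  have lw: "l v = v \<bullet> w" for v using adjoint_works[OF l, of v 1] by (simp add: w_def)
  have "(\<Sum>b\<in>Basis. (l b)\<^sup>2) = w \<bullet> w"
    by (simp add: lw euclidean_inner[of w w] power2_eq_square inner_commute)
  also have "w \<bullet> w = w \<bullet> (\<Sum>j<DIM('a). (w \<bullet> es ! j) *\<^sub>R es ! j)" using orthonormal_expand[OF es, of w] by simp
  also have "\<dots> = (\<Sum>i<DIM('a). (l (es ! i))\<^sup>2)"
    by (simp add: lw inner_sum_right power2_eq_square inner_commute)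
  finally show ?thesis .
qed

text \<open>Half the Laplacian of P^2 is |grad P|^2 + P times the Laplacian of P, and the last term
  vanishes for harmonic P.\<close>

lemma laplacian_sum_squares:
  fixes P :: "'b \<Rightarrow> 'a::euclidean_space \<Rightarrow> real"
  assumes B: "finite B" and P: "\<And>b. b \<in> B \<Longrightarrow> smooth_on UNIV (P b)" "\<And>b x. b \<in> B \<Longrightarrow> laplacian (P b) x = 0"
  shows "laplacian (\<lambda>y. \<Sum>b\<in>B. (P b y)\<^sup>2) x = (\<Sum>b\<in>B. 2 * (\<Sum>e\<in>Basis. (frechet_derivative (P b) (at x) e)\<^sup>2))"
proof -
  let ?D = "\<lambda>b e y. frechet_derivative (P b) (at y) e"
  have d1: "frechet_derivative (\<lambda>y. \<Sum>b\<in>B. (P b y)\<^sup>2) (at y) e = (\<Sum>b\<in>B. 2 * P b y * ?D b e y)" for y e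
  proof -
    have "((\<lambda>y. \<Sum>b\<in>B. P b y * P b y) has_derivative (\<lambda>e. \<Sum>b\<in>B. P b y * ?D b e y + ?D b e y * P b y)) (at y)"
      by (intro has_derivative_sum has_derivative_mult smooth_on_has_derivative[OF open_UNIV P(1) UNIV_I])
    from fun_cong[OF frechet_derivative_at[OF this], of e] show ?thesis
      by (simp add: power2_eq_square algebra_simps)
  qed
  have d2: "frechet_derivative (\<lambda>y. \<Sum>b\<in>B. 2 * P b y * ?D b e y) (at x) e
      = (\<Sum>b\<in>B. 2 * (?D b e x)\<^sup>2 + 2 * P b x * frechet_derivative (?D b e) (at x) e)" for e
  proof -
    have "((\<lambda>y. \<Sum>b\<in>B. 2 * (P b y * ?D b e y)) has_derivative
        (\<lambda>v. \<Sum>b\<in>B. 2 * (P b x * frechet_derivative (?D b e) (at x) v + ?D b v x * ?D b e x))) (at x)"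
      by (intro has_derivative_sum has_derivative_mult_right has_derivative_mult
          smooth_on_has_derivative[OF open_UNIV P(1) UNIV_I]
          smooth_on_has_derivative[OF open_UNIV smooth_on_frechet[OF P(1)] UNIV_I])
    from fun_cong[OF frechet_derivative_at[OF this], of e] show ?thesis
      by (simp add: power2_eq_square algebra_simps)
  qed
  have "laplacian (\<lambda>y. \<Sum>b\<in>B. (P b y)\<^sup>2) x
      = (\<Sum>e\<in>Basis. \<Sum>b\<in>B. 2 * (?D b e x)\<^sup>2 + 2 * P b x * frechet_derivative (?D b e) (at x) e)"
    unfolding laplacian_def d1 d2 ..
  also have "\<dots> = (\<Sum>b\<in>B. \<Sum>e\<in>Basis. 2 * (?D b e x)\<^sup>2 + 2 * P b x * frechet_derivative (?D b e) (at x) e)"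
    by (rule sum.swap)
  also have "\<dots> = (\<Sum>b\<in>B. 2 * (\<Sum>e\<in>Basis. (?D b e x)\<^sup>2))"
  proof (rule sum.cong[OF refl])
    fix b assume b: "b \<in> B"
    have "(\<Sum>e\<in>Basis. 2 * (?D b e x)\<^sup>2 + 2 * P b x * frechet_derivative (?D b e) (at x) e)
       = 2 * (\<Sum>e\<in>Basis. (?D b e x)\<^sup>2) + 2 * P b x * laplacian (P b) x"
      by (simp add: sum.distrib sum_distrib_left laplacian_def)
    then show "(\<Sum>e\<in>Basis. 2 * (?D b e x)\<^sup>2 + 2 * P b x * frechet_derivative (?D b e) (at x) e)
       = 2 * (\<Sum>e\<in>Basis. (?D b e x)\<^sup>2)" using P(2)[OF b] by simp
  qed
  finally show ?thesis .
qed

lemma laplacian_inner_power: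
  fixes x :: "'a::euclidean_space"
  assumes "k \<ge> 2" "norm x = 1"
  shows "laplacian (\<lambda>y::'a. (y \<bullet> y) ^ k) x = 2 * real k * (2 * real k + real DIM('a) - 2)"
proof -
  obtain j where k: "k = Suc (Suc j)" using le_Suc_ex[OF assms(1)] by auto
  have xx: "x \<bullet> x = 1" using assms(2) by (simp add: norm_eq_1)
  have i: "((\<lambda>y::'a. y \<bullet> y) has_derivative (\<lambda>v. 2 * (y \<bullet> v))) (at y)" for y
    by (auto intro!: derivative_eq_intros simp: inner_commute)
  have pw: "((\<lambda>y::'a. (y \<bullet> y) ^ Suc m) has_derivative (\<lambda>v. 2 * real (Suc m) * (y \<bullet> y) ^ m * (y \<bullet> v))) (at y)" for m y
    by (rule has_derivative_eq_rhs[OF has_derivative_power[OF i]]) (auto simp: fun_eq_iff)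
  have d1: "frechet_derivative (\<lambda>y::'a. (y \<bullet> y) ^ k) (at y) e = 2 * real k * ((y \<bullet> y) ^ Suc j * (y \<bullet> e))" for y e
    using fun_cong[OF frechet_derivative_at[OF pw[of "Suc j" y]], of e] by (simp add: k)
  have d2: "frechet_derivative (\<lambda>y::'a. 2 * real k * ((y \<bullet> y) ^ Suc j * (y \<bullet> e))) (at x) e
      = 2 * real k * (e \<bullet> e + 2 * real (Suc j) * (x \<bullet> e)\<^sup>2)" for e
  proof -
    have "((\<lambda>y::'a. 2 * real k * ((y \<bullet> y) ^ Suc j * (y \<bullet> e))) has_derivative
      (\<lambda>v. 2 * real k * ((x \<bullet> x) ^ Suc j * (v \<bullet> e) + 2 * real (Suc j) * (x \<bullet> x) ^ j * (x \<bullet> v) * (x \<bullet> e)))) (at x)"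
      by (intro has_derivative_mult_right has_derivative_mult pw) (auto intro!: derivative_eq_intros)
    from fun_cong[OF frechet_derivative_at[OF this], of e] show ?thesis
      by (simp add: xx power2_eq_square algebra_simps)
  qed
  have "laplacian (\<lambda>y::'a. (y \<bullet> y) ^ k) x = (\<Sum>e\<in>Basis. 2 * real k * (e \<bullet> e + 2 * real (Suc j) * (x \<bullet> e)\<^sup>2))"
    unfolding laplacian_def d1 d2 ..
  also have "\<dots> = 2 * real k * ((\<Sum>e\<in>(Basis::'a set). e \<bullet> e) + 2 * real (Suc j) * (\<Sum>e\<in>Basis. (x \<bullet> e)\<^sup>2))"
    by (simp add: sum_distrib_left sum.distrib distrib_left)
  also have "(\<Sum>e\<in>(Basis::'a set). e \<bullet> e) = real DIM('a)" by simp
  also have "(\<Sum>e\<in>Basis. (x \<bullet> e)\<^sup>2) = 1" using xx by (simp add: euclidean_inner[of x x] power2_eq_square)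
  finally show ?thesis by (simp add: k algebra_simps)
qed

text \<open>The harmonic extensions satisfy sum P_b^2 = |y|^(2k). At a unit vector half the
  Laplacian of the right side is k (2k + n - 1), while the squared gradients contribute k^2 in the
  radial direction and \<open>\<mu>\<^sup>2\<close> in each of p tangential ones.\<close>

lemma eigenmap_singular_value:
  fixes f :: "'a::euclidean_space \<Rightarrow> 'b::euclidean_space"
  assumes n: "DIM('a) = n + 1" and f: "smooth_on_sphere f" "f ` sphere 0 1 \<subseteq> sphere 0 1"
    and k: "k \<ge> 2" and harm: "\<And>b. b \<in> Basis \<Longrightarrow> spherical_harmonic k (\<lambda>x. f x \<bullet> b)"
    and x: "norm x = 1" and es: "orthonormal es" "length es = n + 1" "es ! 0 = x" and p: "p \<le> n"
    and sv: "\<And>i j. i < n \<Longrightarrow> j < n \<Longrightarrow> sphere_deriv f x (es ! Suc i) \<bullet> sphere_deriv f x (es ! Suc j) =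
      (if i = j \<and> i < p then \<mu>\<^sup>2 else 0)"
  shows "real p * \<mu>\<^sup>2 = real k * (real k + real n - 1)"
proof -
  let ?Q = "\<lambda>b P. real_polynomial_function P \<and> (\<forall>t x. P (t *\<^sub>R x) = t ^ k * P x) \<and> (\<forall>x. laplacian P x = 0) \<and>
      (\<forall>x \<in> sphere 0 1. f x \<bullet> b = P x)"
  have "\<forall>b\<in>Basis. \<exists>P. ?Q b P" using harm unfolding spherical_harmonic_def by blast
  from bchoice[OF this] obtain P where PQ: "\<forall>b\<in>Basis. ?Q b (P b)" by blast
  then have P: "\<And>b. b \<in> Basis \<Longrightarrow> real_polynomial_function (P b)"
    "\<And>b t x. b \<in> Basis \<Longrightarrow> P b (t *\<^sub>R x) = t ^ k * P b x"
    "\<And>b x. b \<in> Basis \<Longrightarrow> laplacian (P b) x = 0"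
    "\<And>b x. b \<in> Basis \<Longrightarrow> norm x = 1 \<Longrightarrow> f x \<bullet> b = P b x"
    by auto
  note sP = smooth_real_polynomial_function[OF P(1)]
  have Pf: "P b y = norm y ^ k * (f (sgn y) \<bullet> b)" if "b \<in> Basis" "y \<noteq> 0" for b y
    using P(2)[OF that(1), of "norm y" "sgn y"] P(4)[OF that(1), of "sgn y"] that(2)
    by (simp add: norm_sgn sgn_div_norm)
  have sumsq: "(\<Sum>b\<in>Basis. (P b y)\<^sup>2) = (y \<bullet> y) ^ k" for y
  proof (cases "y = 0")
    case True
    then have "P b y = 0" if "b \<in> Basis" for b using P(2)[OF that, of 0 0] k by (auto simp: power_0_left)
    then show ?thesis using True k by simp
  next
    case False
    then have "norm (f (sgn y)) = 1" using f(2) by (auto simp: image_subset_iff norm_sgn)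
    then have "(\<Sum>b\<in>Basis. (f (sgn y) \<bullet> b)\<^sup>2) = 1"
      by (simp add: norm_eq_1 euclidean_inner[of "f (sgn y)" "f (sgn y)"] power2_eq_square)
    moreover have "(\<Sum>b\<in>Basis. (P b y)\<^sup>2) = (norm y ^ k)\<^sup>2 * (\<Sum>b\<in>Basis. (f (sgn y) \<bullet> b)\<^sup>2)"
      using False by (simp add: Pf power_mult_distrib sum_distrib_left)
    ultimately show ?thesis
      by (simp add: dot_square_norm flip: power_mult) (simp add: mult.commute)
  qed
  let ?D = "\<lambda>b. frechet_derivative (P b) (at x)"
  have "laplacian (\<lambda>y. \<Sum>b\<in>Basis. (P b y)\<^sup>2) x = (\<Sum>b\<in>Basis. 2 * (\<Sum>e\<in>Basis. (?D b e)\<^sup>2))"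
    by (rule laplacian_sum_squares) (auto simp: sP P(3))
  then have 1: "(\<Sum>b\<in>Basis. \<Sum>e\<in>Basis. (?D b e)\<^sup>2) = real k * (2 * real k + real DIM('a) - 2)"
    unfolding sumsq laplacian_inner_power[OF k x] by (simp add: sum_distrib_left[symmetric])
  have x0: "x \<noteq> 0" "sgn x = x" using x by (auto simp: sgn_div_norm)
  have D: "?D b v = real k * (x \<bullet> v) * (f x \<bullet> b) + sphere_deriv f x v \<bullet> b" if b: "b \<in> Basis" for b v
  proof -
    have nk: "((\<lambda>y::'a. norm y ^ k) has_derivative (\<lambda>v. real k * (x \<bullet> v))) (at x)"
      by (rule has_derivative_eq_rhs[OF has_derivative_power[OF has_derivative_norm[OF x0(1)]]])
        (simp add: x x0(2) fun_eq_iff inner_commute)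
    have "((\<lambda>y. norm y ^ k * (f (sgn y) \<bullet> b)) has_derivative
        (\<lambda>v. norm x ^ k * (sphere_deriv f x v \<bullet> b) + real k * (x \<bullet> v) * (f (sgn x) \<bullet> b))) (at x)"
      by (rule has_derivative_mult[OF nk has_derivative_inner_left[OF smooth_sphere_has_derivative[OF f(1) x0(1)]]])
    then have "(P b has_derivative (\<lambda>v. norm x ^ k * (sphere_deriv f x v \<bullet> b) + real k * (x \<bullet> v) * (f (sgn x) \<bullet> b))) (at x)"
      by (rule has_derivative_transform_within_open[where s="- {0}"]) (use x0(1) Pf[OF b] in auto)
    from fun_cong[OF frechet_derivative_at[OF this], of v] show ?thesis by (simp add: x x0(2))
  qed
  have fx: "norm (f x) = 1" using f(2) x by (auto simp: image_subset_iff)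
  have on: "x \<bullet> x = 1" using x by (simp add: norm_eq_1)
  have orth: "x \<bullet> es ! Suc i = 0" if "i < n" for i
  proof -
    have "es ! 0 \<bullet> es ! Suc i = 0" using es(1,2) that unfolding orthonormal_def by auto
    then show ?thesis using es(3) by simp
  qed
  have esl: "length es = DIM('a)" using es(2) n by simp
  have "(\<Sum>b\<in>Basis. \<Sum>e\<in>Basis. (?D b e)\<^sup>2) = (\<Sum>b\<in>Basis. \<Sum>i<DIM('a). (?D b (es ! i))\<^sup>2)"
    by (rule sum.cong[OF refl], rule sum_sq_orthonormal[OF _ es(1) esl],
        rule frechet_derivative_smooth_linear[OF sP])
  also have "\<dots> = (\<Sum>i<DIM('a). \<Sum>b\<in>Basis. (?D b (es ! i))\<^sup>2)" by (rule sum.swap)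
  also have "\<dots> = (\<Sum>b\<in>Basis. (?D b x)\<^sup>2) + (\<Sum>i<n. \<Sum>b\<in>Basis. (?D b (es ! Suc i))\<^sup>2)"
    using n es(3) by (simp only: Suc_eq_plus1[symmetric] sum.lessThan_Suc_shift)
  also have "(\<Sum>b\<in>Basis. (?D b x)\<^sup>2) = (real k)\<^sup>2"
  proof -
    have "(\<Sum>b\<in>Basis. (?D b x)\<^sup>2) = (\<Sum>b\<in>Basis. (real k)\<^sup>2 * ((f x \<bullet> b) * (f x \<bullet> b)))"
      by (rule sum.cong) (simp_all add: D on sphere_deriv_radial[OF f(1) x] power2_eq_square algebra_simps)
    also have "\<dots> = (real k)\<^sup>2 * (f x \<bullet> f x)" by (simp add: sum_distrib_left[symmetric] euclidean_inner[of "f x" "f x"])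
    finally show ?thesis using fx by (simp add: norm_eq_1)
  qed
  also have "(\<Sum>i<n. \<Sum>b\<in>Basis. (?D b (es ! Suc i))\<^sup>2) = (\<Sum>i<n. if i < p then \<mu>\<^sup>2 else 0)"
  proof (rule sum.cong[OF refl])
    fix i assume "i \<in> {..<n}"
    then have i: "i < n" by simp
    have "(\<Sum>b\<in>Basis. (?D b (es ! Suc i))\<^sup>2) = sphere_deriv f x (es ! Suc i) \<bullet> sphere_deriv f x (es ! Suc i)"
      unfolding euclidean_inner[of "sphere_deriv f x (es ! Suc i)" "sphere_deriv f x (es ! Suc i)"]
      by (rule sum.cong) (simp_all add: D orth[OF i] power2_eq_square)
    then show "(\<Sum>b\<in>Basis. (?D b (es ! Suc i))\<^sup>2) = (if i < p then \<mu>\<^sup>2 else 0)" using sv[OF i i] by simp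
  qed
  also have "\<dots> = real p * \<mu>\<^sup>2"
  proof -
    have "{..<n} \<inter> {i. i < p} = {..<p}" using p by auto
    then show ?thesis by (simp add: sum.If_cases)
  qed
  finally show ?thesis using 1 n by (simp add: power2_eq_square algebra_simps)
qed

section \<open>Equivariant graphs over the cone\<close>

definition radial_map ::
    "('a::euclidean_space \<Rightarrow> 'b::euclidean_space) \<Rightarrow> (real \<Rightarrow> real) \<Rightarrow> (real \<Rightarrow> real) \<Rightarrow> 'a \<Rightarrow> 'a \<times> 'b" where
  "radial_map f A B x = (A (norm x) *\<^sub>R sgn x, B (norm x) *\<^sub>R f (sgn x))"

lemma LO_cone_param_radial_map: "LO_cone_param f \<theta> = radial_map f (\<lambda>r. r * cos \<theta>) (\<lambda>r. r * sin \<theta>)"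
  by (simp add: LO_cone_param_def[abs_def] radial_map_def[abs_def])

lemma smooth_on_radial_map:
  assumes f: "smooth_on_sphere f" and A: "smooth_on {0<..} A" and B: "smooth_on {0<..} B"
  shows "smooth_on (- {0}) (radial_map f A B)"
proof -
  have n: "smooth_on (- {0}) (\<lambda>x::'a. C (norm x))" if "smooth_on {0<..} C" for C :: "real \<Rightarrow> real"
    by (rule smooth_on_compose[OF _ _ _ that smooth_on_norm]) auto
  have o: "open (- {0::'a})" by auto
  show ?thesis unfolding radial_map_def[abs_def]
    by (rule smooth_on_Pair[OF o smooth_on_scaleR[OF o n[OF A] smooth_on_sgn]
          smooth_on_scaleR[OF o n[OF B] f[unfolded smooth_on_sphere_def]]])
qed

lemma smooth_on_radial_map_UNIV:
  assumes f: "smooth_on_sphere f" and A: "smooth_on {0<..} A" and B: "smooth_on {0<..} B"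
    and d: "d > 0" "\<And>r. r < d \<Longrightarrow> A r = 0 \<and> B r = 0"
  shows "smooth_on UNIV (radial_map f A B)"
proof -
  have "smooth_on (ball 0 d) (radial_map f A B)"
    by (rule smooth_on_cong[OF open_ball _ smooth_on_const[OF open_ball, of _ _ 0]])
      (simp add: radial_map_def d zero_prod_def)
  with smooth_on_radial_map[OF f A B] have "smooth_on (- {0} \<union> ball 0 d) (radial_map f A B)"
    by (intro smooth_on_glue) auto
  moreover have "- {0} \<union> ball (0::'a) d = UNIV" using d(1) by auto
  ultimately show ?thesis by simp
qed

lemma radial_map_has_derivative:
  assumes f: "smooth_on_sphere f" and y: "y \<noteq> 0"
    and A: "(A has_real_derivative A') (at (norm y))" and B: "(B has_real_derivative B') (at (norm y))"
  shows "(radial_map f A B has_derivative (\<lambda>v.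
     ((A' * (sgn y \<bullet> v)) *\<^sub>R sgn y + (A (norm y) / norm y) *\<^sub>R (v - (sgn y \<bullet> v) *\<^sub>R sgn y),
      (B' * (sgn y \<bullet> v)) *\<^sub>R f (sgn y) + B (norm y) *\<^sub>R sphere_deriv f y v))) (at y)"
proof -
  have ny: "norm y > 0" using y by simp
  have N: "(norm has_derivative (\<lambda>v. sgn y \<bullet> v)) (at y)"
    by (rule has_derivative_eq_rhs[OF has_derivative_norm[OF y]]) (simp add: inner_commute fun_eq_iff)
  have comp: "((\<lambda>y. C (norm y)) has_derivative (\<lambda>v. C' * (sgn y \<bullet> v))) (at y)"
    if "(C has_real_derivative C') (at (norm y))" for C C'
    using diff_chain_at[OF N that[unfolded has_field_derivative_def]] by (simp add: o_def)
  have "((\<lambda>x. inverse x) has_real_derivative - inverse (norm y) * inverse (norm y)) (at (norm y))"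
    using DERIV_inverse[of "norm y"] ny by (simp add: numeral_2_eq_2)
  from comp[OF this] have I: "((\<lambda>y. inverse (norm y)) has_derivative
      (\<lambda>v. - inverse (norm y) * inverse (norm y) * (sgn y \<bullet> v))) (at y)" .
  have S: "(sgn has_derivative (\<lambda>v. inverse (norm y) *\<^sub>R (v - (sgn y \<bullet> v) *\<^sub>R sgn y))) (at y)"
  proof -
    have "((\<lambda>y. inverse (norm y) *\<^sub>R y) has_derivative
      (\<lambda>v. inverse (norm y) *\<^sub>R v + (- inverse (norm y) * inverse (norm y) * (sgn y \<bullet> v)) *\<^sub>R y)) (at y)"
      by (rule has_derivative_scaleR[OF I has_derivative_ident])
    moreover have "inverse (norm y) *\<^sub>R v + (- inverse (norm y) * inverse (norm y) * (sgn y \<bullet> v)) *\<^sub>R y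
      = inverse (norm y) *\<^sub>R (v - (sgn y \<bullet> v) *\<^sub>R sgn y)" for v
      by (simp add: sgn_div_norm algebra_simps)
    ultimately show ?thesis by (simp add: sgn_div_norm[abs_def])
  qed
  have 1: "((\<lambda>y. A (norm y) *\<^sub>R sgn y) has_derivative
      (\<lambda>v. A (norm y) *\<^sub>R (inverse (norm y) *\<^sub>R (v - (sgn y \<bullet> v) *\<^sub>R sgn y)) + (A' * (sgn y \<bullet> v)) *\<^sub>R sgn y)) (at y)"
    by (rule has_derivative_scaleR[OF comp[OF A] S])
  have 2: "((\<lambda>y. B (norm y) *\<^sub>R f (sgn y)) has_derivative
      (\<lambda>v. B (norm y) *\<^sub>R sphere_deriv f y v + (B' * (sgn y \<bullet> v)) *\<^sub>R f (sgn y))) (at y)"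
    by (rule has_derivative_scaleR[OF comp[OF B] smooth_sphere_has_derivative[OF f y]])
  show ?thesis unfolding radial_map_def[abs_def]
    by (rule has_derivative_eq_rhs[OF has_derivative_Pair[OF 1 2]])
      (simp add: fun_eq_iff divide_inverse add.commute)
qed

text \<open>The assumption \<open>frame\<close> is a singular value decomposition whose first vector
  is the base point, so that one orthonormal basis of the ambient space diagonalises the derivative
  of every radial map.\<close>

locale equal_singular_value_map =
  fixes f :: "'a::euclidean_space \<Rightarrow> 'b::euclidean_space" and n p :: nat and \<mu> :: real
  assumes dim: "DIM('a) = Suc n" and smooth_f: "smooth_on_sphere f"
    and sphere_f: "f ` sphere 0 1 \<subseteq> sphere 0 1" and mu_pos: "\<mu> > 0" and p_le: "p \<le> n"
    and frame: "\<And>x. norm x = 1 \<Longrightarrow> \<exists>es. orthonormal es \<and> length es = Suc n \<and> es ! 0 = x \<and>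
      (\<forall>i<n. \<forall>j<n. sphere_deriv f x (es ! Suc i) \<bullet> sphere_deriv f x (es ! Suc j) =
        (if i = j \<and> i < p then \<mu>\<^sup>2 else 0))"
begin

lemma norm_f: "x \<noteq> 0 \<Longrightarrow> norm (f (sgn x)) = 1"
  using sphere_f by (auto simp: image_subset_iff norm_sgn)

text \<open>The Jacobian of \<^term>\<open>radial_map f A B\<close> at distance \<open>r\<close> from the origin, where \<open>a, b\<close> are the
  values and \<open>a', b'\<close> the derivatives of the profile \<open>(A, B)\<close>.\<close>

definition jac :: "real \<Rightarrow> real \<Rightarrow> real \<Rightarrow> real \<Rightarrow> real \<Rightarrow> real" where
  "jac a b a' b' r = sqrt (a'\<^sup>2 + b'\<^sup>2) * (sqrt (a\<^sup>2 + \<mu>\<^sup>2 * b\<^sup>2) / r) ^ p * (\<bar>a\<bar> / r) ^ (n - p)"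

text \<open>The radial direction maps to a combination of x and f(x), and the tangential directions
  map to vectors orthogonal to both. Hence the adapted frame is carried to orthogonal vectors and
  the Jacobian is the product of their lengths.\<close>

lemma radial_map_frame:
  assumes y: "y \<noteq> 0" 
    and A: "(A has_real_derivative A') (at (norm y))" and B: "(B has_real_derivative B') (at (norm y))"
  obtains es s where "orthonormal es" "length es = DIM('a)" "\<And>i. s i \<ge> 0"
    "\<And>i j. i < DIM('a) \<Longrightarrow> j < DIM('a) \<Longrightarrow> frechet_derivative (radial_map f A B) (at y) (es ! i)
       \<bullet> frechet_derivative (radial_map f A B) (at y) (es ! j) = (if i = j then (s i)\<^sup>2 else 0)"
    "(\<Prod>i<DIM('a). s i) = jac (A (norm y)) (B (norm y)) A' B' (norm y)"
proof -
  define r where "r = norm y"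
  define x where "x = sgn y"
  let ?a = "A r" and ?b = "B r"
  have r: "r > 0" and x: "norm x = 1" and yx: "y = r *\<^sub>R x" and sx: "sgn y = x"
    using y by (auto simp: r_def x_def norm_sgn sgn_div_norm)
  have x0: "x \<noteq> 0" "sgn x = x" using x by (auto simp: sgn_div_norm)
  obtain es where es: "orthonormal es" "length es = Suc n" "es ! 0 = x"
    and sv: "\<And>i j. i < n \<Longrightarrow> j < n \<Longrightarrow> sphere_deriv f x (es ! Suc i) \<bullet> sphere_deriv f x (es ! Suc j) =
        (if i = j \<and> i < p then \<mu>\<^sup>2 else 0)"
    using frame[OF x] by blast
  have on: "es ! i \<bullet> es ! j = (if i = j then 1 else 0)" if "i < Suc n" "j < Suc n" for i j
    using es(1,2) that unfolding orthonormal_def by auto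
  define L where "L = frechet_derivative (radial_map f A B) (at y)"
  have L: "L v = ((A' * (x \<bullet> v)) *\<^sub>R x + (?a / r) *\<^sub>R (v - (x \<bullet> v) *\<^sub>R x),
      (B' * (x \<bullet> v)) *\<^sub>R f x + (?b / r) *\<^sub>R sphere_deriv f x v)" for v
  proof -
    have sd: "sphere_deriv f y v = (1 / r) *\<^sub>R sphere_deriv f x v"
      unfolding yx by (rule sphere_deriv_scale[OF smooth_f x0(1) r])
    show ?thesis
      using fun_cong[OF frechet_derivative_at[OF radial_map_has_derivative[OF smooth_f y A B]], of v]
      unfolding L_def[symmetric] sx sd r_def[symmetric] by simp
  qed
  have xe: "x \<bullet> es ! Suc i = 0" "es ! Suc i \<bullet> x = 0" if "i < n" for i
    using on[of 0 "Suc i"] on[of "Suc i" 0] that es(3) by auto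
  have xx: "x \<bullet> x = 1" using x by (simp add: norm_eq_1)
  have ff: "f x \<bullet> f x = 1" using norm_f[OF x0(1)] x0(2) by (simp add: norm_eq_1)
  have L0: "L (es ! 0) = (A' *\<^sub>R x, B' *\<^sub>R f x)"
    by (simp add: L es(3) xx sphere_deriv_radial[OF smooth_f x])
  have LS: "L (es ! Suc i) = ((?a / r) *\<^sub>R es ! Suc i, (?b / r) *\<^sub>R sphere_deriv f x (es ! Suc i))" if "i < n" for i
    by (simp add: L xe[OF that])
  have fo: "f x \<bullet> sphere_deriv f x v = 0" "sphere_deriv f x v \<bullet> f x = 0" for v
    using sphere_deriv_orthogonal[OF smooth_f sphere_f x0(1), of v] x0(2) by (simp_all add: inner_commute)
  \<comment> \<open>Index 0 is the radial direction, 1 to p are the directions stretched by f, and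
    the rest are the directions that the differential of f kills.\<close>
  define s where "s i = (if i = 0 then sqrt (A'\<^sup>2 + B'\<^sup>2) else if i \<le> p then sqrt (?a\<^sup>2 + \<mu>\<^sup>2 * ?b\<^sup>2) / r
      else \<bar>?a\<bar> / r)" for i
  have s0: "s i \<ge> 0" for i using r by (auto simp: s_def)
  have "L (es ! i) \<bullet> L (es ! j) = (if i = j then (s i)\<^sup>2 else 0)" if ij: "i < Suc n" "j < Suc n" for i j
  proof (cases i; cases j)
    assume "i = 0" "j = 0"
    then show ?thesis using xx ff by (simp add: L0 s_def power2_eq_square)
  next
    fix j' assume "i = 0" "j = Suc j'"
    then show ?thesis using ij xe[of j'] fo by (simp only: L0) (simp add: LS)
  next
    fix i' assume "i = Suc i'" "j = 0"
    then show ?thesis using ij xe[of i'] fo by (simp only: L0) (simp add: LS)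
  next
    fix i' j' assume e: "i = Suc i'" "j = Suc j'"
    have "L (es ! i) \<bullet> L (es ! j) = (?a / r)\<^sup>2 * (es ! Suc i' \<bullet> es ! Suc j')
        + (?b / r)\<^sup>2 * (sphere_deriv f x (es ! Suc i') \<bullet> sphere_deriv f x (es ! Suc j'))"
      using ij e by (simp add: LS power2_eq_square)
    then show ?thesis
      using ij e on[OF ij] sv[of i' j'] by (auto simp: s_def power_divide add_divide_distrib power_mult_distrib mult.commute)
  qed
  moreover have "(\<Prod>i<Suc n. s i) = jac ?a ?b A' B' r"
  proof -
    have "(\<Prod>i<Suc n. s i) = s 0 * (\<Prod>i<n. s (Suc i))" by (rule prod.lessThan_Suc_shift)
    also have "{..<n} = {..<p} \<union> {p..<n}" using p_le by auto
    also have "(\<Prod>i\<in>{..<p} \<union> {p..<n}. s (Suc i)) = (\<Prod>i<p. s (Suc i)) * (\<Prod>i\<in>{p..<n}. s (Suc i))"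
      by (rule prod.union_disjoint) auto
    also have "(\<Prod>i<p. s (Suc i)) = (sqrt (?a\<^sup>2 + \<mu>\<^sup>2 * ?b\<^sup>2) / r) ^ p" by (simp add: s_def)
    also have "(\<Prod>i\<in>{p..<n}. s (Suc i)) = (\<bar>?a\<bar> / r) ^ (n - p)" by (simp add: s_def)
    finally show ?thesis by (simp add: jac_def s_def mult.assoc)
  qed
  ultimately show ?thesis
    using that[of es s] es(1,2) s0 dim unfolding L_def s_def[abs_def] r_def by auto
qed

lemma radial_map_form_le:
  assumes y: "y \<noteq> 0" 
    and A: "(A has_real_derivative A') (at (norm y))" and B: "(B has_real_derivative B') (at (norm y))"
    and \<omega>: "alternating_form DIM('a) \<omega>" "comass_le_one DIM('a) \<omega>"
  shows "\<bar>\<omega> (map (frechet_derivative (radial_map f A B) (at y)) ordered_basis)\<bar>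
    \<le> jac (A (norm y)) (B (norm y)) A' B' (norm y)"
proof -
  let ?L = "frechet_derivative (radial_map f A B) (at y)"
  obtain es s where es: "orthonormal es" "length es = DIM('a)" "\<And>i. s i \<ge> (0::real)"
    "\<And>i j. i < DIM('a) \<Longrightarrow> j < DIM('a) \<Longrightarrow> ?L (es ! i) \<bullet> ?L (es ! j) = (if i = j then (s i)\<^sup>2 else 0)"
    "(\<Prod>i<DIM('a). s i) = jac (A (norm y)) (B (norm y)) A' B' (norm y)"
    using that by (rule radial_map_frame[OF y A B])
  have d: "(radial_map f A B has_derivative ?L) (at y)"
    using radial_map_has_derivative[OF smooth_f y A B] unfolding frechet_derivative_works[symmetric] differentiable_def by blast
  have "\<bar>\<omega> (map ?L ordered_basis)\<bar> \<le> (\<Prod>i<DIM('a). norm (?L (es ! i)))"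
    by (rule abs_form_le_prod_norm[OF has_derivative_linear[OF d] \<omega> es(1,2)])
  also have "\<dots> = (\<Prod>i<DIM('a). s i)"
    by (rule prod.cong) (simp_all add: norm_eq_sqrt_inner es(3,4))
  finally show ?thesis using es(5) by simp
qed

text \<open>The Jacobian of the parametrisation of \<open>LO_submanifold f \<phi>\<close> by the
  sphere, hence the ratio of their volumes: the angular weight of the profile curve.\<close>

definition W :: "real \<Rightarrow> real" where
  "W \<phi> = sqrt ((cos \<phi>)\<^sup>2 + \<mu>\<^sup>2 * (sin \<phi>)\<^sup>2) ^ p * \<bar>cos \<phi>\<bar> ^ (n - p)"

text \<open>In polar coordinates (g, \<phi>) of the profile the Jacobian separates into arc length,
  a power of the radius and the angular weight.\<close>

lemma jac_polar:
  assumes "r > 0"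
  shows "jac (g * cos \<phi>) (g * sin \<phi>) (g' * cos \<phi> - g * sin \<phi> * \<phi>') (g' * sin \<phi> + g * cos \<phi> * \<phi>') r
    = sqrt (g'\<^sup>2 + (g * \<phi>')\<^sup>2) * (\<bar>g\<bar> / r) ^ n * W \<phi>"
proof -
  have 1: "(g' * cos \<phi> - g * sin \<phi> * \<phi>')\<^sup>2 + (g' * sin \<phi> + g * cos \<phi> * \<phi>')\<^sup>2
      = (g'\<^sup>2 + (g * \<phi>')\<^sup>2) * ((sin \<phi>)\<^sup>2 + (cos \<phi>)\<^sup>2)"
    by (simp only: power2_eq_square) algebra
  have 2: "(g * cos \<phi>)\<^sup>2 + \<mu>\<^sup>2 * (g * sin \<phi>)\<^sup>2 = g\<^sup>2 * ((cos \<phi>)\<^sup>2 + \<mu>\<^sup>2 * (sin \<phi>)\<^sup>2)"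
    by (simp add: power_mult_distrib algebra_simps)
  have 3: "(\<bar>g\<bar> / r) ^ n = (\<bar>g\<bar> / r) ^ p * (\<bar>g\<bar> / r) ^ (n - p)"
    using p_le by (simp flip: power_add)
  show ?thesis unfolding jac_def 1 2 3 W_def
    by (simp add: real_sqrt_mult abs_mult power_mult_distrib power_divide mult_ac)
qed

lemma jac_cone: "r > 0 \<Longrightarrow> jac (r * cos \<phi>) (r * sin \<phi>) (cos \<phi>) (sin \<phi>) r = W \<phi>"
  using jac_polar[of r r \<phi> 1 0] by simp

lemma W_pos: "cos \<phi> > 0 \<Longrightarrow> W \<phi> > 0"
  unfolding W_def by (intro mult_pos_pos zero_less_power) (auto intro!: add_pos_nonneg)

lemma truncated_cone_domain: "{x. LO_cone_param f \<theta> x \<in> cball 0 R} = cball 0 R"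
  using norm_LO_cone_param[OF sphere_f, of \<theta>] by auto

text \<open>The cone is calibrated to first order by the form that extends the volume form of its tangent
  planes constantly in the directions of the second factor; the cut-off keeps away from the axis.\<close>

lemma mass_truncated_cone_ge:
  assumes \<theta>: "0 < \<theta>" "\<theta> < pi / 2" and R: "0 < R" "R \<le> 1"
  shows "ereal (W \<theta> * measure lborel (cball (0::'a) R)) \<le> mass DIM('a) (truncated_cone (LO_cone_param f \<theta>) R)"
proof -
  obtain h :: "real \<Rightarrow> real" where h: "smooth_on UNIV h" "\<And>t. t \<le> 0 \<Longrightarrow> h t = 0"
    "\<And>t. t \<ge> 1 \<Longrightarrow> h t = 1" "\<And>t. 0 \<le> h t" "\<And>t. h t \<le> 1"
    using smooth_step_exists by blast
  have c: "cos \<theta> > 0" using \<theta> by (intro cos_gt_zero) auto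
  have Wpos: "W \<theta> > 0" by (rule W_pos[OF c])
  let ?F = "LO_cone_param f \<theta>"
  let ?A = "\<lambda>r. r * cos \<theta>" and ?B = "\<lambda>r. r * sin \<theta>"
  have AB: "(?A has_real_derivative cos \<theta>) (at r)" "(?B has_real_derivative sin \<theta>) (at r)" for r
    by (auto intro!: derivative_eq_intros)
  have sF: "smooth_on (- {0}) ?F"
    unfolding LO_cone_param_radial_map
    by (rule smooth_on_radial_map[OF smooth_f])
      (auto intro!: smooth_on_mult smooth_on_id smooth_on_const)
  define L where "L x = frechet_derivative ?F (at x)" for x
  have linL: "linear (L x)" if "x \<noteq> 0" for x
    unfolding L_def by (rule has_derivative_linear[OF smooth_on_has_derivative[OF _ sF]]) (use that in auto)
  have cov: "covolume (L x) (map (L x) ordered_basis) = (W \<theta>)\<^sup>2"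
    "\<And>vs. length vs = DIM('a) \<Longrightarrow> orthonormal vs \<Longrightarrow> \<bar>covolume (L x) vs\<bar> \<le> W \<theta>" if x: "x \<noteq> 0" for x
  proof -
    obtain es s where es: "orthonormal es" "length es = DIM('a)" "\<And>i. s i \<ge> (0::real)"
      "\<And>i j. i < DIM('a) \<Longrightarrow> j < DIM('a) \<Longrightarrow> L x (es ! i) \<bullet> L x (es ! j) = (if i = j then (s i)\<^sup>2 else 0)"
      "(\<Prod>i<DIM('a). s i) = jac (?A (norm x)) (?B (norm x)) (cos \<theta>) (sin \<theta>) (norm x)"
      using that by (rule radial_map_frame[OF x AB, folded LO_cone_param_radial_map, folded L_def])
    have P: "(\<Prod>i<DIM('a). s i) = W \<theta>" using es(5) jac_cone x by simp
    \<comment> \<open>The frame only provides nonnegative stretches; since their product is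
      W(\<theta>) > 0, none of them vanishes.\<close>
    have "s i > 0" if "i < DIM('a)" for i
    proof (rule ccontr)
      assume "\<not> s i > 0"
      then have "s i = 0" using es(3)[of i] by simp
      then have "(\<Prod>i<DIM('a). s i) = 0" using that by (intro prod_zero) auto
      then show False using P Wpos by simp
    qed
    from covolume_bounds[OF linL[OF x] es(1,2) this es(4)] P
    show "covolume (L x) (map (L x) ordered_basis) = (W \<theta>)\<^sup>2"
      "\<And>vs. length vs = DIM('a) \<Longrightarrow> orthonormal vs \<Longrightarrow> \<bar>covolume (L x) vs\<bar> \<le> W \<theta>" by auto
  qed
  \<comment> \<open>The first factor vanishes near \<open>fst q = 0\<close> and tends to 1 elsewhere
    as j grows. The second is 1 on the unit ball, which contains the truncated cone, and makes the
    support compact.\<close>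
  define cut where "cut j q = h (real j * (fst q \<bullet> fst q) - 1) * (1 - h (q \<bullet> q - 1))" for j and q :: "'a \<times> 'b"
  have chi01: "0 \<le> cut j q" "cut j q \<le> 1" for j q
    using h(4,5) by (auto simp: cut_def intro!: mult_nonneg_nonneg mult_le_one)
  \<comment> \<open>\<open>(1 / cos \<theta>) *\<^sub>R fst q\<close> is the parameter of the cone
    point with the same first component as \<open>q\<close>, so the form is extended to be
    independent of the second component.\<close>
  define \<omega> where "\<omega> j q vs = cut j q * (covolume (L ((1 / cos \<theta>) *\<^sub>R fst q)) vs / W \<theta>)" for j q vs
  have chi0: "cut j q = 0" if "real j * (fst q \<bullet> fst q) < 1" for j q using that h(2) by (simp add: cut_def)
  have fst: "bounded_linear (fst :: 'a \<times> 'b \<Rightarrow> 'a)" by (rule bounded_linear_fst)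
  have smfst: "smooth_on S (fst :: 'a \<times> 'b \<Rightarrow> 'a)" if "open S" for S
    by (rule smooth_on_linear[OF fst that smooth_on_id[OF that]])
  have smchi: "smooth_on UNIV (cut j)" for j
  proof -
    have "smooth_on UNIV (\<lambda>q::'a \<times> 'b. real j * (fst q \<bullet> fst q) - 1)" "smooth_on UNIV (\<lambda>q::'a \<times> 'b. q \<bullet> q - 1)"
      by (auto intro!: smooth_on_diff smooth_on_mult smooth_on_const smooth_on_inner smfst smooth_on_id)
    then have "smooth_on UNIV (\<lambda>q::'a \<times> 'b. h (real j * (fst q \<bullet> fst q) - 1))" "smooth_on UNIV (\<lambda>q::'a \<times> 'b. h (q \<bullet> q - 1))"
      by (auto intro: smooth_on_compose[OF open_UNIV open_UNIV UNIV_I h(1)])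
    then show ?thesis unfolding cut_def[abs_def]
      by (intro smooth_on_mult smooth_on_diff smooth_on_const open_UNIV)
  qed
  have test: "\<omega> j \<in> test_forms DIM('a)" for j
  proof -
    have alt: "alternating_form DIM('a) (\<omega> j q)" for q
    proof (cases "fst q = 0")
      case True
      then have "\<omega> j q vs = 0" for vs using chi0 by (simp add: \<omega>_def)
      then show ?thesis by (simp add: alternating_form_def linear_iff)
    next
      case False
      then have "linear (L ((1 / cos \<theta>) *\<^sub>R fst q))" using c by (intro linL) simp
      from alternating_form_combination[OF alternating_form_covolume[OF this] alternating_form_covolume[OF this],
          of "cut j q / W \<theta>" 0]
      show ?thesis by (simp add: \<omega>_def[abs_def])
    qed
    have sm: "smooth_on UNIV (\<lambda>q. \<omega> j q vs)" for vs
    proof (cases "length vs = DIM('a)")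
      case False
      have "\<omega> j q vs = 0" for q
        using False by (simp add: \<omega>_def covolume_def vol_def ordered_basis(3))
      then show ?thesis by (simp add: smooth_on_const)
    next
      case True
      let ?S = "{q :: 'a \<times> 'b. fst q \<noteq> 0}" and ?T = "{q :: 'a \<times> 'b. real j * (fst q \<bullet> fst q) < 1}"
      have oS: "open ?S" by (intro open_Collect_neq continuous_intros)
      have oT: "open ?T" by (intro open_Collect_less continuous_intros)
      have "smooth_on ?S (\<lambda>q. L ((1 / cos \<theta>) *\<^sub>R fst q) b)" for b
      proof (rule smooth_on_compose[OF oS, where g="\<lambda>x. L x b" and f="\<lambda>q. (1 / cos \<theta>) *\<^sub>R fst q" and T="- {0}"])
        show "smooth_on (- {0}) (\<lambda>x. L x b)" unfolding L_def by (rule smooth_on_frechet[OF sF])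
        show "smooth_on ?S (\<lambda>q. (1 / cos \<theta>) *\<^sub>R fst q)"
          by (rule smooth_on_linear[OF bounded_linear_scaleR_right oS smfst[OF oS]])
      qed (use c in auto)
      then have s: "smooth_on ?S (\<lambda>q. \<Sum>p | p permutes {..<DIM('a)}. of_int (sign p) *
          (\<Prod>i<DIM('a). vs ! i \<bullet> L ((1 / cos \<theta>) *\<^sub>R fst q) (ordered_basis ! p i)))"
        by (intro smooth_on_sum smooth_on_mult smooth_on_const smooth_on_prod smooth_on_inner oS)
      have "smooth_on ?S (\<lambda>q. covolume (L ((1 / cos \<theta>) *\<^sub>R fst q)) vs)"
        by (rule smooth_on_cong[OF oS _ s]) (subst covolume_eq, use linL c True in auto)
      then have "smooth_on ?S (\<lambda>q. \<omega> j q vs)" unfolding \<omega>_def divide_inverse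
        by (intro smooth_on_mult oS smooth_on_const smooth_on_subset[OF smchi]) auto
      moreover have "smooth_on ?T (\<lambda>q. \<omega> j q vs)"
        by (rule smooth_on_cong[OF oT _ smooth_on_const[OF oT, of 0]]) (simp add: \<omega>_def chi0)
      ultimately have "smooth_on (?S \<union> ?T) (\<lambda>q. \<omega> j q vs)" by (rule smooth_on_glue[OF oS oT])
      moreover have "?S \<union> ?T = UNIV" by auto
      ultimately show ?thesis by simp
    qed
    have supp: "\<omega> j q vs = 0" if "q \<notin> cball 0 2" for q vs
    proof -
      have "2 < norm q" using that by simp
      then have "2\<^sup>2 < (norm q)\<^sup>2" by (intro power_strict_mono) auto
      then have "h (q \<bullet> q - 1) = 1" by (intro h(3)) (simp add: dot_square_norm)
      then show ?thesis by (simp add: \<omega>_def cut_def)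
    qed
    show ?thesis unfolding test_forms_def
      by (intro CollectI conjI allI exI[of _ "cball 0 2"] compact_cball impI alt sm) (rule supp)
  qed
  have comass: "comass_le_one DIM('a) (\<omega> j q)" for j q
    unfolding comass_le_one_def
  proof (intro allI impI, elim conjE)
    fix vs :: "('a \<times> 'b) list" assume vs: "length vs = DIM('a)" "orthonormal vs"
    show "\<bar>\<omega> j q vs\<bar> \<le> 1"
    proof (cases "fst q = 0")
      case True
      then show ?thesis using chi0 by (simp add: \<omega>_def)
    next
      case False
      then have "\<bar>covolume (L ((1 / cos \<theta>) *\<^sub>R fst q)) vs\<bar> \<le> W \<theta>" using cov(2) vs c by simp
      then have "\<bar>covolume (L ((1 / cos \<theta>) *\<^sub>R fst q)) vs / W \<theta>\<bar> \<le> 1" using Wpos by simp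
      then show ?thesis using chi01[of j q] unfolding \<omega>_def abs_mult by (intro mult_le_one) auto
    qed
  qed
  have val: "\<omega> j (?F x) (map (L x) ordered_basis) = W \<theta> * cut j (?F x)" for j x
  proof (cases "x = 0")
    case True
    then show ?thesis using chi0 by (simp add: \<omega>_def LO_cone_param_def)
  next
    case False
    have "norm x *\<^sub>R sgn x = x" using False by (simp add: sgn_div_norm)
    then have "(1 / cos \<theta>) *\<^sub>R fst (?F x) = x" using c
      by (simp add: LO_cone_param_def)
    then show ?thesis using cov(1)[OF False] Wpos by (simp add: \<omega>_def power2_eq_square)
  qed
  let ?T = "truncated_cone ?F R"
  have T: "?T (\<omega> j) = (\<integral>x. indicator (cball 0 R) x *\<^sub>R (W \<theta> * cut j (?F x)) \<partial>lborel)" for j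
    unfolding truncated_cone_def param_current_def truncated_cone_domain set_lebesgue_integral_def
    using val unfolding L_def by simp
  have conv: "(\<lambda>j. ?T (\<omega> j)) \<longlonglongrightarrow> (\<integral>x. indicator (cball (0::'a) R) x *\<^sub>R W \<theta> \<partial>lborel)"
    unfolding T
  proof (rule integral_dominated_convergence[where w="\<lambda>x. indicator (cball 0 R) x *\<^sub>R W \<theta>"])
    have mF: "?F \<in> borel_measurable borel"
    proof -
      have cf: "continuous_on (- {0}) ?F" by (rule smooth_on_continuous[OF sF])
      then have "(\<lambda>x. indicator (- {0}) x *\<^sub>R ?F x) \<in> borel_measurable borel"
        by (intro borel_measurable_continuous_on_indicator) auto
      moreover have "(\<lambda>x. indicator (- {0}) x *\<^sub>R ?F x) = ?F"
        by (auto simp: LO_cone_param_def indicator_def)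
      ultimately show ?thesis by simp
    qed
    show "(\<lambda>x. indicator (cball 0 R) x *\<^sub>R (W \<theta> * cut j (?F x))) \<in> borel_measurable lborel" for j
      using measurable_compose[OF mF borel_measurable_continuous_onI[OF smooth_on_continuous[OF smchi]], of j]
      by (simp only: measurable_lborel2)
        (intro borel_measurable_scaleR borel_measurable_times borel_measurable_indicator
          borel_measurable_const borel_closed closed_cball)
    show "integrable lborel (\<lambda>x. indicator (cball (0::'a) R) x *\<^sub>R W \<theta>)"
      using emeasure_bounded_finite[OF bounded_cball, of "0::'a" R] by (intro integrable_scaleR_left integrable_real_indicator) auto
    show "AE x in lborel. norm (indicator (cball 0 R) x *\<^sub>R (W \<theta> * cut j (?F x))) \<le> indicator (cball (0::'a) R) x *\<^sub>R W \<theta>" for j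
      using chi01 Wpos by (intro AE_I2) (auto simp: indicator_def abs_mult mult_left_le)
    show "AE x in lborel. (\<lambda>j. indicator (cball (0::'a) R) x *\<^sub>R (W \<theta> * cut j (?F x))) \<longlonglongrightarrow> indicator (cball 0 R) x *\<^sub>R W \<theta>"
      using AE_lborel_singleton[of "0::'a"]
    proof eventually_elim
      case (elim x)
      show ?case
      proof (cases "x \<in> cball 0 R")
        case True
        have ne: "fst (?F x) \<bullet> fst (?F x) > 0"
        proof -
          have "fst (?F x) \<noteq> 0" using elim c by (simp add: LO_cone_param_def sgn_zero_iff)
          then show ?thesis by simp
        qed
        have "norm (?F x) \<le> 1" using True R norm_LO_cone_param[OF sphere_f] by simp
        then have "?F x \<bullet> ?F x \<le> 1" by (simp add: dot_square_norm power_le_one)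
        then have h2: "h (?F x \<bullet> ?F x - 1) = 0" by (intro h(2)) simp
        obtain N where N: "2 / (fst (?F x) \<bullet> fst (?F x)) \<le> real N" using real_arch_simple by blast
        have "cut j (?F x) = 1" if "j \<ge> N" for j
        proof -
          have "2 / (fst (?F x) \<bullet> fst (?F x)) \<le> real j" using N that by linarith
          then have "h (real j * (fst (?F x) \<bullet> fst (?F x)) - 1) = 1"
            using ne by (intro h(3)) (simp add: field_simps)
          then show ?thesis using h2 by (simp add: cut_def)
        qed
        then have "eventually (\<lambda>j. indicator (cball 0 R) x *\<^sub>R (W \<theta> * cut j (?F x)) = indicator (cball 0 R) x *\<^sub>R W \<theta>) sequentially"
          by (auto simp: eventually_sequentially)
        then show ?thesis by (rule tendsto_eventually)
      qed simp
    qed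
  qed (intro borel_measurable_scaleR borel_measurable_indicator borel_measurable_const, simp)
  moreover have "ereal (?T (\<omega> j)) \<le> mass DIM('a) ?T" for j
    unfolding mass_def by (rule SUP_upper) (use test comass in auto)
  ultimately have "ereal (\<integral>x. indicator (cball (0::'a) R) x *\<^sub>R W \<theta> \<partial>lborel) \<le> mass DIM('a) ?T"
    by (intro LIMSEQ_le_const2[where X="\<lambda>j. ereal (?T (\<omega> j))"]) auto
  moreover have "(\<integral>x. indicator (cball (0::'a) R) x *\<^sub>R W \<theta> \<partial>lborel) = W \<theta> * measure lborel (cball (0::'a) R)"
    by (simp add: mult.commute)
  ultimately show ?thesis by (simp only:)
qed

end

section \<open>Comparison currents\<close>

lemma smooth_real_derivative:
  fixes g :: "real \<Rightarrow> real"
  assumes "smooth_on UNIV g"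
  shows "(g has_real_derivative deriv g r) (at r)" "continuous_on UNIV (deriv g)"
proof -
  have D: "(g has_derivative frechet_derivative g (at r)) (at r)" for r
    by (rule smooth_on_has_derivative[OF open_UNIV assms UNIV_I])
  have e: "frechet_derivative g (at r) = (*) (frechet_derivative g (at r) 1)" for r
  proof
    fix v :: real
    show "frechet_derivative g (at r) v = frechet_derivative g (at r) 1 * v"
      using linear_cmul[OF has_derivative_linear[OF D], of r v 1] by (simp add: mult.commute)
  qed
  have d: "(g has_real_derivative frechet_derivative g (at r) 1) (at r)" for r
    unfolding has_field_derivative_def by (subst e[symmetric]) (rule D)
  then have de: "deriv g = (\<lambda>r. frechet_derivative g (at r) 1)" by (auto intro: DERIV_imp_deriv)
  show "(g has_real_derivative deriv g r) (at r)" using d de by simp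
  show "continuous_on UNIV (deriv g)"
    unfolding de by (rule smooth_on_continuous[OF smooth_on_frechet[OF assms]])
qed

lemma deriv_eq_0_locally_const:
  fixes g :: "real \<Rightarrow> real"
  assumes "open S" "r \<in> S" "\<And>s. s \<in> S \<Longrightarrow> g s = c"
  shows "deriv g r = 0"
  by (rule DERIV_imp_deriv, rule has_field_derivative_transform_within_open[OF _ assms(1,2)])
    (auto simp: assms(3))

lemma bounded_deriv_of_compact_variation:
  fixes g :: "real \<Rightarrow> real"
  assumes g: "smooth_on UNIV g" and "\<And>t. t \<le> a \<Longrightarrow> g t = c" "\<And>t. t \<ge> b \<Longrightarrow> g t = d"
  obtains M where "M \<ge> 0" "\<And>t. \<bar>deriv g t\<bar> \<le> M" "\<And>t. deriv g t \<noteq> 0 \<Longrightarrow> a \<le> t \<and> t \<le> b"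
proof -
  have z: "a \<le> t \<and> t \<le> b" if "deriv g t \<noteq> 0" for t
  proof (rule ccontr)
    assume "\<not> (a \<le> t \<and> t \<le> b)"
    then consider "t \<in> {..<a}" | "t \<in> {b<..}" by fastforce
    then show False
      by cases (use that deriv_eq_0_locally_const[of "{..<a}" t g c] deriv_eq_0_locally_const[of "{b<..}" t g d]
        assms in auto)
  qed
  have "bounded (deriv g ` {a..b})"
    by (intro compact_imp_bounded compact_continuous_image continuous_on_subset[OF smooth_real_derivative(2)[OF g]]) auto
  then obtain M where M: "\<forall>t\<in>{a..b}. \<bar>deriv g t\<bar> \<le> M" by (auto simp: bounded_iff)
  have "\<bar>deriv g t\<bar> \<le> \<bar>M\<bar>" for t
  proof (cases "deriv g t = 0")
    case False
    then have "\<bar>deriv g t\<bar> \<le> M" using M z by simp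
    then show ?thesis by linarith
  qed simp
  then show ?thesis using that[of "\<bar>M\<bar>"] z by auto
qed

text \<open>Smooth approximations of \<open>r \<mapsto> min r R\<close> that vanish near the origin.\<close>

lemma cutoff_profiles:
  fixes R :: real
  assumes R: "R > 0"
  obtains g :: "nat \<Rightarrow> real \<Rightarrow> real" and K :: real where "\<And>j. smooth_on UNIV (g j)"
    "\<And>j. \<exists>d>0. \<forall>r<d. g j r = 0" "\<And>j r. r \<ge> R \<Longrightarrow> g j r = R"
    "\<And>j r. r > 0 \<Longrightarrow> \<bar>g j r\<bar> \<le> K * r" "\<And>j r. r > 0 \<Longrightarrow> \<bar>deriv (g j) r\<bar> \<le> K"
    "\<And>r. 0 < r \<Longrightarrow> r < R \<Longrightarrow> \<exists>N. \<forall>j\<ge>N. \<exists>e>0. \<forall>s. \<bar>s - r\<bar> < e \<longrightarrow> g j s = s" "K \<ge> 0"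
proof -
  obtain h :: "real \<Rightarrow> real" where h: "smooth_on UNIV h" "\<And>t. t \<le> 0 \<Longrightarrow> h t = 0"
    "\<And>t. t \<ge> 1 \<Longrightarrow> h t = 1" "\<And>t. 0 \<le> h t" "\<And>t. h t \<le> 1"
    using smooth_step_exists by blast
  obtain M where M: "M \<ge> 0" "\<And>t. \<bar>deriv h t\<bar> \<le> M" "\<And>t. deriv h t \<noteq> 0 \<Longrightarrow> 0 \<le> t \<and> t \<le> 1"
    using bounded_deriv_of_compact_variation[OF h(1-3)] by blast
  \<comment> \<open>The summand 2 / R keeps the two transitions apart: \<open>u j\<close> rises
    between 1/(2m) and 1/m, and \<open>k j\<close> rises between R - 1/m and R.\<close>
  define m where "m j = real j + 2 / R" for j :: nat
  have mR: "m j * R \<ge> 2" "m j > 0" for j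
    using R by (simp_all add: m_def distrib_right add_nonneg_pos)
  define u where "u j r = h (2 * m j * r - 1)" for j r
  define k where "k j r = h (1 + m j * (r - R))" for j r
  define g where "g j r = r * u j r * (1 - k j r) + R * k j r" for j r
  have lin: "smooth_on UNIV (\<lambda>r. h (a * r + b))" for a b
    by (rule smooth_on_compose[OF open_UNIV open_UNIV UNIV_I h(1)])
      (intro smooth_on_add smooth_on_mult smooth_on_const smooth_on_id open_UNIV)
  have su: "smooth_on UNIV (u j)" for j using lin[of "2 * m j" "-1"] by (simp add: u_def[abs_def])
  have sk: "smooth_on UNIV (k j)" for j using lin[of "m j" "1 - m j * R"] by (simp add: k_def[abs_def] algebra_simps)
  have sg: "smooth_on UNIV (g j)" for j unfolding g_def[abs_def]
    by (intro smooth_on_add smooth_on_mult smooth_on_diff smooth_on_const smooth_on_id open_UNIV su sk)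
  have u01: "0 \<le> u j r" "u j r \<le> 1" and k01: "0 \<le> k j r" "k j r \<le> 1" for j r
    using h(4,5) by (auto simp: u_def k_def)
  have k0: "k j r = 0" if "m j * (R - r) \<ge> 1" for j r
    unfolding k_def by (rule h(2)) (use that in \<open>simp add: algebra_simps\<close>)
  have u1: "u j r = 1" if "m j * r \<ge> 1" for j r
    unfolding u_def by (rule h(3)) (use that in simp)
  have z: "\<exists>d>0. \<forall>r<d. g j r = 0" for j
  proof (intro exI[of _ "1 / (2 * m j)"] conjI allI impI)
    fix r assume "r < 1 / (2 * m j)"
    then have r: "2 * m j * r < 1" using mR(2)[of j] by (simp add: field_simps)
    then have "u j r = 0" unfolding u_def by (intro h(2)) simp
    moreover have "k j r = 0" using r mR(1)[of j] by (intro k0) (simp add: algebra_simps)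
    ultimately show "g j r = 0" by (simp add: g_def)
  qed (use mR in simp)
  have gR: "g j r = R" if "r \<ge> R" for j r
  proof -
    have "k j r = 1" unfolding k_def using that mR(2)[of j] by (intro h(3)) simp
    then show ?thesis by (simp add: g_def)
  qed
  \<comment> \<open>The constant is 1 + 2: the first summand is at most r, and the second is nonzero
    only for r \<ge> R / 2.\<close>
  have gb: "\<bar>g j r\<bar> \<le> 3 * r" if r: "r > 0" for j r
  proof -
    have "r * u j r * (1 - k j r) \<le> r" "0 \<le> r * u j r * (1 - k j r)"
      using r u01[of j r] k01[of j r] by (auto simp: mult.assoc intro!: mult_left_le mult_le_one)
    moreover have "R * k j r \<le> 2 * r" "0 \<le> R * k j r"
    proof -
      show "R * k j r \<le> 2 * r"
      proof (cases "k j r = 0")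
        case False
        then have "m j * (R - r) < 1" using k0[of j r] by linarith
        then have "m j * (2 * r) \<ge> m j * R" using mR(1)[of j] by (simp add: algebra_simps)
        then have "R \<le> 2 * r" using mR(2)[of j] by (simp del: mult.left_commute)
        then show ?thesis using k01[of j r] R mult_left_le[of "k j r" R] by linarith
      qed (use r in simp)
    qed (use R k01 in simp)
    ultimately show ?thesis by (simp add: g_def)
  qed
  have gd: "\<bar>deriv (g j) r\<bar> \<le> 1 + 3 * M" if r: "r > 0" for j r
  proof -
    let ?a = "deriv h (2 * m j * r - 1)" and ?b = "deriv h (1 + m j * (r - R))"
    have du: "(u j has_real_derivative ?a * (2 * m j)) (at r)"
      unfolding u_def[abs_def]
      by (rule DERIV_chain'[OF _ smooth_real_derivative(1)[OF h(1)]]) (auto intro!: derivative_eq_intros)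
    have dk: "(k j has_real_derivative ?b * m j) (at r)"
      unfolding k_def[abs_def]
      by (rule DERIV_chain'[OF _ smooth_real_derivative(1)[OF h(1)]]) (auto intro!: derivative_eq_intros)
    have "(g j has_real_derivative (1 * u j r + ?a * (2 * m j) * r) * (1 - k j r) + (0 - ?b * m j) * (r * u j r)
        + (0 * k j r + ?b * m j * R)) (at r)"
      unfolding g_def[abs_def]
      by (intro DERIV_add DERIV_mult DERIV_diff DERIV_const DERIV_ident du dk)
    then have D: "deriv (g j) r = u j r * (1 - k j r) + 2 * (m j * r * ?a) * (1 - k j r) + m j * ?b * (R - r * u j r)"
      by (rule DERIV_imp_deriv[THEN trans]) (simp add: algebra_simps)
    \<comment> \<open>The large factor \<open>m j\<close> from the chain rule is harmless, since
      \<open>?a\<close> vanishes unless m r \<le> 1. At the outer transition it meets R - r in the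
      same way, because \<open>u j\<close> is already 1 there.\<close>
    have "\<bar>m j * r * ?a\<bar> \<le> M"
    proof (cases "?a = 0")
      case False
      then have "m j * r \<le> 1" using M(3) by fastforce
      have "\<bar>m j * r * ?a\<bar> = (m j * r) * \<bar>?a\<bar>" using r mR(2)[of j] by (simp add: abs_mult)
      also have "\<dots> \<le> 1 * M" by (intro mult_mono M(2) \<open>m j * r \<le> 1\<close>) auto
      finally show ?thesis by simp
    qed (use M in simp)
    then have "\<bar>m j * r * ?a\<bar> * \<bar>1 - k j r\<bar> \<le> M * 1"
      using k01[of j r] M(1) by (intro mult_mono) auto
    then have 2: "\<bar>2 * (m j * r * ?a) * (1 - k j r)\<bar> \<le> 2 * M" by (simp only: abs_mult)
    have 3: "\<bar>m j * ?b * (R - r * u j r)\<bar> \<le> M"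
    proof (cases "?b = 0")
      case False
      then have b: "0 \<le> 1 + m j * (r - R)" "m j * (r - R) \<le> 0" using M(3) by fastforce+
      then have "m j * r \<ge> 1" using mR(1)[of j] by (simp add: algebra_simps)
      then have u: "u j r = 1" by (rule u1)
      have "m j * ?b * (R - r * u j r) = (m j * (R - r)) * ?b" by (simp add: u)
      moreover have "0 \<le> m j * (R - r)" "m j * (R - r) \<le> 1" using b by (simp_all add: algebra_simps)
      then have "\<bar>(m j * (R - r)) * ?b\<bar> \<le> 1 * M"
        unfolding abs_mult by (intro mult_mono M(2)) auto
      ultimately show ?thesis by (simp only: mult_1_left)
    qed (use M in simp)
    have 1: "\<bar>u j r * (1 - k j r)\<bar> \<le> 1"
      using u01[of j r] k01[of j r] by (simp add: abs_mult mult_le_one)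
    show ?thesis unfolding D using 1 2 3 by linarith
  qed
  have id: "\<exists>N. \<forall>j\<ge>N. \<exists>e>0. \<forall>s. \<bar>s - r\<bar> < e \<longrightarrow> g j s = s" if r: "0 < r" "r < R" for r
  proof -
    define e where "e = min (r / 2) ((R - r) / 2)"
    have e: "e > 0" using r by (simp add: e_def)
    obtain N where N: "1 / e \<le> real N" using real_arch_simple by blast
    have "g j s = s" if "j \<ge> N" "\<bar>s - r\<bar> < e" for j s
    proof -
      have "1 / e \<le> m j" using N that(1) R by (simp add: m_def add_increasing2)
      then have me: "m j * e \<ge> 1" using e by (simp add: field_simps)
      have e1: "e \<le> r / 2" unfolding e_def by (rule min.cobounded1)
      have e2: "e \<le> (R - r) / 2" unfolding e_def by (rule min.cobounded2)
      have "s - r < e" "r - s < e" using that(2) by linarith+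
      then have "s \<ge> e" "R - s \<ge> e" using e1 e2 by argo+
      then have "m j * s \<ge> 1" "m j * (R - s) \<ge> 1"
        using me mult_left_mono[of e _ "m j"] mR(2)[of j] by (meson less_imp_le order_trans)+
      then show ?thesis by (simp add: g_def u1 k0)
    qed
    then show ?thesis using e by blast
  qed
  show ?thesis
  proof (rule that[OF sg z gR])
    show "\<bar>g j r\<bar> \<le> (3 + 3 * M) * r" if "r > 0" for j r
      using gb[OF that, of j] M(1) that by (simp add: algebra_simps add_increasing2)
    show "\<bar>deriv (g j) r\<bar> \<le> 3 + 3 * M" if "r > 0" for j r using gd[OF that, of j] by simp
  qed (use id M(1) in auto)
qed

text \<open>Boundaries of currents involve test forms of arbitrary size; after rescaling, the
  Jacobian bounds for comass one supply a dominating function for them too.\<close>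

lemma test_form_bounded:
  fixes \<omega> :: "'c::euclidean_space form"
  assumes \<omega>: "\<omega> \<in> test_forms k"
  obtains C where "C > 0" "\<And>x. comass_le_one k (\<lambda>vs. \<omega> x vs / C)"
proof -
  note alt = test_formsD(1)[OF \<omega>]
  obtain S where S: "compact S" "\<And>x vs. x \<notin> S \<Longrightarrow> \<omega> x vs = 0"
    using \<omega> unfolding test_forms_def by blast
  have base: "\<exists>C. \<forall>x. \<bar>\<omega> x us\<bar> \<le> C" for us
  proof -
    have "bounded ((\<lambda>x. \<omega> x us) ` S)"
      using smooth_on_continuous[OF test_formsD(2)[OF \<omega>]] S(1)
      by (intro compact_imp_bounded compact_continuous_image) (auto intro: continuous_on_subset)
    then obtain C where C: "\<forall>x\<in>S. \<bar>\<omega> x us\<bar> \<le> C" by (auto simp: bounded_iff)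
    have "\<bar>\<omega> x us\<bar> \<le> \<bar>C\<bar>" for x
    proof (cases "x \<in> S")
      case True
      then have "\<bar>\<omega> x us\<bar> \<le> C" using C by blast
      then show ?thesis by linarith
    qed (simp add: S(2))
    then show ?thesis by blast
  qed
  \<comment> \<open>Slots from \<open>m\<close> on are frozen at \<open>us\<close>. Releasing a slot
    costs a finite sum over the basis, because coordinates of a vector in the unit ball are at most
    1.\<close>
  have "\<exists>C. \<forall>x vs. length vs = k \<and> (\<forall>i<k. norm (vs ! i) \<le> 1) \<and> (\<forall>i<k. m \<le> i \<longrightarrow> vs ! i = us i) \<longrightarrow> \<bar>\<omega> x vs\<bar> \<le> C"
    if "m \<le> k" for m us
    using that
  proof (induction m arbitrary: us)
    case 0
    obtain C where C: "\<And>x. \<bar>\<omega> x (map us [0..<k])\<bar> \<le> C" using base by blast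
    have "vs = map us [0..<k]" if "length vs = k" "\<forall>i<k. vs ! i = us i" for vs
      using that by (auto intro: nth_equalityI)
    then show ?case using C by (intro exI[of _ C]) auto
  next
    case (Suc m)
    have m: "m < k" using Suc.prems by simp
    have "\<forall>b. \<exists>C. \<forall>x vs. length vs = k \<and> (\<forall>i<k. norm (vs ! i) \<le> 1) \<and>
        (\<forall>i<k. m \<le> i \<longrightarrow> vs ! i = (us(m := b)) i) \<longrightarrow> \<bar>\<omega> x vs\<bar> \<le> C"
      using Suc.IH m by simp
    then obtain C where C: "\<And>b x vs. length vs = k \<Longrightarrow> (\<forall>i<k. norm (vs ! i) \<le> 1) \<Longrightarrow>
        (\<forall>i<k. m \<le> i \<longrightarrow> vs ! i = (us(m := b)) i) \<Longrightarrow> \<bar>\<omega> x vs\<bar> \<le> C b" by metis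
    have "\<bar>\<omega> x vs\<bar> \<le> (\<Sum>b\<in>Basis. \<bar>C b\<bar>)"
      if vs: "length vs = k" "\<forall>i<k. norm (vs ! i) \<le> 1" "\<forall>i<k. Suc m \<le> i \<longrightarrow> vs ! i = us i" for x vs
    proof -
      have "\<omega> x vs = \<omega> x (vs[m := vs ! m])" by simp
      also have "\<dots> = (\<Sum>b\<in>Basis. (vs ! m \<bullet> b) * \<omega> x (vs[m := b]))" by (rule form_expand_slot[OF alt vs(1) m])
      also have "\<bar>\<dots>\<bar> \<le> (\<Sum>b\<in>Basis. \<bar>C b\<bar>)"
      proof (rule order_trans[OF sum_abs sum_mono])
        fix b :: 'c assume b: "b \<in> Basis"
        have "\<bar>vs ! m \<bullet> b\<bar> \<le> 1" using Basis_le_norm[OF b, of "vs ! m"] vs(2) m by fastforce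
        moreover have "\<bar>\<omega> x (vs[m := b])\<bar> \<le> C b"
        proof (rule C)
          show "\<forall>i<k. norm (vs[m := b] ! i) \<le> 1" using vs b m by (simp add: nth_list_update)
          show "\<forall>i<k. m \<le> i \<longrightarrow> vs[m := b] ! i = (us(m := b)) i" using vs m by (simp add: nth_list_update)
        qed (simp add: vs)
        ultimately have "\<bar>vs ! m \<bullet> b\<bar> * \<bar>\<omega> x (vs[m := b])\<bar> \<le> 1 * \<bar>C b\<bar>" by (intro mult_mono) auto
        then show "\<bar>(vs ! m \<bullet> b) * \<omega> x (vs[m := b])\<bar> \<le> \<bar>C b\<bar>" by (simp add: abs_mult)
      qed
      finally show ?thesis .
    qed
    then show ?case by blast
  qed
  from this[of k] obtain C where C: "\<And>x vs. length vs = k \<Longrightarrow> (\<forall>i<k. norm (vs ! i) \<le> 1) \<Longrightarrow> \<bar>\<omega> x vs\<bar> \<le> C" by force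
  have "comass_le_one k (\<lambda>vs. \<omega> x vs / (\<bar>C\<bar> + 1))" for x
    unfolding comass_le_one_def
  proof (intro allI impI, elim conjE)
    fix vs :: "'c list" assume vs: "length vs = k" "orthonormal vs"
    then have "norm (vs ! i) = 1" if "i < k" for i using that by (simp add: orthonormal_def norm_eq_1)
    then have "\<bar>\<omega> x vs\<bar> \<le> C" using C vs by simp
    then show "\<bar>\<omega> x vs / (\<bar>C\<bar> + 1)\<bar> \<le> 1" by (simp add: abs_divide)
  qed
  then show ?thesis using that[of "\<bar>C\<bar> + 1"] by auto
qed

lemma AE_norm_neq: "AE x in lborel. norm (x :: 'a::euclidean_space) \<noteq> R"
proof -
  have "sphere (0::'a) R \<in> null_sets lebesgue" using negligible_sphere[of "0::'a" R] by (simp add: negligible_iff_null_sets)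
  then have "AE x in lebesgue. x \<notin> sphere (0::'a) R" by (rule AE_not_in)
  then have "AE x in lborel. x \<notin> sphere (0::'a) R" by (simp add: AE_completion_iff)
  then show ?thesis by simp
qed

lemma set_integrable_ubox_continuous:
  fixes F :: "'a::euclidean_space \<Rightarrow> real"
  assumes "continuous_on UNIV F"
  shows "integrable lborel (\<lambda>x. indicator ubox x *\<^sub>R F x)"
proof -
  have "set_integrable lborel cubox F"
    unfolding set_integrable_def
    by (rule borel_integrable_compact[OF cubox(1)]) (use assms continuous_on_subset in blast)
  then have "set_integrable lborel ubox F"
    by (rule set_integrable_subset) (simp add: ubox_def, rule cubox(3))
  then show ?thesis by (simp add: set_integrable_def)
qed

section \<open>Smooth cubes that fill equivariant surfaces\<close>

context equal_singular_value_map
begin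

definition profile_map :: "(real \<Rightarrow> real) \<Rightarrow> (real \<Rightarrow> real) \<Rightarrow> 'a \<Rightarrow> 'a \<times> 'b" where
  "profile_map g \<phi> = radial_map f (\<lambda>r. g r * cos (\<phi> r)) (\<lambda>r. g r * sin (\<phi> r))"

definition jprof :: "(real \<Rightarrow> real) \<Rightarrow> (real \<Rightarrow> real) \<Rightarrow> real \<Rightarrow> real" where
  "jprof g \<phi> r = sqrt ((deriv g r)\<^sup>2 + (g r * deriv \<phi> r)\<^sup>2) * (\<bar>g r\<bar> / r) ^ n * W (\<phi> r)"

lemma smooth_profile_map:
  assumes "smooth_on UNIV g" "smooth_on UNIV \<phi>" "\<exists>d>0. \<forall>r<d. g r = 0"
  shows "smooth_on UNIV (profile_map g \<phi>)"
proof -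
  have "smooth_on UNIV (\<lambda>r. g r * cos (\<phi> r))" "smooth_on UNIV (\<lambda>r. g r * sin (\<phi> r))"
    by (rule smooth_on_mult[OF open_UNIV assms(1) smooth_on_compose[OF open_UNIV open_UNIV UNIV_I smooth_on_sin_cos(2) assms(2)]],
        rule smooth_on_mult[OF open_UNIV assms(1) smooth_on_compose[OF open_UNIV open_UNIV UNIV_I smooth_on_sin_cos(1) assms(2)]])
  then have "smooth_on {0<..} (\<lambda>r. g r * cos (\<phi> r))" "smooth_on {0<..} (\<lambda>r. g r * sin (\<phi> r))"
    by (auto intro: smooth_on_subset)
  moreover obtain d where "d > 0" "\<forall>r<d. g r = 0" using assms(3) by blast
  ultimately show ?thesis unfolding profile_map_def by (intro smooth_on_radial_map_UNIV[OF smooth_f]) auto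
qed

lemma profile_map_form_le:
  assumes g: "smooth_on UNIV g" and \<phi>: "smooth_on UNIV \<phi>" and y: "y \<noteq> 0"
    and \<omega>: "alternating_form DIM('a) \<omega>" "comass_le_one DIM('a) \<omega>"
  shows "\<bar>\<omega> (map (frechet_derivative (profile_map g \<phi>) (at y)) ordered_basis)\<bar> \<le> jprof g \<phi> (norm y)"
proof -
  let ?r = "norm y"
  note d = smooth_real_derivative(1)[OF g, of ?r] smooth_real_derivative(1)[OF \<phi>, of ?r]
  have 1: "((\<lambda>r. g r * cos (\<phi> r)) has_real_derivative (deriv g ?r * cos (\<phi> ?r) - g ?r * sin (\<phi> ?r) * deriv \<phi> ?r)) (at ?r)"
    by (rule DERIV_cong[OF DERIV_mult[OF d(1) DERIV_fun_cos[OF d(2)]]]) (simp add: algebra_simps)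
  have 2: "((\<lambda>r. g r * sin (\<phi> r)) has_real_derivative (deriv g ?r * sin (\<phi> ?r) + g ?r * cos (\<phi> ?r) * deriv \<phi> ?r)) (at ?r)"
    by (rule DERIV_cong[OF DERIV_mult[OF d(1) DERIV_fun_sin[OF d(2)]]]) (simp add: algebra_simps)
  have "?r > 0" using y by simp
  from radial_map_form_le[OF y 1 2 \<omega>] show ?thesis
    unfolding profile_map_def jprof_def jac_polar[OF \<open>?r > 0\<close>] .
qed

lemma W_le: "W \<phi> \<le> sqrt (1 + \<mu>\<^sup>2) ^ p" "0 \<le> W \<phi>"
proof -
  have "(cos \<phi>)\<^sup>2 \<le> 1" "(sin \<phi>)\<^sup>2 \<le> 1" by (simp_all add: abs_square_le_1)
  then have "(cos \<phi>)\<^sup>2 + \<mu>\<^sup>2 * (sin \<phi>)\<^sup>2 \<le> 1 + \<mu>\<^sup>2" by (intro add_mono mult_left_le) auto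
  then have "sqrt ((cos \<phi>)\<^sup>2 + \<mu>\<^sup>2 * (sin \<phi>)\<^sup>2) ^ p \<le> sqrt (1 + \<mu>\<^sup>2) ^ p"
    by (intro power_mono) auto
  moreover have "\<bar>cos \<phi>\<bar> ^ (n - p) \<le> 1" by (intro power_le_one) auto
  ultimately show "W \<phi> \<le> sqrt (1 + \<mu>\<^sup>2) ^ p"
    unfolding W_def by (meson abs_ge_zero mult_left_le order_trans zero_le_power real_sqrt_ge_zero
      sum_power2_ge_zero zero_le_power2 add_nonneg_nonneg mult_nonneg_nonneg)
  show "0 \<le> W \<phi>" unfolding W_def by (intro mult_nonneg_nonneg zero_le_power) auto
qed

lemma continuous_W: "continuous_on UNIV W"
  unfolding W_def[abs_def] by (intro continuous_intros)

lemma jprof_measurable: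
  assumes g: "smooth_on UNIV g" and \<phi>: "smooth_on UNIV \<phi>"
  shows "(\<lambda>x::'a. jprof g \<phi> (norm x)) \<in> borel_measurable borel"
proof -
  note [measurable] = borel_measurable_continuous_onI[OF smooth_real_derivative(2)[OF g]]
    borel_measurable_continuous_onI[OF smooth_real_derivative(2)[OF \<phi>]]
    borel_measurable_continuous_onI[OF smooth_on_continuous[OF g]]
    borel_measurable_continuous_onI[OF smooth_on_continuous[OF \<phi>]]
    borel_measurable_continuous_onI[OF continuous_W]
  show ?thesis unfolding jprof_def by measurable
qed

text \<open>\<open>jprof\<close> at r > 0 for the identity radius g(r) = r, the limit of the cutoff
  radii inside the ball.\<close>

definition area_density :: "(real \<Rightarrow> real) \<Rightarrow> real \<Rightarrow> real" where
  "area_density \<phi> r = sqrt (1 + (r * deriv \<phi> r)\<^sup>2) * W (\<phi> r)"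

lemma area_density_measurable:
  assumes \<phi>: "smooth_on UNIV \<phi>"
  shows "(\<lambda>x::'a. area_density \<phi> (norm x)) \<in> borel_measurable borel"
proof -
  note [measurable] = borel_measurable_continuous_onI[OF smooth_real_derivative(2)[OF \<phi>]]
    borel_measurable_continuous_onI[OF smooth_on_continuous[OF \<phi>]]
    borel_measurable_continuous_onI[OF continuous_W]
  show ?thesis unfolding area_density_def by measurable
qed

text \<open>The competitor is a cube with radius \<open>g j\<close> and angle \<phi>. Its Jacobians
  converge dominatedly to \<open>area_density \<phi>\<close> on the ball and to 0 outside, so for
  large \<open>j\<close> the mass is below \<open>c\<close>; the strict inequality in the assumption
  pays for the cutoff.\<close>

theorem comparison_currents:
  assumes R: "0 < R" "R < 1 / 2"
    and \<phi>: "smooth_on UNIV \<phi>" "\<And>r. r \<ge> R \<Longrightarrow> \<phi> r = \<theta>" "\<And>r. r \<le> 0 \<Longrightarrow> \<phi> r = \<theta>"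
    and less: "(\<integral>x. indicator (cball (0::'a) R) x *\<^sub>R area_density \<phi> (norm x) \<partial>lborel) < c"
  obtains S where "integral_current DIM('a) S"
    "eq_current n (boundary S) (boundary (truncated_cone (LO_cone_param f \<theta>) R))"
    "mass DIM('a) S \<le> ereal c"
proof -
  obtain g :: "nat \<Rightarrow> real \<Rightarrow> real" and K where g: "\<And>j. smooth_on UNIV (g j)"
    "\<And>j. \<exists>d>0. \<forall>r<d. g j r = 0" "\<And>j r. r \<ge> R \<Longrightarrow> g j r = R"
    "\<And>j r. r > 0 \<Longrightarrow> \<bar>g j r\<bar> \<le> K * r" "\<And>j r. r > 0 \<Longrightarrow> \<bar>deriv (g j) r\<bar> \<le> K"
    "\<And>r. 0 < r \<Longrightarrow> r < R \<Longrightarrow> \<exists>N. \<forall>j\<ge>N. \<exists>e>0. \<forall>s. \<bar>s - r\<bar> < e \<longrightarrow> g j s = s" "K \<ge> 0"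
    using cutoff_profiles[OF R(1)] by blast
  let ?c = "\<lambda>_::real. \<theta>"
  have smc: "smooth_on UNIV ?c" by (rule smooth_on_const[OF open_UNIV])
  define \<Psi> where "\<Psi> \<psi> j = profile_map (g j) \<psi>" for \<psi> j
  define S where "S \<psi> j = cube_current DIM('a) (\<lambda>t. \<Psi> \<psi> j (emb t))" for \<psi> j
  have sm: "smooth_on UNIV (\<Psi> \<psi> j)" if "smooth_on UNIV \<psi>" for \<psi> j
    unfolding \<Psi>_def by (rule smooth_profile_map[OF g(1) that g(2)])
  have far: "\<Psi> \<psi> j x = (R *\<^sub>R (cos \<theta> *\<^sub>R sgn x), R *\<^sub>R (sin \<theta> *\<^sub>R f (sgn x)))"
    if "\<And>r. r \<ge> R \<Longrightarrow> \<psi> r = \<theta>" "norm x \<ge> R" for \<psi> j x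
    unfolding \<Psi>_def profile_map_def radial_map_def using that g(3) by simp
  \<comment> \<open>A point on a face has a coordinate of modulus 1/2 > R, and beyond radius R the
    map depends neither on the cutoff nor on the profile of the angle.\<close>
  have faces: "face_chain (Suc n) (\<Psi> \<psi> j) = face_chain (Suc n) (\<Psi> ?c i)"
    if "\<And>r. r \<ge> R \<Longrightarrow> \<psi> r = \<theta>" for \<psi> i j
  proof -
    have "face (\<Psi> \<psi> j) l s = face (\<Psi> ?c i) l s" if l: "l < Suc n" and s: "s = 0 \<or> s = 1" for l s
    proof
      fix t
      have "\<bar>(emb (ins l s t) :: 'a) \<bullet> ordered_basis ! l\<bar> = 1 / 2"
        using l s dim by (auto simp: emb_inner ins_skip)
      moreover have "ordered_basis ! l \<in> (Basis :: 'a set)"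
        using l dim ordered_basis(2,3)[where 'a='a] nth_mem by metis
      ultimately have "norm (emb (ins l s t) :: 'a) \<ge> 1 / 2" by (metis Basis_le_norm)
      then have "R \<le> norm (emb (ins l s t) :: 'a)" using R by simp
      then show "face (\<Psi> \<psi> j) l s t = face (\<Psi> ?c i) l s t"
        unfolding face_def using far[OF \<open>\<And>r. r \<ge> R \<Longrightarrow> \<psi> r = \<theta>\<close>] far[of ?c] by simp
    qed
    then show ?thesis unfolding face_chain_def by simp
  qed
  have bd: "boundary (S \<psi> j) \<omega> = boundary (S ?c i) \<omega>"
    if "smooth_on UNIV \<psi>" "\<And>r. r \<ge> R \<Longrightarrow> \<psi> r = \<theta>" "\<omega> \<in> test_forms n" for \<psi> i j \<omega>
    unfolding S_def dim
    using boundary_cube[OF dim sm[where j=j, OF that(1)] that(3)] boundary_cube[OF dim sm[where j=i, OF smc] that(3)]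
      faces[where \<psi>=\<psi> and j=j and i=i, OF that(2)] by simp
  have S_param: "S \<psi> j \<xi> = (\<integral>x. indicator ubox x *\<^sub>R \<xi> (\<Psi> \<psi> j x) (map (frechet_derivative (\<Psi> \<psi> j) (at x)) ordered_basis) \<partial>lborel)"
    if "smooth_on UNIV \<psi>" "\<xi> \<in> test_forms DIM('a)" for \<psi> j \<xi>
    unfolding S_def cube_current_eq_param_current[OF that(2) sm[OF that(1)]] param_current_def set_lebesgue_integral_def ..
  \<comment> \<open>The bound is uniform in \<open>j\<close> and serves for dominated convergence.
    Beyond R radius and angle are constant, so the Jacobian is 0; the null sphere r = R is left
    out.\<close>
  have jb: "\<exists>B. \<forall>j r. r > 0 \<longrightarrow> r \<noteq> R \<longrightarrow> \<bar>jprof (g j) \<psi> r\<bar> \<le> B"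
    and j0: "\<And>j r. r > R \<Longrightarrow> jprof (g j) \<psi> r = 0"
    if \<psi>: "smooth_on UNIV \<psi>" "\<And>r. r \<ge> R \<Longrightarrow> \<psi> r = \<theta>" "\<And>r. r \<le> 0 \<Longrightarrow> \<psi> r = \<theta>" for \<psi>
  proof -
    show z: "jprof (g j) \<psi> r = 0" if "r > R" for j r
    proof -
      have "deriv (g j) r = 0" by (rule deriv_eq_0_locally_const[of "{R<..}" _ _ R]) (use that g(3) in auto)
      moreover have "deriv \<psi> r = 0" by (rule deriv_eq_0_locally_const[of "{R<..}" _ _ \<theta>]) (use that \<psi>(2) in auto)
      ultimately show ?thesis by (simp add: jprof_def)
    qed
    obtain M where M: "M \<ge> 0" "\<And>t. \<bar>deriv \<psi> t\<bar> \<le> M"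
      using bounded_deriv_of_compact_variation[OF \<psi>(1,3,2)] by metis
    define B where "B = (K + K * R * M) * K ^ n * sqrt (1 + \<mu>\<^sup>2) ^ p"
    have "\<bar>jprof (g j) \<psi> r\<bar> \<le> B" if r: "r > 0" "r \<noteq> R" for j r
    proof (cases "r < R")
      case True
      have "\<bar>g j r * deriv \<psi> r\<bar> \<le> (K * R) * M"
        unfolding abs_mult
        by (intro mult_mono M order_trans[OF g(4)[OF r(1)]]) (use True g(7) R r in auto)
      then have "sqrt ((deriv (g j) r)\<^sup>2 + (g j r * deriv \<psi> r)\<^sup>2) \<le> K + K * R * M"
        using g(5)[OF r(1), of j] sqrt_sum_squares_le_sum_abs[of "deriv (g j) r" "g j r * deriv \<psi> r"] by linarith
      moreover have "(\<bar>g j r\<bar> / r) ^ n \<le> K ^ n"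
        using g(4)[OF r(1), of j] r by (intro power_mono) (auto simp: field_simps)
      ultimately have "jprof (g j) \<psi> r \<le> B"
        unfolding jprof_def B_def using g(7) r M(1) R W_le
        by (intro mult_mono mult_nonneg_nonneg add_nonneg_nonneg zero_le_power) auto
      moreover have "jprof (g j) \<psi> r \<ge> 0"
        unfolding jprof_def using r W_le(2) by (intro mult_nonneg_nonneg zero_le_power) auto
      ultimately show ?thesis by simp
    next
      case False
      moreover have "B \<ge> 0" unfolding B_def using g(7) M(1) R by (intro mult_nonneg_nonneg add_nonneg_nonneg zero_le_power) auto
      ultimately show ?thesis using z[of r j] r by simp
    qed
    then show "\<exists>B. \<forall>j r. r > 0 \<longrightarrow> r \<noteq> R \<longrightarrow> \<bar>jprof (g j) \<psi> r\<bar> \<le> B" by blast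
  qed
  have ub: "integrable lborel (\<lambda>x::'a. indicator ubox x *\<^sub>R (B::real))" for B
    by (rule set_integrable_ubox_continuous) auto
  have sub: "cball (0::'a) R \<subseteq> ubox"
  proof
    fix x :: 'a assume "x \<in> cball 0 R"
    then have "\<bar>x \<bullet> b\<bar> < 1 / 2" if "b \<in> Basis" for b
      using Basis_le_norm[OF that, of x] R by simp
    then show "x \<in> ubox" by (simp add: mem_ubox)
  qed
  have ind_bound: "norm (indicator ubox x *\<^sub>R v) \<le> indicator ubox x *\<^sub>R B"
    if "\<bar>v\<bar> \<le> B" for x :: 'a and v B :: real
    using that by (simp add: indicator_def)
  \<comment> \<open>Eventually the cutoff is the identity on a whole neighbourhood, so maps and
    derivatives at \<open>x\<close> coincide with their limits: all pointwise limits below are of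
    eventually constant sequences.\<close>
  have near: "\<exists>N. \<forall>j\<ge>N. g j (norm x) = norm x \<and> deriv (g j) (norm x) = 1 \<and>
      (\<forall>\<psi>. \<exists>U. open U \<and> x \<in> U \<and> (\<forall>y\<in>U. \<Psi> \<psi> j y = radial_map f (\<lambda>r. r * cos (\<psi> r)) (\<lambda>r. r * sin (\<psi> r)) y))"
    if x: "x \<noteq> 0" "norm x < R" for x :: 'a
  proof -
    obtain N where N: "\<And>j. j \<ge> N \<Longrightarrow> \<exists>e>0. \<forall>s. \<bar>s - norm x\<bar> < e \<longrightarrow> g j s = s"
      using g(6)[of "norm x"] x by auto
    show ?thesis
    proof (intro exI[of _ N] allI impI)
      fix j assume "j \<ge> N"
      then obtain e where e: "e > 0" "\<And>s. \<bar>s - norm x\<bar> < e \<Longrightarrow> g j s = s" using N by blast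
      have 1: "g j (norm x) = norm x" using e by simp
      have 2: "deriv (g j) (norm x) = 1"
        by (rule DERIV_imp_deriv, rule has_field_derivative_transform_within_open[of "\<lambda>s. s" _ _ "ball (norm x) e"])
          (use e in \<open>auto simp: dist_real_def abs_minus_commute\<close>)
      have 3: "\<exists>U. open U \<and> x \<in> U \<and> (\<forall>y\<in>U. \<Psi> \<psi> j y = radial_map f (\<lambda>r. r * cos (\<psi> r)) (\<lambda>r. r * sin (\<psi> r)) y)" for \<psi>
      proof (intro exI[of _ "ball x e"] conjI ballI)
        fix y assume "y \<in> ball x e"
        then have "\<bar>norm y - norm x\<bar> < e" using norm_triangle_ineq3[of y x] by (simp add: dist_norm norm_minus_commute)
        then show "\<Psi> \<psi> j y = radial_map f (\<lambda>r. r * cos (\<psi> r)) (\<lambda>r. r * sin (\<psi> r)) y"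
          by (simp add: \<Psi>_def profile_map_def radial_map_def e(2))
      qed (use e in auto)
      show "g j (norm x) = norm x \<and> deriv (g j) (norm x) = 1 \<and>
        (\<forall>\<psi>. \<exists>U. open U \<and> x \<in> U \<and> (\<forall>y\<in>U. \<Psi> \<psi> j y = radial_map f (\<lambda>r. r * cos (\<psi> r)) (\<lambda>r. r * sin (\<psi> r)) y))"
        using 1 2 3 by blast
    qed
  qed
  obtain B where B: "\<And>j r. r > 0 \<Longrightarrow> r \<noteq> R \<Longrightarrow> \<bar>jprof (g j) \<phi> r\<bar> \<le> B" using jb[OF \<phi>] by blast
  have jint: "integrable lborel (\<lambda>x::'a. indicator ubox x *\<^sub>R jprof (g j) \<phi> (norm x))" for j
  proof (rule Bochner_Integration.integrable_bound[OF ub[of B]])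
    show "(\<lambda>x::'a. indicator ubox x *\<^sub>R jprof (g j) \<phi> (norm x)) \<in> borel_measurable lborel"
      using jprof_measurable[OF g(1) \<phi>(1), of j] by (intro borel_measurable_scaleR borel_measurable_indicator) (auto simp: ubox_def)
    show "AE x::'a in lborel. norm (indicator ubox x *\<^sub>R jprof (g j) \<phi> (norm x)) \<le> norm (indicator ubox x *\<^sub>R B)"
      using AE_norm_neq[of R] AE_norm_neq[of 0]
    proof eventually_elim
      case (elim x)
      then show ?case using B[of "norm x" j] by (auto simp: indicator_def)
    qed
  qed
  have area: "(\<lambda>j. \<integral>x. indicator ubox x *\<^sub>R jprof (g j) \<phi> (norm (x::'a)) \<partial>lborel)
      \<longlonglongrightarrow> (\<integral>x. indicator (cball (0::'a) R) x *\<^sub>R area_density \<phi> (norm x) \<partial>lborel)"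
  proof (rule integral_dominated_convergence[where w="\<lambda>x::'a. indicator ubox x *\<^sub>R B"])
    show "(\<lambda>x. indicator (cball (0::'a) R) x *\<^sub>R area_density \<phi> (norm x)) \<in> borel_measurable lborel"
      using area_density_measurable[OF \<phi>(1)] by (intro borel_measurable_scaleR borel_measurable_indicator) auto
    show "(\<lambda>x::'a. indicator ubox x *\<^sub>R jprof (g j) \<phi> (norm x)) \<in> borel_measurable lborel" for j
      using jint[of j] by simp
    show "AE x::'a in lborel. norm (indicator ubox x *\<^sub>R jprof (g j) \<phi> (norm x)) \<le> indicator ubox x *\<^sub>R B" for j
      using AE_norm_neq[of R] AE_norm_neq[of 0]
    proof eventually_elim
      case (elim x)
      then show ?case using B[of "norm x" j] by (auto simp: indicator_def)
    qed
    show "AE x::'a in lborel. (\<lambda>j. indicator ubox x *\<^sub>R jprof (g j) \<phi> (norm x))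
        \<longlonglongrightarrow> indicator (cball 0 R) x *\<^sub>R area_density \<phi> (norm x)"
      using AE_norm_neq[of R] AE_norm_neq[of 0]
    proof eventually_elim
      case (elim x)
      show ?case
      proof (cases "norm x < R")
        case True
        obtain N where N: "\<And>j. j \<ge> N \<Longrightarrow> g j (norm x) = norm x \<and> deriv (g j) (norm x) = 1"
          using near[of x] True elim by auto
        have "jprof (g j) \<phi> (norm x) = area_density \<phi> (norm x)" if "j \<ge> N" for j
          using N[OF that] elim by (simp add: jprof_def area_density_def)
        moreover have "x \<in> ubox" "x \<in> cball 0 R" using sub True by auto
        ultimately show ?thesis by (intro tendsto_eventually) (auto simp: eventually_sequentially)
      next
        case False
        then show ?thesis using j0[OF \<phi>] elim by simp
      qed
    qed
  qed (rule ub)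
  have mass_le: "mass DIM('a) (S \<phi> j) \<le> ereal (\<integral>x. indicator ubox x *\<^sub>R jprof (g j) \<phi> (norm (x::'a)) \<partial>lborel)" for j
    unfolding mass_def
  proof (rule SUP_least)
    fix \<omega> :: "('a \<times> 'b) form" assume "\<omega> \<in> {\<omega> \<in> test_forms DIM('a). \<forall>x. comass_le_one DIM('a) (\<omega> x)}"
    then have \<omega>: "\<omega> \<in> test_forms DIM('a)" "\<And>x. comass_le_one DIM('a) (\<omega> x)" by auto
    have "S \<phi> j \<omega> \<le> (\<integral>x. indicator ubox x *\<^sub>R jprof (g j) \<phi> (norm (x::'a)) \<partial>lborel)"
      unfolding S_param[OF \<phi>(1) \<omega>(1)]
    proof (rule integral_mono_AE[OF set_integrable_ubox_continuous[OF continuous_on_form_ordered_basis[OF \<omega>(1) sm[OF \<phi>(1)]]] jint])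
      show "AE x in lborel. indicator ubox x *\<^sub>R \<omega> (\<Psi> \<phi> j x) (map (frechet_derivative (\<Psi> \<phi> j) (at x)) ordered_basis)
          \<le> indicator ubox x *\<^sub>R jprof (g j) \<phi> (norm x)"
        using AE_lborel_singleton[of "0::'a"]
      proof eventually_elim
        case (elim x)
        then show ?case
          using profile_map_form_le[OF g(1)[of j] \<phi>(1) elim test_formsD(1)[OF \<omega>(1), of "\<Psi> \<phi> j x"] \<omega>(2)[of "\<Psi> \<phi> j x"]]
          unfolding \<Psi>_def by (auto simp: indicator_def)
      qed
    qed
    then show "ereal (S \<phi> j \<omega>) \<le> ereal (\<integral>x. indicator ubox x *\<^sub>R jprof (g j) \<phi> (norm (x::'a)) \<partial>lborel)" by simp
  qed
  \<comment> \<open>With constant angle \<theta> the cubes converge weakly to the truncated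
    cone.\<close>
  have lim: "(\<lambda>j. S ?c j \<xi>) \<longlonglongrightarrow> truncated_cone (LO_cone_param f \<theta>) R \<xi>" if \<xi>: "\<xi> \<in> test_forms DIM('a)" for \<xi>
  proof -
    obtain C where C: "C > 0" "\<And>x. comass_le_one DIM('a) (\<lambda>vs. \<xi> x vs / C)" using test_form_bounded[OF \<xi>] by blast
    obtain B where B: "\<And>j r. r > 0 \<Longrightarrow> r \<noteq> R \<Longrightarrow> \<bar>jprof (g j) ?c r\<bar> \<le> B" using jb[OF smc] by auto
    let ?v = "\<lambda>j x. \<xi> (\<Psi> ?c j x) (map (frechet_derivative (\<Psi> ?c j) (at x)) ordered_basis)"
    let ?F = "LO_cone_param f \<theta>"
    let ?w = "\<lambda>x. \<xi> (?F x) (map (frechet_derivative ?F (at x)) ordered_basis)"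
    have v: "\<bar>?v j x\<bar> \<le> C * jprof (g j) ?c (norm x)" if "x \<noteq> 0" for j x
    proof -
      have "alternating_form DIM('a) (\<lambda>vs. (1 / C) * \<xi> (\<Psi> ?c j x) vs + 0 * \<xi> (\<Psi> ?c j x) vs)"
        by (rule alternating_form_combination) (rule test_formsD(1)[OF \<xi>])+
      then have "alternating_form DIM('a) (\<lambda>vs. \<xi> (\<Psi> ?c j x) vs / C)" by simp
      from profile_map_form_le[OF g(1)[of j] smc that this C(2)[of "\<Psi> ?c j x"]]
      have "\<bar>?v j x / C\<bar> \<le> jprof (g j) ?c (norm x)" unfolding \<Psi>_def .
      then show ?thesis using C(1) by (simp add: abs_divide field_simps)
    qed
    have T: "truncated_cone ?F R \<xi> = (\<integral>x. indicator (cball 0 R) x *\<^sub>R ?w x \<partial>lborel)"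
      unfolding truncated_cone_def param_current_def truncated_cone_domain set_lebesgue_integral_def ..
    have conv: "AE x in lborel. (\<lambda>j. indicator ubox x *\<^sub>R ?v j x) \<longlonglongrightarrow> indicator (cball 0 R) x *\<^sub>R ?w x"
      using AE_norm_neq[of R] AE_norm_neq[of 0]
    proof eventually_elim
      case (elim x)
      show ?case
      proof (cases "norm x < R")
        case True
        obtain N where N: "\<And>j. j \<ge> N \<Longrightarrow> \<exists>U. open U \<and> x \<in> U \<and> (\<forall>y\<in>U. \<Psi> ?c j y = ?F y)"
          using near[of x] True elim unfolding LO_cone_param_radial_map by auto
        have "?v j x = ?w x" if "j \<ge> N" for j
        proof -
          obtain U where U: "open U" "x \<in> U" "\<And>y. y \<in> U \<Longrightarrow> \<Psi> ?c j y = ?F y" using N[OF \<open>j \<ge> N\<close>] by blast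
          have "(\<Psi> ?c j) differentiable (at x)"
            using smooth_on_has_derivative[OF open_UNIV sm[OF smc] UNIV_I] by (rule differentiableI)
          from frechet_derivative_transform_within_open[OF this U(1,2), of ?F]
          have "frechet_derivative (\<Psi> ?c j) (at x) = frechet_derivative ?F (at x)" using U(3) by simp
          then show ?thesis using U(2,3) by simp
        qed
        moreover have "x \<in> ubox" "x \<in> cball 0 R" using sub True by auto
        ultimately show ?thesis by (intro tendsto_eventually) (auto simp: eventually_sequentially)
      next
        case False
        then have "?v j x = 0" for j using v[where x=x and j=j] j0[where r="norm x" and j=j, OF smc] elim by simp
        then show ?thesis using False elim by simp
      qed
    qed
    have meas: "(\<lambda>x. indicator ubox x *\<^sub>R ?v j x) \<in> borel_measurable lborel" for j
      using set_integrable_ubox_continuous[OF continuous_on_form_ordered_basis[OF \<xi> sm[OF smc]]] by simp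
    have bound: "AE x::'a in lborel. norm (indicator ubox x *\<^sub>R ?v j x) \<le> indicator ubox x *\<^sub>R (C * B)" for j
      using AE_norm_neq[of R] AE_norm_neq[of 0]
    proof eventually_elim
      case (elim x)
      then have "\<bar>?v j x\<bar> \<le> C * jprof (g j) ?c (norm x)" using v by simp
      also have "\<dots> \<le> C * B" using B[of "norm x" j] elim C(1) by (intro mult_left_mono) auto
      finally show ?case by (rule ind_bound)
    qed
    have measw: "(\<lambda>x. indicator (cball 0 R) x *\<^sub>R ?w x) \<in> borel_measurable lborel"
    proof -
      have "continuous_on (- {0}) ?w"
      proof -
        have o: "open (- {0::'a})" by auto
        have sF: "smooth_on (- {0}) ?F"
          unfolding LO_cone_param_radial_map
          by (rule smooth_on_radial_map[OF smooth_f]) (auto intro!: smooth_on_mult smooth_on_id smooth_on_const)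
        have "smooth_on (- {0}) (\<lambda>y. \<xi> (?F y) (map (\<lambda>i. frechet_derivative ?F (at y) (ordered_basis ! i)) [0..<DIM('a)]))"
          by (rule smooth_on_form[OF \<xi> o sF]) (rule smooth_on_frechet[OF sF])
        moreover have "map (\<lambda>i. frechet_derivative ?F (at y) (ordered_basis ! i)) [0..<DIM('a)]
            = map (frechet_derivative ?F (at y)) ordered_basis" for y
          by (rule nth_equalityI) (simp_all add: ordered_basis(3))
        ultimately show ?thesis using smooth_on_continuous by simp
      qed
      then have 1: "(\<lambda>x. indicator (- {0}) x *\<^sub>R ?w x) \<in> borel_measurable borel"
        by (intro borel_measurable_continuous_on_indicator) auto
      \<comment> \<open>The cone map need not be differentiable at the vertex, so
        \<open>?w 0\<close> is some unspecified number; it is put back on the singleton.\<close>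
      have "(\<lambda>x::'a. indicator {0} x *\<^sub>R ?w 0) \<in> borel_measurable borel"
        by (intro borel_measurable_scaleR borel_measurable_indicator) auto
      from borel_measurable_add[OF 1 this]
      have "(\<lambda>x. indicator (- {0}) x *\<^sub>R ?w x + indicator {0} x *\<^sub>R ?w 0) \<in> borel_measurable borel" .
      moreover have "(\<lambda>x. indicator (- {0}) x *\<^sub>R ?w x + indicator {0} x *\<^sub>R ?w 0) = ?w"
        by (auto simp: indicator_def fun_eq_iff)
      ultimately have "?w \<in> borel_measurable borel" by simp
      then show ?thesis by (intro borel_measurable_scaleR borel_measurable_indicator) auto
    qed
    show ?thesis unfolding S_param[OF smc \<xi>] T
      by (rule integral_dominated_convergence[OF measw meas ub conv bound])
  qed
  \<comment> \<open>Along the approximation of the cone the boundary values form a constant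
    sequence, shared with the competitor; the constant therefore equals the limit.\<close>
  have bd_eq: "boundary (S \<phi> j) \<omega> = boundary (truncated_cone (LO_cone_param f \<theta>) R) \<omega>"
    if \<omega>: "\<omega> \<in> test_forms n" for j \<omega>
  proof -
    have "ext_deriv \<omega> \<in> test_forms DIM('a)" using ext_deriv_test_form[OF \<omega>] dim by simp
    from lim[OF this] have "(\<lambda>i. boundary (S ?c i) \<omega>) \<longlonglongrightarrow> boundary (truncated_cone (LO_cone_param f \<theta>) R) \<omega>"
      unfolding boundary_def .
    moreover have "boundary (S ?c i) \<omega> = boundary (S \<phi> j) \<omega>" for i
      using bd[where \<psi>=\<phi> and j=j and i=i, OF \<phi>(1,2) \<omega>] by simp
    ultimately show ?thesis using LIMSEQ_unique[OF tendsto_const] by simp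
  qed
  from order_tendstoD(2)[OF area less] obtain j where
    "(\<integral>x. indicator ubox x *\<^sub>R jprof (g j) \<phi> (norm (x::'a)) \<partial>lborel) < c"
    by (auto simp: eventually_sequentially)
  then have "mass DIM('a) (S \<phi> j) \<le> ereal c"
    using mass_le[of j] by (meson ereal_less_eq(3) less_imp_le order_trans)
  moreover have "integral_current DIM('a) (S \<phi> j)"
    unfolding S_def by (rule integral_current_cube[OF dim sm[OF \<phi>(1)]])
  moreover have "eq_current n (boundary (S \<phi> j)) (boundary (truncated_cone (LO_cone_param f \<theta>) R))"
    unfolding eq_current_def using bd_eq by blast
  ultimately show ?thesis using that by blast
qed

end

section \<open>Instability of the cone\<close>

text \<open>Integration in polar coordinates for radial functions: both measures give the half-line
  up to a the volume of the ball of radius a, and such half-lines form a generating family closed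
  under intersection.\<close>

lemma distr_norm_lborel:
  "distr (lborel :: 'a::euclidean_space measure) borel norm = density lborel
     (\<lambda>r. ennreal (unit_ball_vol DIM('a) * (real DIM('a) * r ^ (DIM('a) - 1)) * indicator {0<..} r))"
  (is "?M = density lborel (\<lambda>r. ennreal (?f r))")
proof -
  let ?d = "DIM('a)"
  have fm: "?f \<in> borel_measurable borel" by measurable
  have E1: "emeasure ?M {..a} = ennreal (if a < 0 then 0 else unit_ball_vol ?d * a ^ ?d)" for a
  proof -
    have "emeasure ?M {..a} = emeasure lborel (norm -` {..a} :: 'a set)"
      by (subst emeasure_distr) auto
    also have "(norm -` {..a} :: 'a set) = (if a < 0 then {} else cball 0 a)"
      by (auto dest: order_trans[OF norm_ge_zero])
    finally show ?thesis using emeasure_cball[of a "0::'a"] by simp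
  qed
  have E2: "emeasure (density lborel (\<lambda>r. ennreal (?f r))) {..a} = ennreal (if a < 0 then 0 else unit_ball_vol ?d * a ^ ?d)" for a
  proof -
    have "emeasure (density lborel (\<lambda>r. ennreal (?f r))) {..a} = (\<integral>\<^sup>+r. ennreal (?f r) * indicator {..a} r \<partial>lborel)"
      by (rule emeasure_density) (use fm in auto)
    also have "\<dots> = ennreal (if a < 0 then 0 else unit_ball_vol ?d * a ^ ?d)"
    proof (cases "a < 0")
      case True
      then have z: "ennreal (?f r) * indicator {..a} r = 0" for r by (auto simp: indicator_def)
      show ?thesis unfolding z using True by simp
    next
      case False
      have "(\<integral>\<^sup>+r. ennreal (?f r) * indicator {..a} r \<partial>lborel)
          = (\<integral>\<^sup>+r. ennreal (unit_ball_vol ?d * (real ?d * r ^ (?d - 1))) * indicator {0..a} r \<partial>lborel)"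
        by (rule nn_integral_cong_AE, use AE_lborel_singleton[of "0::real"] in eventually_elim)
          (auto simp: indicator_def)
      also have "\<dots> = ennreal (unit_ball_vol ?d * a ^ ?d - unit_ball_vol ?d * 0 ^ ?d)"
      proof (rule nn_integral_FTC_Icc)
        show "((\<lambda>r. unit_ball_vol ?d * r ^ ?d) has_real_derivative unit_ball_vol ?d * (real ?d * x ^ (?d - 1))) (at x)" for x
          by (auto intro!: derivative_eq_intros)
      qed (use False in auto)
      finally show ?thesis using False by simp
    qed
    finally show ?thesis .
  qed
  show ?thesis
  proof (rule measure_eqI_generator_eq[where E="range (\<lambda>a::real. {..a})" and \<Omega>=UNIV and A="\<lambda>i. {..real i}"])
    show "Int_stable (range (\<lambda>a::real. {..a}))" by (auto simp: Int_stable_def Int_atMost)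
    have s: "sets (borel::real measure) = sigma_sets UNIV (range (\<lambda>a. {..a}))"
      by (subst borel_eq_atMost) simp
    then show "sets ?M = sigma_sets UNIV (range (\<lambda>a. {..a}))"
      "sets (density lborel (\<lambda>r. ennreal (?f r))) = sigma_sets UNIV (range (\<lambda>a. {..a}))" by simp_all
    show "emeasure ?M X = emeasure (density lborel (\<lambda>r. ennreal (?f r))) X" if "X \<in> range (\<lambda>a. {..a})" for X
      using that E1 E2 by auto
    show "(\<Union>i. {..real i}) = UNIV" using real_arch_simple by auto
    show "emeasure ?M {..real i} \<noteq> \<infinity>" for i unfolding E1 by simp
  qed auto
qed

lemma radial_integral:
  fixes G :: "real \<Rightarrow> real"
  assumes [measurable]: "G \<in> borel_measurable borel" and a: "0 < a" and z: "\<And>r. r < a \<or> r > b \<Longrightarrow> G r = 0"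
  shows "(\<integral>x. G (norm (x::'a::euclidean_space)) \<partial>lborel)
    = unit_ball_vol DIM('a) * real DIM('a) * (\<integral>r. r ^ (DIM('a) - 1) * G r * indicator {a..b} r \<partial>lborel)"
proof -
  let ?f = "\<lambda>r. unit_ball_vol DIM('a) * (real DIM('a) * r ^ (DIM('a) - 1)) * indicator {0<..} r"
  have "(\<integral>x. G (norm (x::'a)) \<partial>lborel) = (\<integral>r. G r \<partial>distr (lborel :: 'a measure) borel norm)"
    by (rule integral_distr[symmetric]) auto
  also have "\<dots> = (\<integral>r. ?f r *\<^sub>R G r \<partial>lborel)"
    unfolding distr_norm_lborel by (rule integral_density) (auto simp: indicator_def)
  also have "\<dots> = (\<integral>r. (unit_ball_vol DIM('a) * real DIM('a)) * (r ^ (DIM('a) - 1) * G r * indicator {a..b} r) \<partial>lborel)"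
    by (rule Bochner_Integration.integral_cong[OF refl]) (use a z in \<open>auto simp: indicator_def not_le\<close>)
  finally show ?thesis by simp
qed

lemma integral_inverse_Icc:
  fixes a b :: real
  assumes "0 < a" "a \<le> b"
  shows "integrable lborel (\<lambda>r. 1 / r * indicator {a..b} r)" "(\<integral>r. 1 / r * indicator {a..b} r \<partial>lborel) = ln b - ln a"
proof -
  have "has_bochner_integral lborel (\<lambda>r. 1 / r * indicator {a..b} r) (ln b - ln a)"
    by (rule has_bochner_integral_FTC_Icc_real[where F=ln and f="\<lambda>r. 1 / r"])
      (use assms in \<open>auto intro!: derivative_eq_intros continuous_intros\<close>)
  then show "integrable lborel (\<lambda>r. 1 / r * indicator {a..b} r)" "(\<integral>r. 1 / r * indicator {a..b} r \<partial>lborel) = ln b - ln a"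
    by (auto simp: has_bochner_integral_iff)
qed

text \<open>Near-optimal test functions \<open>r\<^sup>-\<^sup>c v (ln r)\<close> for Hardy's inequality with sharp constant \<open>c\<^sup>2\<close>,
  where \<open>v\<close> has a long plateau.\<close>

lemma hardy_test_function:
  fixes R M V :: real
  assumes R: "R > 0" and V: "V > 0" and c: "c \<ge> 1" and M: "M + (real c)\<^sup>2 * V < 0"
  obtains u :: "real \<Rightarrow> real" and a where "smooth_on UNIV u" "0 < a" "a < R" "\<And>r. r \<le> a \<Longrightarrow> u r = 0" "\<And>r. r \<ge> R \<Longrightarrow> u r = 0"
    "(\<integral>r. r ^ (2 * c - 1) * u r * indicator {a..R} r \<partial>lborel) > 0"
    "(\<integral>r. r ^ (2 * c - 1) * (M * (u r)\<^sup>2 + V * (r * deriv u r)\<^sup>2) * indicator {a..R} r \<partial>lborel) < 0"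
proof -
  obtain h :: "real \<Rightarrow> real" where h: "smooth_on UNIV h" "\<And>t. t \<le> 0 \<Longrightarrow> h t = 0"
    "\<And>t. t \<ge> 1 \<Longrightarrow> h t = 1" "\<And>t. 0 \<le> h t" "\<And>t. h t \<le> 1"
    using smooth_step_exists by blast
  obtain N where N: "N \<ge> 0" "\<And>t. \<bar>deriv h t\<bar> \<le> N" "\<And>t. deriv h t \<noteq> 0 \<Longrightarrow> 0 \<le> t \<and> t \<le> 1"
    using bounded_deriv_of_compact_variation[OF h(1-3)] by blast
  define \<gamma> where "\<gamma> = - (M + (real c)\<^sup>2 * V)"
  have \<gamma>: "\<gamma> > 0" using M by (simp add: \<gamma>_def)
  \<comment> \<open>The plateau is chosen so long that its gain \<gamma> L exceeds the cost V * 8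
    N^2 of the two transitions.\<close>
  define L where "L = 8 * V * N\<^sup>2 / \<gamma> + 1"
  have "8 * V * N\<^sup>2 / \<gamma> \<ge> 0" using \<gamma> V by simp
  moreover have "\<gamma> * L = 8 * V * N\<^sup>2 + \<gamma>" using \<gamma> by (simp add: L_def distrib_left)
  ultimately have L: "L > 0" "\<gamma> * L > 8 * V * N\<^sup>2" using \<gamma> by (auto simp: L_def)
  define D where "D = ln R"
  \<comment> \<open>On the logarithmic scale: a transition of length 1 after A, the plateau of
    length L, and a transition of length 1 before D.\<close>
  define A where "A = D - L - 2"
  define a where "a = exp A"
  have eD: "exp D = R" using R by (simp add: D_def)
  have a: "0 < a" "a < R" using L(1) by (auto simp: a_def A_def simp flip: eD)
  define v where "v y = h (y - A) * h (D - y)" for y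
  have sv: "smooth_on UNIV v"
    unfolding v_def[abs_def]
    by (rule smooth_on_mult[OF open_UNIV smooth_on_compose[OF open_UNIV open_UNIV UNIV_I h(1)]
          smooth_on_compose[OF open_UNIV open_UNIV UNIV_I h(1)]])
      (intro smooth_on_diff smooth_on_const smooth_on_id open_UNIV)+
  have v0: "v y = 0" if "y \<le> A \<or> y \<ge> D" for y using that h(2) by (auto simp: v_def)
  have v1: "v y = 1" if "A + 1 \<le> y" "y \<le> D - 1" for y using that h(3) by (simp add: v_def)
  have vnn: "0 \<le> v y" for y using h(4) by (simp add: v_def)
  note dv = smooth_real_derivative(1)[OF sv]
  have dv_eq: "deriv v y = deriv h (y - A) * h (D - y) - h (y - A) * deriv h (D - y)" for y
  proof (rule DERIV_imp_deriv)
    have "((\<lambda>y. h (y - A)) has_real_derivative deriv h (y - A) * 1) (at y)"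
      by (rule DERIV_chain'[OF _ smooth_real_derivative(1)[OF h(1)]]) (auto intro!: derivative_eq_intros)
    moreover have "((\<lambda>y. h (D - y)) has_real_derivative deriv h (D - y) * (-1)) (at y)"
      by (rule DERIV_chain'[OF _ smooth_real_derivative(1)[OF h(1)]]) (auto intro!: derivative_eq_intros)
    ultimately show "(v has_real_derivative deriv h (y - A) * h (D - y) - h (y - A) * deriv h (D - y)) (at y)"
      unfolding v_def[abs_def] by (rule DERIV_cong[OF DERIV_mult]) simp
  qed
  have dv_le: "(deriv v y)\<^sup>2 \<le> 4 * N\<^sup>2" for y
  proof -
    have "\<bar>deriv h (y - A) * h (D - y)\<bar> \<le> N * 1" "\<bar>h (y - A) * deriv h (D - y)\<bar> \<le> 1 * N"
      unfolding abs_mult using N h(4,5) by (intro mult_mono; simp)+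
    then have "\<bar>deriv v y\<bar> \<le> 2 * N" unfolding dv_eq by linarith
    then have "\<bar>deriv v y\<bar>\<^sup>2 \<le> (2 * N)\<^sup>2" by (intro power_mono) auto
    then show ?thesis by (simp add: power_mult_distrib)
  qed
  have dv_supp: "deriv v y = 0" if "\<not> (A \<le> y \<and> y \<le> A + 1)" "\<not> (D - 1 \<le> y \<and> y \<le> D)" for y
  proof -
    have "deriv h (y - A) = 0" using N(3)[of "y - A"] that(1) by fastforce
    moreover have "deriv h (D - y) = 0" using N(3)[of "D - y"] that(2) by fastforce
    ultimately show ?thesis by (simp add: dv_eq)
  qed
  \<comment> \<open>With y = ln r the measure r^(2c-1) u^2 dr becomes v^2 dy, and r u' corresponds
    to v' - c v. Expanding the square moves c^2 V to M and leaves a cross term and V (v')^2.\<close>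
  define u where "u r = (if r \<le> 0 then 0 else inverse r ^ c * v (ln r))" for r
  have u0: "u r = 0" if "r \<le> a \<or> r \<ge> R" for r
  proof (cases "r \<le> 0")
    case False
    have "ln r \<le> A \<or> ln r \<ge> D"
    proof (cases "r \<le> a")
      case True
      then have "ln r \<le> ln a" using False by simp
      then show ?thesis by (simp add: a_def)
    next
      case F: False
      then have "ln R \<le> ln r" using that R by simp
      then show ?thesis by (simp add: D_def)
    qed
    then show ?thesis using v0 False by (simp add: u_def)
  qed (simp add: u_def)
  have su: "smooth_on UNIV u"
  proof -
    have o: "open ({0<..} :: real set)" by simp
    have "smooth_on {0<..} (\<lambda>r::real. inverse r)" by (rule smooth_on_subset[OF smooth_on_inverse]) auto
    then have "smooth_on {0<..} (\<lambda>r::real. inverse r ^ c)" by (rule smooth_on_power[OF o])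
    moreover have "smooth_on {0<..} (\<lambda>r. v (ln r))" by (rule smooth_on_compose[OF o open_UNIV UNIV_I sv smooth_on_ln])
    ultimately have "smooth_on {0<..} (\<lambda>r. inverse r ^ c * v (ln r))" by (rule smooth_on_mult[OF o])
    then have 1: "smooth_on {0<..} u" by (rule smooth_on_cong[OF o, rotated]) (simp add: u_def)
    have 2: "smooth_on {..<a} u"
      by (rule smooth_on_cong[OF _ _ smooth_on_const[of _ 0]]) (auto simp: u0)
    have "{0<..} \<union> {..<a} = (UNIV::real set)" using a by auto
    then show ?thesis using smooth_on_glue[OF _ _ 1 2] by simp
  qed
  have du: "deriv u r = inverse r ^ (c + 1) * (deriv v (ln r) - real c * v (ln r))" if r: "r > 0" for r
  proof (rule DERIV_imp_deriv)
    have i: "(inverse has_real_derivative - (inverse r ^ 2)) (at r)"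
      using DERIV_inverse[of r] r by (simp add: numeral_2_eq_2)
    obtain k where k: "c = Suc k" using c by (cases c) auto
    have p: "((\<lambda>r. inverse r ^ c) has_real_derivative - (real c * inverse r ^ (c + 1))) (at r)"
      unfolding k by (rule DERIV_cong[OF DERIV_power_Suc[OF i]]) (simp add: power2_eq_square algebra_simps)
    have l: "(ln has_real_derivative inverse r) (at r)" using r by (auto intro!: derivative_eq_intros simp: divide_inverse)
    have q: "((\<lambda>r. v (ln r)) has_real_derivative deriv v (ln r) * inverse r) (at r)"
      by (rule DERIV_chain2[OF dv l])
    have "((\<lambda>r. inverse r ^ c * v (ln r)) has_real_derivative inverse r ^ (c + 1) * (deriv v (ln r) - real c * v (ln r))) (at r)"
      by (rule DERIV_cong[OF DERIV_mult[OF p q]]) (simp add: algebra_simps)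
    then show "(u has_real_derivative inverse r ^ (c + 1) * (deriv v (ln r) - real c * v (ln r))) (at r)"
      by (rule has_field_derivative_transform_within_open[of _ _ _ "{0<..}"]) (use r in \<open>auto simp: u_def\<close>)
  qed
  have c2: "2 * c = Suc (2 * c - 1)" using c by simp
  have pw: "r ^ (2 * c - 1) * (inverse r ^ c)\<^sup>2 = 1 / r" if "r > 0" for r :: real
  proof -
    have "(inverse r ^ c)\<^sup>2 = inverse r ^ (2 * c)" by (simp add: power_mult[symmetric] mult.commute)
    also have "\<dots> = inverse r * inverse r ^ (2 * c - 1)" by (subst c2) simp
    finally show ?thesis using that by (simp add: power_inverse divide_inverse)
  qed
  have e1: "r ^ (2 * c - 1) * (u r)\<^sup>2 = 1 / r * (v (ln r))\<^sup>2" if "r > 0" for r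
    using pw[OF that] that by (simp add: u_def power_mult_distrib mult.assoc[symmetric])
  have e2: "r ^ (2 * c - 1) * (r * deriv u r)\<^sup>2 = 1 / r * (deriv v (ln r) - real c * v (ln r))\<^sup>2" if "r > 0" for r
  proof -
    have "r * deriv u r = inverse r ^ c * (deriv v (ln r) - real c * v (ln r))" using that by (simp add: du)
    then show ?thesis using pw[OF that] by (simp add: power_mult_distrib mult.assoc[symmetric])
  qed
  have contv: "continuous_on {a..R} (\<lambda>r. v (ln r))" "continuous_on {a..R} (\<lambda>r. deriv v (ln r))"
    using a by (auto intro!: continuous_on_compose2[OF smooth_on_continuous[OF sv]]
        continuous_on_compose2[OF smooth_real_derivative(2)[OF sv]] continuous_intros)
  have int: "integrable lborel (\<lambda>r. f r * indicator {a..R} r)" if "continuous_on {a..R} f" for f :: "real \<Rightarrow> real"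
    using borel_integrable_atLeastAtMost'[OF that] by (simp add: set_integrable_def mult.commute)
  have inv: "continuous_on {a..R} (\<lambda>r::real. 1 / r)" using a by (auto intro!: continuous_intros)
  define S1 where "S1 = (\<integral>r. 1 / r * (v (ln r))\<^sup>2 * indicator {a..R} r \<partial>lborel)"
  define S2 where "S2 = (\<integral>r. 1 / r * (deriv v (ln r))\<^sup>2 * indicator {a..R} r \<partial>lborel)"
  have i1: "integrable lborel (\<lambda>r. 1 / r * (v (ln r))\<^sup>2 * indicator {a..R} r)"
    and i2: "integrable lborel (\<lambda>r. 1 / r * (deriv v (ln r))\<^sup>2 * indicator {a..R} r)"
    and i3: "integrable lborel (\<lambda>r. (2 * v (ln r) * (deriv v (ln r) * (1 / r))) * indicator {a..R} r)"
    by (intro int continuous_intros contv inv)+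
  \<comment> \<open>The cross term is the derivative of v^2, which vanishes at both ends.\<close>
  have S3: "(\<integral>r. (2 * v (ln r) * (deriv v (ln r) * (1 / r))) * indicator {a..R} r \<partial>lborel) = 0"
  proof -
    have "has_bochner_integral lborel (\<lambda>r. (2 * v (ln r) * (deriv v (ln r) * (1 / r))) * indicator {a..R} r)
        ((v (ln R))\<^sup>2 - (v (ln a))\<^sup>2)"
    proof (rule has_bochner_integral_FTC_Icc_real[where F="\<lambda>r. (v (ln r))\<^sup>2" and f="\<lambda>r. 2 * v (ln r) * (deriv v (ln r) * (1 / r))"])
      fix r assume r: "a \<le> r" "r \<le> R"
      have l: "(ln has_real_derivative 1 / r) (at r)" using r a by (auto intro!: derivative_eq_intros)
      show "((\<lambda>r. (v (ln r))\<^sup>2) has_real_derivative 2 * v (ln r) * (deriv v (ln r) * (1 / r))) (at r)"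
        by (rule DERIV_cong[OF DERIV_power[OF DERIV_chain2[OF dv l], of 2]]) simp
      have lc: "isCont ln r" using r a by (intro isCont_ln) auto
      have c1: "isCont v (ln r)" "isCont (deriv v) (ln r)"
        using smooth_on_continuous[OF sv] smooth_real_derivative(2)[OF sv] by (auto simp: continuous_on_eq_continuous_at)
      show "isCont (\<lambda>r. 2 * v (ln r) * (deriv v (ln r) * (1 / r))) r"
        using isCont_o2[OF lc c1(1)] isCont_o2[OF lc c1(2)] r a by (intro continuous_intros) auto
    qed (use a in auto)
    then show ?thesis using v0[of D] v0[of A] by (simp add: has_bochner_integral_iff D_def a_def)
  qed
  have S1: "S1 \<ge> L"
  proof -
    let ?p = "exp (A + 1)" and ?q = "exp (D - 1)"
    have pq: "0 < ?p" "?p \<le> ?q" using L(1) by (auto simp: A_def)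
    have "L = (\<integral>r. 1 / r * indicator {?p..?q} r \<partial>lborel)"
      using integral_inverse_Icc(2)[OF pq] by (simp add: A_def)
    also have "\<dots> \<le> S1" unfolding S1_def
    proof (rule integral_mono[OF integral_inverse_Icc(1)[OF pq] i1])
      fix r :: real
      show "1 / r * indicator {?p..?q} r \<le> 1 / r * (v (ln r))\<^sup>2 * indicator {a..R} r"
      proof (cases "r \<in> {?p..?q}")
        case True
        have r: "r > 0" using True less_le_trans[OF exp_gt_zero, of "A + 1" r] by simp
        have "A + 1 \<le> ln r" "ln r \<le> D - 1"
          using True ln_ge_iff[OF r, of "A + 1"] ln_le_cancel_iff[OF r exp_gt_zero, of "D - 1"] by simp_all
        then have "v (ln r) = 1" by (rule v1)
        moreover have "a \<le> r" "r \<le> R" using True order_trans[of a ?p r] order_trans[of r ?q R]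
          by (auto simp: a_def simp flip: eD)
        ultimately show ?thesis using True by simp
      next
        case False
        have "0 \<le> 1 / r * (v (ln r))\<^sup>2 * indicator {a..R} r" using a(1) by (auto simp: indicator_def)
        then show ?thesis using False by simp
      qed
    qed
    finally show ?thesis .
  qed
  \<comment> \<open>The square of v' is at most 4 N^2 and lives on two intervals of logarithmic
    length 1.\<close>
  have S2: "S2 \<le> 8 * N\<^sup>2"
  proof -
    let ?p = "exp (A + 1)" and ?q = "exp (D - 1)"
    have p: "a \<le> ?p" "?q \<le> R" "0 < ?q" by (auto simp: a_def simp flip: eD)
    note I = integral_inverse_Icc[OF a(1) p(1)] integral_inverse_Icc[OF p(3,2)]
    have "S2 \<le> (\<integral>r. 4 * N\<^sup>2 * (1 / r * indicator {a..?p} r) + 4 * N\<^sup>2 * (1 / r * indicator {?q..R} r) \<partial>lborel)"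
      unfolding S2_def
    proof (rule integral_mono[OF i2])
      show "integrable lborel (\<lambda>r. 4 * N\<^sup>2 * (1 / r * indicator {a..?p} r) + 4 * N\<^sup>2 * (1 / r * indicator {?q..R} r))"
        by (intro Bochner_Integration.integrable_add integrable_mult_right I)
      fix r :: real
      show "1 / r * (deriv v (ln r))\<^sup>2 * indicator {a..R} r
          \<le> 4 * N\<^sup>2 * (1 / r * indicator {a..?p} r) + 4 * N\<^sup>2 * (1 / r * indicator {?q..R} r)"
      proof (cases "r \<in> {a..R}")
        case True
        then have r: "r > 0" using a(1) by auto
        have b: "1 / r * (deriv v (ln r))\<^sup>2 \<le> 4 * N\<^sup>2 * (1 / r)"
          using dv_le[of "ln r"] r by (simp add: divide_right_mono)
        have nn: "0 \<le> 4 * N\<^sup>2 * (1 / r * indicator {a..?p} r)" "0 \<le> 4 * N\<^sup>2 * (1 / r * indicator {?q..R} r)"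
          using r by auto
        show ?thesis
        proof (cases "r \<le> ?p \<or> r \<ge> ?q")
          case T: True
          then show ?thesis
          proof
            assume "r \<le> ?p"
            then show ?thesis using True b nn(2) by simp
          next
            assume "?q \<le> r"
            then show ?thesis using True b nn(1) by simp
          qed
        next
          case False
          then have "A + 1 < ln r" "ln r < D - 1" using r by (metis exp_less_cancel_iff exp_ln not_le)+
          then have "deriv v (ln r) = 0" by (intro dv_supp) auto
          then show ?thesis using nn by simp
        qed
      next
        case False
        have n1: "0 \<le> 1 / r * indicator {a..?p} r" using a(1) by (auto simp: indicator_def)
        have n2: "0 \<le> 1 / r * indicator {?q..R} r"
          using less_le_trans[OF p(3), of r] by (auto simp: indicator_def)
        have "0 \<le> 4 * N\<^sup>2 * (1 / r * indicator {a..?p} r) + 4 * N\<^sup>2 * (1 / r * indicator {?q..R} r)"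
          by (intro add_nonneg_nonneg mult_nonneg_nonneg[OF _ n1] mult_nonneg_nonneg[OF _ n2]) auto
        then show ?thesis using False by simp
      qed
    qed
    also have "\<dots> = (\<integral>r. 4 * N\<^sup>2 * (1 / r * indicator {a..?p} r) \<partial>lborel)
        + (\<integral>r. 4 * N\<^sup>2 * (1 / r * indicator {?q..R} r) \<partial>lborel)"
      by (rule Bochner_Integration.integral_add[OF integrable_mult_right[OF I(1)] integrable_mult_right[OF I(3)]])
    also have "\<dots> = 4 * N\<^sup>2 * (ln ?p - ln a) + 4 * N\<^sup>2 * (ln R - ln ?q)"
      by (simp only: integral_mult_right_zero I(2,4))
    also have "\<dots> = 8 * N\<^sup>2" by (simp add: a_def D_def[symmetric])
    finally show ?thesis .
  qed
  have "(\<integral>r. r ^ (2 * c - 1) * (M * (u r)\<^sup>2 + V * (r * deriv u r)\<^sup>2) * indicator {a..R} r \<partial>lborel)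
      = (\<integral>r. (M + (real c)\<^sup>2 * V) * (1 / r * (v (ln r))\<^sup>2 * indicator {a..R} r)
          + V * (1 / r * (deriv v (ln r))\<^sup>2 * indicator {a..R} r)
          - real c * V * ((2 * v (ln r) * (deriv v (ln r) * (1 / r))) * indicator {a..R} r) \<partial>lborel)"
  proof (rule Bochner_Integration.integral_cong[OF refl])
    fix r :: real
    have alg: "M * (w * x\<^sup>2) + V * (w * (y - k * x)\<^sup>2) = (M + k\<^sup>2 * V) * (w * x\<^sup>2) + V * (w * y\<^sup>2) - k * V * (2 * x * (y * w))"
      for w x y k :: real by (simp add: power2_eq_square algebra_simps)
    show "r ^ (2 * c - 1) * (M * (u r)\<^sup>2 + V * (r * deriv u r)\<^sup>2) * indicator {a..R} r
        = (M + (real c)\<^sup>2 * V) * (1 / r * (v (ln r))\<^sup>2 * indicator {a..R} r)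
          + V * (1 / r * (deriv v (ln r))\<^sup>2 * indicator {a..R} r)
          - real c * V * ((2 * v (ln r) * (deriv v (ln r) * (1 / r))) * indicator {a..R} r)"
    proof (cases "r \<in> {a..R}")
      case True
      then have r: "r > 0" using a(1) by auto
      have "r ^ (2 * c - 1) * (M * (u r)\<^sup>2 + V * (r * deriv u r)\<^sup>2)
          = M * (r ^ (2 * c - 1) * (u r)\<^sup>2) + V * (r ^ (2 * c - 1) * (r * deriv u r)\<^sup>2)"
        by (simp add: algebra_simps)
      also have "\<dots> = M * (1 / r * (v (ln r))\<^sup>2) + V * (1 / r * (deriv v (ln r) - real c * v (ln r))\<^sup>2)"
        by (simp only: e1[OF r] e2[OF r])
      also have "\<dots> = (M + (real c)\<^sup>2 * V) * (1 / r * (v (ln r))\<^sup>2) + V * (1 / r * (deriv v (ln r))\<^sup>2)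
          - real c * V * (2 * v (ln r) * (deriv v (ln r) * (1 / r)))"
        by (rule alg)
      finally show ?thesis using True by simp
    qed simp
  qed
  also have "\<dots> = (M + (real c)\<^sup>2 * V) * S1 + V * S2"
    by (subst Bochner_Integration.integral_diff[OF Bochner_Integration.integrable_add[OF
            integrable_mult_right[OF i1] integrable_mult_right[OF i2]] integrable_mult_right[OF i3]],
        subst Bochner_Integration.integral_add[OF integrable_mult_right[OF i1] integrable_mult_right[OF i2]])
      (simp only: integral_mult_right_zero S3 S1_def S2_def mult_zero_right diff_zero)
  also have "\<dots> \<le> - \<gamma> * L + V * (8 * N\<^sup>2)"
  proof (rule add_mono)
    have "(M + (real c)\<^sup>2 * V) * S1 \<le> (M + (real c)\<^sup>2 * V) * L"
      by (rule mult_left_mono_neg[OF S1]) (use M in simp)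
    then show "(M + (real c)\<^sup>2 * V) * S1 \<le> - \<gamma> * L" by (simp only: \<gamma>_def minus_minus)
    show "V * S2 \<le> V * (8 * N\<^sup>2)" by (rule mult_left_mono[OF S2]) (use V in simp)
  qed
  also have "\<dots> < 0"
  proof -
    have "8 * V * N\<^sup>2 = V * (8 * N\<^sup>2)" by simp
    then show ?thesis using L(2) by linarith
  qed
  finally have neg: "(\<integral>r. r ^ (2 * c - 1) * (M * (u r)\<^sup>2 + V * (r * deriv u r)\<^sup>2) * indicator {a..R} r \<partial>lborel) < 0" .
  \<comment> \<open>This integral multiplies W'(\<theta>) in the first variation, so at a
    noncritical angle the same test function already works to first order.\<close>
  have pos: "(\<integral>r. r ^ (2 * c - 1) * u r * indicator {a..R} r \<partial>lborel) > 0"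
  proof -
    let ?p = "exp (A + 1)" and ?q = "exp (D - 1)"
    have pq: "0 < ?p" "?p < ?q" using L(1) by (auto simp: A_def)
    have iu: "integrable lborel (\<lambda>r. r ^ (2 * c - 1) * u r * indicator {a..R} r)"
      by (intro int continuous_intros continuous_on_subset[OF smooth_on_continuous[OF su]]) auto
    have "0 < ?p ^ (c - 1) * (?q - ?p)" using pq by simp
    also have "\<dots> = (\<integral>r. ?p ^ (c - 1) * indicator {?p..?q} r \<partial>lborel)" using pq by simp
    also have "\<dots> \<le> (\<integral>r. r ^ (2 * c - 1) * u r * indicator {a..R} r \<partial>lborel)"
    proof (rule integral_mono[OF _ iu])
      show "integrable lborel (\<lambda>r. ?p ^ (c - 1) * indicator {?p..?q} r)" using pq by simp
      fix r :: real
      show "?p ^ (c - 1) * indicator {?p..?q} r \<le> r ^ (2 * c - 1) * u r * indicator {a..R} r"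
      proof (cases "r \<in> {?p..?q}")
        case True
        have r: "r > 0" using True less_le_trans[OF exp_gt_zero, of "A + 1" r] by simp
        have "A + 1 \<le> ln r" "ln r \<le> D - 1"
          using True ln_ge_iff[OF r, of "A + 1"] ln_le_cancel_iff[OF r exp_gt_zero, of "D - 1"] by simp_all
        then have "v (ln r) = 1" by (rule v1)
        moreover have "2 * c - 1 = (c - 1) + c" using c by simp
        ultimately have "r ^ (2 * c - 1) * u r = r ^ (c - 1)"
          using r by (simp add: u_def power_add power_inverse)
        moreover have "?p ^ (c - 1) \<le> r ^ (c - 1)" using True by (intro power_mono) auto
        moreover have "a \<le> r" "r \<le> R" using True order_trans[of a ?p r] order_trans[of r ?q R]
          by (auto simp: a_def simp flip: eD)
        ultimately show ?thesis using True by simp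
      next
        case False
        have "0 \<le> r ^ (2 * c - 1) * u r * indicator {a..R} r"
          using a(1) vnn by (auto simp: indicator_def u_def)
        then show ?thesis using False by simp
      qed
    qed
    finally show ?thesis .
  qed
  show ?thesis by (rule that[OF su a _ _ pos neg]) (use u0 in auto)
qed

text \<open>Taylor's formula with Lagrange remainder; the gap between V2(\<theta>) and M absorbs the
  variation of the second derivative near \<theta>.\<close>

lemma second_order_upper_bound:
  fixes V V1 V2 :: "real \<Rightarrow> real"
  assumes "\<And>t. (V has_real_derivative V1 t) (at t)" "\<And>t. (V1 has_real_derivative V2 t) (at t)"
    and "isCont V2 \<theta>" "V2 \<theta> < M"
  obtains d where "d > 0" "\<And>\<delta>. \<bar>\<delta>\<bar> \<le> d \<Longrightarrow> V (\<theta> + \<delta>) \<le> V \<theta> + V1 \<theta> * \<delta> + M / 2 * \<delta>\<^sup>2"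
proof -
  obtain d where d: "d > 0" "\<And>t. dist t \<theta> < d \<Longrightarrow> dist (V2 t) (V2 \<theta>) < M - V2 \<theta>"
    using assms(3,4) unfolding continuous_at_eps_delta by (metis diff_gt_0_iff_gt)
  have "V (\<theta> + \<delta>) \<le> V \<theta> + V1 \<theta> * \<delta> + M / 2 * \<delta>\<^sup>2" if \<delta>: "\<bar>\<delta>\<bar> \<le> d / 2" for \<delta>
  proof (cases "\<delta> = 0")
    case False
    define F where "F m = (if m = 0 then V else if m = 1 then V1 else V2)" for m :: nat
    have "\<exists>t. (if \<theta> + \<delta> < \<theta> then \<theta> + \<delta> < t \<and> t < \<theta> else \<theta> < t \<and> t < \<theta> + \<delta>) \<and>
      V (\<theta> + \<delta>) = (\<Sum>m<2. (F m \<theta> / fact m) * (\<theta> + \<delta> - \<theta>) ^ m) + (F 2 t / fact 2) * (\<theta> + \<delta> - \<theta>) ^ 2"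
      by (rule Taylor[where a="\<theta> - \<bar>\<delta>\<bar>" and b="\<theta> + \<bar>\<delta>\<bar>"])
        (use False assms(1,2) in \<open>auto simp: F_def less_2_cases_iff\<close>)
    then obtain t where tt: "if \<theta> + \<delta> < \<theta> then \<theta> + \<delta> < t \<and> t < \<theta> else \<theta> < t \<and> t < \<theta> + \<delta>"
      "V (\<theta> + \<delta>) = (\<Sum>m<2. (F m \<theta> / fact m) * (\<theta> + \<delta> - \<theta>) ^ m) + (F 2 t / fact 2) * (\<theta> + \<delta> - \<theta>) ^ 2" by blast
    have t: "\<bar>t - \<theta>\<bar> < d" "V (\<theta> + \<delta>) = V \<theta> + V1 \<theta> * \<delta> + V2 t / 2 * \<delta>\<^sup>2"
      using tt(1) \<delta> d(1) False tt(2) by (auto simp: F_def numeral_2_eq_2 split: if_splits)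
    have "V2 t \<le> M" using d(2)[of t] t(1) by (auto simp: dist_real_def)
    then have "V2 t / 2 * \<delta>\<^sup>2 \<le> M / 2 * \<delta>\<^sup>2" by (intro mult_right_mono) auto
    then show ?thesis using t(2) by simp
  qed simp
  then show ?thesis using that[of "d / 2"] d(1) by auto
qed

text \<open>In the application \<open>a\<close> is the first variation and \<open>b\<close> half the
  second. A nonzero \<open>a\<close> decides with the right sign of \<epsilon>; otherwise the
  negative quadratic term beats the cubic error.\<close>

lemma small_parameter_negative:
  fixes a b k d :: real
  assumes "a \<noteq> 0 \<or> b < 0" "d > 0" "k \<ge> 0"
  obtains \<epsilon> where "\<bar>\<epsilon>\<bar> \<le> d" "\<bar>\<epsilon>\<bar> \<le> 1" "\<epsilon> * a + \<epsilon>\<^sup>2 * b + \<bar>\<epsilon>\<bar> ^ 3 * k < 0"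
proof (cases "a = 0")
  case True
  then have b: "b < 0" using assms by auto
  define \<epsilon> where "\<epsilon> = min (min d 1) (- b / (2 * (k + 1)))"
  have e: "0 < \<epsilon>" "\<epsilon> \<le> d" "\<epsilon> \<le> 1" "\<epsilon> \<le> - b / (2 * (k + 1))"
    using assms b by (auto simp: \<epsilon>_def divide_pos_pos divide_neg_pos)
  have "0 < 2 * (k + 1)" using assms(3) by simp
  from e(4)[unfolded pos_le_divide_eq[OF this]] have "\<epsilon> * (2 * (k + 1)) \<le> - b" .
  moreover have "\<epsilon> * (2 * (k + 1)) = 2 * (\<epsilon> * k) + 2 * \<epsilon>" by (simp add: algebra_simps)
  moreover have "0 \<le> \<epsilon> * k" using e(1) assms(3) by simp
  ultimately have "\<epsilon> * k < - b" using e(1) by linarith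
  then have "b + \<epsilon> * k < 0" by simp
  then have "\<epsilon>\<^sup>2 * (b + \<epsilon> * k) < 0" using e(1) by (intro mult_pos_neg) auto
  then have "\<epsilon> * a + \<epsilon>\<^sup>2 * b + \<bar>\<epsilon>\<bar> ^ 3 * k < 0"
    using True e(1) by (simp add: power2_eq_square power3_eq_cube algebra_simps)
  then show ?thesis using that[of \<epsilon>] e by auto
next
  case False
  define e where "e = min (min d 1) (\<bar>a\<bar> / (2 * (\<bar>b\<bar> + k + 1)))"
  have e: "0 < e" "e \<le> d" "e \<le> 1" "e \<le> \<bar>a\<bar> / (2 * (\<bar>b\<bar> + k + 1))"
    using assms False by (auto simp: e_def)
  define \<epsilon> where "\<epsilon> = - sgn a * e"
  have ab: "\<bar>\<epsilon>\<bar> = e" "\<epsilon> * a = - (e * \<bar>a\<bar>)" "\<epsilon>\<^sup>2 = e\<^sup>2"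
    using False e(1) by (auto simp: \<epsilon>_def abs_mult sgn_real_def power_mult_distrib)
  have "e * (\<bar>b\<bar> + k + 1) \<le> \<bar>a\<bar> / 2"
  proof -
    have "0 < 2 * (\<bar>b\<bar> + k + 1)" using assms(3) by simp
    from e(4)[unfolded pos_le_divide_eq[OF this]] show ?thesis by (simp add: algebra_simps)
  qed
  moreover have "e * b \<le> e * \<bar>b\<bar>" using e(1) by simp
  moreover have "e\<^sup>2 * k \<le> e * k"
    unfolding power2_eq_square using e assms(3) by (intro mult_right_mono mult_left_le) auto
  moreover have "e * (\<bar>b\<bar> + k + 1) = e * \<bar>b\<bar> + e * k + e" by (simp add: algebra_simps)
  moreover have "\<bar>a\<bar> > 0" using False by simp
  ultimately have "e * b + e\<^sup>2 * k < \<bar>a\<bar>" using e(1) by linarith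
  then have "e * (e * b + e\<^sup>2 * k - \<bar>a\<bar>) < 0" using e(1) by (intro mult_pos_neg) auto
  then have "\<epsilon> * a + \<epsilon>\<^sup>2 * b + \<bar>\<epsilon>\<bar> ^ 3 * k < 0"
    unfolding ab by (simp add: power2_eq_square power3_eq_cube algebra_simps)
  then show ?thesis using that[of \<epsilon>] e ab(1) by auto
qed

section \<open>Second variation of the angular weight\<close>

context equal_singular_value_map
begin

definition Q :: "real \<Rightarrow> real" where
  "Q t = (cos t)\<^sup>2 + \<mu>\<^sup>2 * (sin t)\<^sup>2"

lemma Q_pos: "cos t > 0 \<Longrightarrow> Q t > 0"
  unfolding Q_def by (intro add_pos_nonneg) auto

text \<open>Since p is even the root disappears, and n - p = 1 leaves a single cosine, so near
  \<theta> the weight is a trigonometric polynomial. The cases (3,2) and (5,4) are l = 0 and l =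
  1.\<close>

lemma W_eq:
  assumes "n = 2 * l + 3" "p = 2 * l + 2" "cos t > 0"
  shows "W t = Q t ^ Suc l * cos t"
proof -
  have "p = 2 * Suc l" using assms(2) by simp
  then have "sqrt (Q t) ^ p = (sqrt (Q t) ^ 2) ^ Suc l" by (simp only: power_mult)
  also have "\<dots> = Q t ^ Suc l" using Q_pos[OF assms(3)] by simp
  finally have e: "sqrt (Q t) ^ p = Q t ^ Suc l" .
  have "n - p = 1" using assms(1,2) by simp
  then show ?thesis using assms(3) unfolding W_def Q_def[symmetric] e by simp
qed

lemma Q_derivative: "(Q has_real_derivative 2 * (\<mu>\<^sup>2 - 1) * sin t * cos t) (at t)"
  unfolding Q_def[abs_def] by (auto intro!: derivative_eq_intros simp: algebra_simps)

text \<open>The factor of W' that can vanish: on (0, pi/2) the sine and the power of Q are positive,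
  so its zeros are the critical angles.\<close>

definition critP :: "nat \<Rightarrow> real \<Rightarrow> real" where
  "critP l t = 2 * (real l + 1) * (\<mu>\<^sup>2 - 1) * (cos t)\<^sup>2 - Q t"

definition dW :: "nat \<Rightarrow> real \<Rightarrow> real" where
  "dW l t = sin t * Q t ^ l * critP l t"

text \<open>At \<open>l = 0\<close> the truncated exponent \<open>l - Suc 0\<close> does no harm,
  because that term carries the factor \<open>real l\<close>.\<close>

definition ddW :: "nat \<Rightarrow> real \<Rightarrow> real" where
  "ddW l t = (sin t * (real l * (2 * (\<mu>\<^sup>2 - 1) * sin t * cos t * Q t ^ (l - Suc 0))) + cos t * Q t ^ l) * critP l t
     + sin t * Q t ^ l * (- 2 * (2 * real l + 3) * (\<mu>\<^sup>2 - 1) * sin t * cos t)"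

lemma W_derivatives:
  "((\<lambda>t. Q t ^ Suc l * cos t) has_real_derivative dW l t) (at t)"
  "(dW l has_real_derivative ddW l t) (at t)"
  "isCont (ddW l) t"
proof -
  show "((\<lambda>t. Q t ^ Suc l * cos t) has_real_derivative dW l t) (at t)"
    by (rule DERIV_cong[OF DERIV_mult[OF DERIV_power_Suc[OF Q_derivative] DERIV_cos]])
      (simp add: dW_def critP_def power2_eq_square algebra_simps)
  have c: "(critP l has_real_derivative (- 2 * (2 * real l + 3) * (\<mu>\<^sup>2 - 1) * sin t * cos t)) (at t)"
    unfolding critP_def[abs_def]
    by (rule DERIV_cong[OF DERIV_diff[OF _ Q_derivative]])
      (auto intro!: derivative_eq_intros simp: algebra_simps)
  show "(dW l has_real_derivative ddW l t) (at t)"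
    unfolding dW_def[abs_def]
    by (rule DERIV_cong[OF DERIV_mult[OF DERIV_mult[OF DERIV_sin DERIV_power[OF Q_derivative]] c]])
      (simp add: ddW_def algebra_simps)
  show "isCont (ddW l) t"
    unfolding ddW_def[abs_def] critP_def Q_def by (intro continuous_intros)
qed

text \<open>At a critical angle the second variation of the area beats the Hardy constant
  \<open>((n + 1) / 2)\<^sup>2 = (l + 2)\<^sup>2\<close>.\<close>

lemma unstable_angle:
  assumes \<theta>: "0 < \<theta>" "\<theta> < pi / 2" and q: "\<mu>\<^sup>2 > 1"
    and inst: "(real l + 2)\<^sup>2 * (real l + 1) * \<mu>\<^sup>2 < (2 * real l + 3) * (2 * (real l + 1) * (\<mu>\<^sup>2 - 1) - 1)"
    and crit: "dW l \<theta> = 0"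
  shows "ddW l \<theta> + (real l + 2)\<^sup>2 * (Q \<theta> ^ Suc l * cos \<theta>) < 0"
proof -
  have C: "cos \<theta> > 0" using \<theta> by (intro cos_gt_zero) auto
  have S: "sin \<theta> > 0" using \<theta> by (intro sin_gt_zero) auto
  have Q: "Q \<theta> > 0" by (rule Q_pos[OF C])
  let ?q = "\<mu>\<^sup>2" and ?C = "(cos \<theta>)\<^sup>2" and ?S = "(sin \<theta>)\<^sup>2"
  have P: "critP l \<theta> = 0" using crit S Q by (simp add: dW_def)
  then have Qe: "Q \<theta> = 2 * (real l + 1) * (?q - 1) * ?C" by (simp add: critP_def)
  have C2: "?C > 0" using C by simp
  \<comment> \<open>The critical equation fixes the squared tangent of \<theta> in terms of \<mu>;
    this is what makes the hypothesis \<open>inst\<close> equivalent to an inequality between the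
    squared sine and cosine.\<close>
  have qS: "?q * ?S = (2 * (real l + 1) * (?q - 1) - 1) * ?C"
    using Qe by (simp add: Q_def algebra_simps)
  have "?q * ((real l + 2)\<^sup>2 * (real l + 1) * ?C) = ((real l + 2)\<^sup>2 * (real l + 1) * ?q) * ?C" by simp
  also have "\<dots> < ((2 * real l + 3) * (2 * (real l + 1) * (?q - 1) - 1)) * ?C"
    by (rule mult_strict_right_mono[OF inst C2])
  also have "\<dots> = (2 * real l + 3) * (?q * ?S)" unfolding qS by simp
  also have "\<dots> = ?q * ((2 * real l + 3) * ?S)" by simp
  finally have "(real l + 2)\<^sup>2 * (real l + 1) * ?C < (2 * real l + 3) * ?S"
    using q by (subst (asm) mult_less_cancel_left_pos) auto
  then have less: "2 * (?q - 1) * ((real l + 2)\<^sup>2 * (real l + 1) * ?C) < 2 * (?q - 1) * ((2 * real l + 3) * ?S)"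
    using q by (intro mult_strict_left_mono) auto
  have neg: "(real l + 2)\<^sup>2 * Q \<theta> - 2 * (2 * real l + 3) * (?q - 1) * ?S < 0"
  proof -
    have "(real l + 2)\<^sup>2 * (2 * (real l + 1) * (?q - 1) * ?C) = 2 * (?q - 1) * ((real l + 2)\<^sup>2 * (real l + 1) * ?C)"
      "2 * (2 * real l + 3) * (?q - 1) * ?S = 2 * (?q - 1) * ((2 * real l + 3) * ?S)"
      by (simp_all only: mult_ac)
    then show ?thesis using less unfolding Qe by linarith
  qed
  \<comment> \<open>At a critical angle only the derivative of \<open>critP\<close> contributes to
    the second derivative of W.\<close>
  have "ddW l \<theta> + (real l + 2)\<^sup>2 * (Q \<theta> ^ Suc l * cos \<theta>)
      = (cos \<theta> * Q \<theta> ^ l) * ((real l + 2)\<^sup>2 * Q \<theta> - 2 * (2 * real l + 3) * (?q - 1) * ?S)"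
    unfolding ddW_def P by (simp add: power2_eq_square algebra_simps)
  also have "\<dots> < 0" using neg C Q by (intro mult_pos_neg) auto
  finally show ?thesis .
qed

text \<open>For \<phi> = \<theta> + \<epsilon> u the area exceeds that of the cone by at most
  \<epsilon> W'(\<theta>) I1 + \<epsilon>^2 I2 / 2 + |\<epsilon>|^3 K B, where I1 > 0, and I2 < 0
  whenever W'(\<theta>) = 0.\<close>

theorem better_profile_exists:
  assumes np: "n = 2 * l + 3" "p = 2 * l + 2"
    and \<theta>: "0 < \<theta>" "\<theta> < pi / 2" and q: "\<mu>\<^sup>2 > 1" and R: "R > 0"
    and inst: "(real l + 2)\<^sup>2 * (real l + 1) * \<mu>\<^sup>2 < (2 * real l + 3) * (2 * (real l + 1) * (\<mu>\<^sup>2 - 1) - 1)"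
  obtains \<phi> where "smooth_on UNIV \<phi>" "\<And>r. r \<ge> R \<Longrightarrow> \<phi> r = \<theta>" "\<And>r. r \<le> 0 \<Longrightarrow> \<phi> r = \<theta>"
    "(\<integral>x. indicator (cball (0::'a) R) x *\<^sub>R area_density \<phi> (norm x) \<partial>lborel)
      < W \<theta> * measure lborel (cball (0::'a) R)"
proof -
  have C: "cos \<theta> > 0" using \<theta> by (intro cos_gt_zero) auto
  define V where "V = (\<lambda>t. Q t ^ Suc l * cos t)"
  have V\<theta>: "V \<theta> > 0" using C Q_pos[OF C] by (simp add: V_def)
  have W\<theta>: "W \<theta> = V \<theta>" unfolding V_def by (rule W_eq[OF np C])
  \<comment> \<open>c = (n + 1) / 2, so that the weight r^(2c-1) is the radial density r^n.\<close>
  define c where "c = l + 2"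
  have c: "c \<ge> 1" "2 * c - 1 = DIM('a) - 1" "real c = real l + 2" using np dim by (auto simp: c_def)
  define H where "H = - (real c)\<^sup>2 * V \<theta>"
  \<comment> \<open>\<open>M\<close> must exceed W''(\<theta>) for the Taylor bound. At a critical
    angle it is also kept below the Hardy threshold \<open>H\<close>; otherwise \<open>M0\<close>
    below \<open>H\<close> merely secures a test function with positive integral.\<close>
  define M where "M = (if dW l \<theta> = 0 then (ddW l \<theta> + H) / 2 else ddW l \<theta> + 1)"
  define M0 where "M0 = (if dW l \<theta> = 0 then M else H - 1)"
  have "ddW l \<theta> < H" if "dW l \<theta> = 0"
    using unstable_angle[OF \<theta> q inst that] by (simp add: H_def V_def c(3))
  then have M: "ddW l \<theta> < M" "M0 < H" by (auto simp: M_def M0_def)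
  then have M0: "M0 + (real c)\<^sup>2 * V \<theta> < 0" by (simp add: H_def)
  obtain u a where u: "smooth_on UNIV u" "0 < a" "a < R" "\<And>r. r \<le> a \<Longrightarrow> u r = 0" "\<And>r. r \<ge> R \<Longrightarrow> u r = 0"
    "(\<integral>r. r ^ (2 * c - 1) * u r * indicator {a..R} r \<partial>lborel) > 0"
    "(\<integral>r. r ^ (2 * c - 1) * (M0 * (u r)\<^sup>2 + V \<theta> * (r * deriv u r)\<^sup>2) * indicator {a..R} r \<partial>lborel) < 0"
    using that by (rule hardy_test_function[OF R V\<theta> c(1) M0])
  obtain N where N: "N \<ge> 0" "\<And>t. \<bar>deriv u t\<bar> \<le> N" "\<And>t. deriv u t \<noteq> 0 \<Longrightarrow> a \<le> t \<and> t \<le> R"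
    using bounded_deriv_of_compact_variation[OF u(1,4,5)] by blast
  define w where "w r = (r * deriv u r)\<^sup>2" for r
  define X where "X = (R * N)\<^sup>2"
  have w: "0 \<le> w r" "w r \<le> X" for r
  proof -
    show "w r \<le> X"
    proof (cases "deriv u r = 0")
      case False
      then have "\<bar>r * deriv u r\<bar> \<le> R * N" unfolding abs_mult using N(2,3) u(2) by (intro mult_mono) force+
      then have "\<bar>r * deriv u r\<bar>\<^sup>2 \<le> X" unfolding X_def by (intro power_mono) auto
      then show ?thesis by (simp add: w_def)
    qed (simp add: w_def X_def)
  qed (simp add: w_def)
  obtain U where U: "U \<ge> 0" "\<And>r. \<bar>u r\<bar> \<le> U"
  proof -
    have "bounded (u ` {a..R})"
      by (intro compact_imp_bounded compact_continuous_image continuous_on_subset[OF smooth_on_continuous[OF u(1)]]) auto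
    then obtain B where B: "\<forall>r\<in>{a..R}. \<bar>u r\<bar> \<le> B" by (auto simp: bounded_iff)
    have "\<bar>u r\<bar> \<le> \<bar>B\<bar>" for r
    proof (cases "r \<in> {a..R}")
      case True
      then have "\<bar>u r\<bar> \<le> B" using B by blast
      then show ?thesis by linarith
    qed (use u(4)[of r] u(5)[of r] in auto)
    then show ?thesis using that[of "\<bar>B\<bar>"] by auto
  qed
  obtain d where d: "d > 0" "\<And>\<delta>. \<bar>\<delta>\<bar> \<le> d \<Longrightarrow> V (\<theta> + \<delta>) \<le> V \<theta> + dW l \<theta> * \<delta> + M / 2 * \<delta>\<^sup>2"
    using second_order_upper_bound[OF W_derivatives(1)[of l] W_derivatives(2)[of l] W_derivatives(3) M(1)]
    unfolding V_def by metis
  \<comment> \<open>Keeps the perturbed angle inside (0, pi/2), where W is given by the smooth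
    function V.\<close>
  define d' where "d' = min d (min \<theta> (pi / 2 - \<theta>) / 2)"
  have d': "d' > 0" "d' \<le> d" "d' < \<theta>" "d' < pi / 2 - \<theta>" using d(1) \<theta> by (auto simp: d'_def min_def field_simps)
  define f2 where "f2 r = M * (u r)\<^sup>2 + V \<theta> * w r" for r
  define B where "B = measure lborel (cball (0::'a) R)"
  define I1 where "I1 = (\<integral>x. u (norm (x::'a)) \<partial>lborel)"
  define I2 where "I2 = (\<integral>x. f2 (norm (x::'a)) \<partial>lborel)"
  have contu: "continuous_on UNIV u" by (rule smooth_on_continuous[OF u(1)])
  have contf: "continuous_on UNIV f2"
    unfolding f2_def w_def by (intro continuous_intros contu smooth_real_derivative(2)[OF u(1)])
  have z: "u r = 0 \<and> f2 r = 0" if "r < a \<or> r > R" for r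
  proof -
    have "u r = 0" using that u(4)[of r] u(5)[of r] by auto
    moreover have "deriv u r = 0" using N(3)[of r] that by fastforce
    ultimately show ?thesis by (simp add: f2_def w_def)
  qed
  have K0: "unit_ball_vol (real DIM('a)) * real DIM('a) > 0" by simp
  have I1: "I1 > 0"
  proof -
    have "I1 = unit_ball_vol (real DIM('a)) * real DIM('a) * (\<integral>r. r ^ (DIM('a) - 1) * u r * indicator {a..R} r \<partial>lborel)"
      unfolding I1_def by (rule radial_integral[OF borel_measurable_continuous_onI[OF contu] u(2)]) (use z in auto)
    then show ?thesis using mult_pos_pos[OF K0 u(6)[unfolded c(2)]] by (simp only:)
  qed
  have I2: "I2 < 0" if "dW l \<theta> = 0"
  proof -
    have "M0 = M" using that by (simp add: M0_def)
    then have "(\<integral>r. r ^ (DIM('a) - 1) * f2 r * indicator {a..R} r \<partial>lborel) < 0"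
      using u(7) by (simp only: f2_def w_def c(2))
    moreover have "I2 = unit_ball_vol (real DIM('a)) * real DIM('a) * (\<integral>r. r ^ (DIM('a) - 1) * f2 r * indicator {a..R} r \<partial>lborel)"
      unfolding I2_def by (rule radial_integral[OF borel_measurable_continuous_onI[OF contf] u(2)]) (use z in auto)
    ultimately show ?thesis using mult_pos_neg[OF K0] by (simp only:)
  qed
  have int: "integrable lborel (\<lambda>x::'a. G (norm x))" if "continuous_on UNIV G" "\<And>r. r > R \<Longrightarrow> G r = 0" for G :: "real \<Rightarrow> real"
  proof -
    have "continuous_on (cball 0 R) (\<lambda>x::'a. G (norm x))"
      by (rule continuous_on_compose2[OF that(1)]) (auto intro: continuous_intros)
    then have "integrable lborel (\<lambda>x::'a. indicator (cball 0 R) x *\<^sub>R G (norm x))"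
      by (rule borel_integrable_compact[OF compact_cball])
    moreover have "(\<lambda>x::'a. indicator (cball 0 R) x *\<^sub>R G (norm x)) = (\<lambda>x. G (norm x))"
      using that(2) by (auto simp: indicator_def fun_eq_iff)
    ultimately show ?thesis by simp
  qed
  \<comment> \<open>Bounds the mixed products of the angular expansion with half of (r \<phi>')^2;
    as |\<epsilon>| \<le> 1, the fourth-order product counts as cubic.\<close>
  define K where "K = \<bar>dW l \<theta>\<bar> * U * X / 2 + \<bar>M\<bar> * U\<^sup>2 * X / 4"
  have X0: "X \<ge> 0" by (simp add: X_def)
  have K: "K \<ge> 0" unfolding K_def using U(1) X0 by (intro add_nonneg_nonneg) auto
  have "dW l \<theta> * I1 \<noteq> 0 \<or> I2 / 2 < 0" using I1 I2 by auto
  moreover have "d' / (U + 1) > 0" using d'(1) U(1) by simp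
  moreover have "K * B \<ge> 0" using K by (simp add: B_def)
  ultimately obtain \<epsilon> where \<epsilon>: "\<bar>\<epsilon>\<bar> \<le> d' / (U + 1)" "\<bar>\<epsilon>\<bar> \<le> 1"
    "\<epsilon> * (dW l \<theta> * I1) + \<epsilon>\<^sup>2 * (I2 / 2) + \<bar>\<epsilon>\<bar> ^ 3 * (K * B) < 0"
    by (rule small_parameter_negative)
  define \<phi> where "\<phi> r = \<theta> + \<epsilon> * u r" for r
  have s\<phi>: "smooth_on UNIV \<phi>" unfolding \<phi>_def[abs_def]
    by (intro smooth_on_add smooth_on_mult smooth_on_const open_UNIV u(1))
  have d\<phi>: "deriv \<phi> r = \<epsilon> * deriv u r" for r
    unfolding \<phi>_def[abs_def]
    by (rule DERIV_imp_deriv, rule DERIV_cong[OF DERIV_add[OF DERIV_const DERIV_cmult[OF smooth_real_derivative(1)[OF u(1)]]]]) simp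
  have bound: "area_density \<phi> r \<le> V \<theta> + \<epsilon> * (dW l \<theta> * u r) + \<epsilon>\<^sup>2 / 2 * f2 r + \<bar>\<epsilon>\<bar> ^ 3 * K" for r
  proof -
    let ?\<delta> = "\<epsilon> * u r" and ?y = "\<epsilon>\<^sup>2 * w r"
    have "\<bar>?\<delta>\<bar> \<le> d' / (U + 1) * U"
      unfolding abs_mult by (rule mult_mono[OF \<epsilon>(1) U(2)]) (use d'(1) U(1) in auto)
    also have "\<dots> \<le> d'" using d'(1) U(1) by (simp add: field_simps)
    finally have \<delta>: "\<bar>?\<delta>\<bar> \<le> d'" .
    then have "cos (\<theta> + ?\<delta>) > 0" using d' by (intro cos_gt_zero_pi) linarith+
    then have We: "W (\<phi> r) = V (\<theta> + ?\<delta>)" unfolding V_def \<phi>_def by (rule W_eq[OF np])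
    have Vle: "V (\<theta> + ?\<delta>) \<le> V \<theta> + dW l \<theta> * ?\<delta> + M / 2 * ?\<delta>\<^sup>2" using \<delta> d'(2) by (intro d(2)) linarith
    have Vnn: "0 \<le> V (\<theta> + ?\<delta>)" using W_le(2)[of "\<phi> r"] We by simp
    have y0: "0 \<le> ?y" using w(1) by simp
    \<comment> \<open>An upper bound for the root suffices, and it is exact to the order in
      \<epsilon> that matters.\<close>
    have "sqrt (1 + y) \<le> 1 + y / 2" if "0 \<le> y" for y :: real
      by (rule real_le_lsqrt) (use that in \<open>auto simp: power2_eq_square algebra_simps\<close>)
    from this[OF y0]
    have "sqrt (1 + ?y) * V (\<theta> + ?\<delta>) \<le> (1 + ?y / 2) * V (\<theta> + ?\<delta>)" by (rule mult_right_mono[OF _ Vnn])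
    also have "\<dots> \<le> (1 + ?y / 2) * (V \<theta> + dW l \<theta> * ?\<delta> + M / 2 * ?\<delta>\<^sup>2)"
      by (rule mult_left_mono[OF Vle]) (use y0 in simp)
    also have "\<dots> = V \<theta> + \<epsilon> * (dW l \<theta> * u r) + \<epsilon>\<^sup>2 / 2 * f2 r + (\<epsilon> ^ 3 * (dW l \<theta> * u r * w r / 2) + \<epsilon> ^ 4 * (M * (u r)\<^sup>2 * w r / 4))"
      by (simp add: f2_def power2_eq_square power3_eq_cube power4_eq_xxxx field_simps)
    also have "\<epsilon> ^ 3 * (dW l \<theta> * u r * w r / 2) + \<epsilon> ^ 4 * (M * (u r)\<^sup>2 * w r / 4) \<le> \<bar>\<epsilon>\<bar> ^ 3 * K"
    proof -
      have abs: "\<epsilon> ^ m * x \<le> \<bar>\<epsilon>\<bar> ^ m * \<bar>x\<bar>" for m x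
        using abs_ge_self[of "\<epsilon> ^ m * x"] by (simp only: abs_mult power_abs)
      have 1: "\<bar>dW l \<theta> * u r * w r / 2\<bar> \<le> \<bar>dW l \<theta>\<bar> * U * X / 2"
        using w[of r] U U(2)[of r] by (auto simp: abs_mult intro!: mult_mono)
      have "(u r)\<^sup>2 \<le> U\<^sup>2" using U(2)[of r] U(1) by (simp add: abs_le_square_iff[symmetric])
      then have 2: "\<bar>M * (u r)\<^sup>2 * w r / 4\<bar> \<le> \<bar>M\<bar> * U\<^sup>2 * X / 4"
        using w[of r] by (auto simp: abs_mult intro!: mult_mono)
      have "\<epsilon> ^ 3 * (dW l \<theta> * u r * w r / 2) \<le> \<bar>\<epsilon>\<bar> ^ 3 * (\<bar>dW l \<theta>\<bar> * U * X / 2)"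
        by (rule order_trans[OF abs mult_left_mono[OF 1]]) simp
      moreover have "\<epsilon> ^ 4 * (M * (u r)\<^sup>2 * w r / 4) \<le> \<bar>\<epsilon>\<bar> ^ 3 * (\<bar>M\<bar> * U\<^sup>2 * X / 4)"
      proof -
        have "\<epsilon> ^ 4 * (M * (u r)\<^sup>2 * w r / 4) \<le> \<bar>\<epsilon>\<bar> ^ 4 * \<bar>M * (u r)\<^sup>2 * w r / 4\<bar>"
          by (rule abs)
        also have "\<dots> \<le> \<bar>\<epsilon>\<bar> ^ 3 * (\<bar>M\<bar> * U\<^sup>2 * X / 4)"
          by (rule mult_mono[OF power_decreasing 2]) (use \<epsilon>(2) in auto)
        finally show ?thesis .
      qed
      ultimately show ?thesis unfolding K_def by (simp only: distrib_left)
    qed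
    finally have "sqrt (1 + ?y) * V (\<theta> + ?\<delta>) \<le> V \<theta> + \<epsilon> * (dW l \<theta> * u r) + \<epsilon>\<^sup>2 / 2 * f2 r + \<bar>\<epsilon>\<bar> ^ 3 * K" by simp
    moreover have "(r * deriv \<phi> r)\<^sup>2 = ?y" by (simp add: d\<phi> w_def power_mult_distrib)
    ultimately show ?thesis by (simp add: area_density_def We)
  qed
  let ?g = "\<lambda>x::'a. indicator (cball 0 R) x *\<^sub>R (V \<theta> + \<bar>\<epsilon>\<bar> ^ 3 * K) + (\<epsilon> * dW l \<theta>) * u (norm x) + (\<epsilon>\<^sup>2 / 2) * f2 (norm x)"
  have iu: "integrable lborel (\<lambda>x::'a. u (norm x))" "integrable lborel (\<lambda>x::'a. f2 (norm x))"
    by (rule int[OF contu], use z in simp, rule int[OF contf], use z in simp)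
  have ic: "integrable lborel (\<lambda>x. indicator (cball (0::'a) R) x *\<^sub>R k)" for k :: real
    using emeasure_bounded_finite[OF bounded_cball, of "0::'a" R] by (intro integrable_scaleR_left integrable_real_indicator) auto
  have ig: "integrable lborel ?g"
    by (rule Bochner_Integration.integrable_add[OF Bochner_Integration.integrable_add[OF ic
          integrable_mult_right[OF iu(1)]] integrable_mult_right[OF iu(2)]])
  have ia: "integrable lborel (\<lambda>x::'a. indicator (cball 0 R) x *\<^sub>R area_density \<phi> (norm x))"
  proof (rule borel_integrable_compact[OF compact_cball])
    have "continuous_on UNIV (area_density \<phi>)"
      unfolding area_density_def[abs_def]
      by (intro continuous_intros smooth_real_derivative(2)[OF s\<phi>] continuous_on_compose2[OF continuous_W smooth_on_continuous[OF s\<phi>]]) auto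
    then show "continuous_on (cball 0 R) (\<lambda>x::'a. area_density \<phi> (norm x))"
      by (rule continuous_on_compose2) (auto intro: continuous_intros)
  qed
  have "(\<integral>x. indicator (cball (0::'a) R) x *\<^sub>R area_density \<phi> (norm x) \<partial>lborel) \<le> (\<integral>x. ?g x \<partial>lborel)"
  proof (rule integral_mono[OF ia ig])
    fix x :: 'a
    show "indicator (cball 0 R) x *\<^sub>R area_density \<phi> (norm x) \<le> ?g x"
      using bound[of "norm x"] z[of "norm x"] by (auto simp: indicator_def mult.assoc)
  qed
  also have "(\<integral>x. ?g x \<partial>lborel) = (\<integral>x. indicator (cball (0::'a) R) x *\<^sub>R (V \<theta> + \<bar>\<epsilon>\<bar> ^ 3 * K) \<partial>lborel)
      + (\<integral>x. (\<epsilon> * dW l \<theta>) * u (norm (x::'a)) \<partial>lborel) + (\<integral>x. (\<epsilon>\<^sup>2 / 2) * f2 (norm (x::'a)) \<partial>lborel)"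
    by (subst Bochner_Integration.integral_add[OF Bochner_Integration.integrable_add[OF ic
          integrable_mult_right[OF iu(1)]] integrable_mult_right[OF iu(2)]],
        subst Bochner_Integration.integral_add[OF ic integrable_mult_right[OF iu(1)]]) (rule refl)
  also have "\<dots> = (V \<theta> + \<bar>\<epsilon>\<bar> ^ 3 * K) * B + (\<epsilon> * dW l \<theta>) * I1 + (\<epsilon>\<^sup>2 / 2) * I2"
  proof -
    have "(\<integral>x. indicator (cball (0::'a) R) x *\<^sub>R k \<partial>lborel) = k * B" for k :: real
      by (simp add: B_def mult.commute)
    then show ?thesis by (simp only: integral_mult_right_zero I1_def I2_def)
  qed
  also have "\<dots> < V \<theta> * B" using \<epsilon>(3) by (simp add: algebra_simps)
  finally have "(\<integral>x. indicator (cball (0::'a) R) x *\<^sub>R area_density \<phi> (norm x) \<partial>lborel) < W \<theta> * B"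
    by (simp only: W\<theta>)
  then show ?thesis
    using that[of \<phi>] s\<phi> u(2,4,5) unfolding B_def by (simp add: \<phi>_def)
qed

theorem not_area_minimizing:
  assumes np: "n = 2 * l + 3" "p = 2 * l + 2"
    and \<theta>: "0 < \<theta>" "\<theta> < pi / 2" and q: "\<mu>\<^sup>2 > 1"
    and inst: "(real l + 2)\<^sup>2 * (real l + 1) * \<mu>\<^sup>2 < (2 * real l + 3) * (2 * (real l + 1) * (\<mu>\<^sup>2 - 1) - 1)"
  shows "\<not> area_minimizing_cone (LO_cone_param f \<theta>)"
proof
  assume min: "area_minimizing_cone (LO_cone_param f \<theta>)"
  \<comment> \<open>One radius refutes the property. It must be below 1/2, so that the ball lies
    inside the cube, and at most 1, where the calibrating forms are not cut off.\<close>
  let ?R = "1 / 4 :: real" and ?T = "truncated_cone (LO_cone_param f \<theta>) (1 / 4)"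
  let ?B = "measure lborel (cball (0::'a) ?R)"
  obtain \<phi> where \<phi>: "smooth_on UNIV \<phi>" "\<And>r. r \<ge> ?R \<Longrightarrow> \<phi> r = \<theta>" "\<And>r. r \<le> 0 \<Longrightarrow> \<phi> r = \<theta>"
    "(\<integral>x. indicator (cball (0::'a) ?R) x *\<^sub>R area_density \<phi> (norm x) \<partial>lborel) < W \<theta> * ?B"
    by (rule better_profile_exists[OF np \<theta> q _ inst, of ?R]) auto
  then obtain c where c: "(\<integral>x. indicator (cball (0::'a) ?R) x *\<^sub>R area_density \<phi> (norm x) \<partial>lborel) < c" "c < W \<theta> * ?B"
    using dense by blast
  have R: "0 < ?R" "?R < 1 / 2" by simp_all
  obtain S where S: "integral_current DIM('a) S" "eq_current n (boundary S) (boundary ?T)" "mass DIM('a) S \<le> ereal c"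
    using comparison_currents[OF R \<phi>(1-3) c(1)] by blast
  have "DIM('a) - 1 = n" using dim by simp
  then have "mass DIM('a) ?T \<le> mass DIM('a) S"
    using min S(1,2) R(1) unfolding area_minimizing_cone_def by simp
  then have "mass DIM('a) ?T \<le> ereal c" using S(3) by (rule order_trans)
  moreover have "ereal (W \<theta> * ?B) \<le> mass DIM('a) ?T" by (rule mass_truncated_cone_ge[OF \<theta>]) simp_all
  ultimately have "ereal (W \<theta> * ?B) \<le> ereal c" by (rule order_trans[rotated])
  then show False using c(2) by simp
qed

end

theorem corollary3p7:
  fixes f :: "'a::euclidean_space \<Rightarrow> 'b::euclidean_space"
    and n m p k :: nat and \<theta> :: real
  assumes "DIM('a) = n + 1" and "DIM('b) = m + 1"
    and "LOMSE_type n p k f"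
    and "(n = 3 \<and> p = 2 \<and> k \<ge> 4) \<or> (n = 5 \<and> p = 4 \<and> k \<ge> 6)"
    and "LO_angle f \<theta>"
  shows "\<not> area_minimizing_cone (LO_cone_param f \<theta>)"
proof -
  have f: "smooth_on_sphere f" "f ` sphere 0 1 \<subseteq> sphere 0 1"
    using assms(3) by (auto simp: LOMSE_type_def LOMSE_def LOM_def)
  have k: "k \<ge> 2" and harm: "\<And>b. b \<in> Basis \<Longrightarrow> spherical_harmonic k (\<lambda>x. f x \<bullet> b)"
    using assms(3) by (auto simp: LOMSE_type_def)
  obtain \<mu> where mu: "\<mu> > 0" "\<And>x. norm x = 1 \<Longrightarrow> singular_mult f x \<mu> = p"
    "\<And>x \<sigma>. norm x = 1 \<Longrightarrow> singular_value f x \<sigma> \<Longrightarrow> \<sigma> \<noteq> 0 \<Longrightarrow> \<sigma> = \<mu>"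
    using assms(3) unfolding LOMSE_type_def by auto
  have \<theta>: "0 < \<theta>" "\<theta> < pi / 2" using assms(5) by (auto simp: LO_angle_def)
  have frame: "\<exists>es. orthonormal es \<and> length es = n + 1 \<and> es ! 0 = x \<and> p \<le> n \<and>
      (\<forall>i<n. \<forall>j<n. sphere_deriv f x (es ! Suc i) \<bullet> sphere_deriv f x (es ! Suc j) =
        (if i = j \<and> i < p then \<mu>\<^sup>2 else 0))" if x: "norm x = 1" for x
  proof -
    have "x \<noteq> 0" using x by auto
    then have "linear (sphere_deriv f x)" by (rule sphere_deriv_linear[OF f(1)])
    then show ?thesis
    proof (rule adapted_frame[OF assms(1) x _ mu(1) mu(2)[OF x]])
      show "\<sigma> = \<mu>" if "singular_value f x \<sigma>" "\<sigma> \<noteq> 0" for \<sigma> by (rule mu(3)[OF x that])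
      fix es assume es: "orthonormal es" "length es = n + 1" "es ! 0 = x" "p \<le> n"
        "\<And>i j. i < n \<Longrightarrow> j < n \<Longrightarrow> sphere_deriv f x (es ! Suc i) \<bullet> sphere_deriv f x (es ! Suc j) =
          (if i = j \<and> i < p then \<mu>\<^sup>2 else 0)"
      show ?thesis by (intro exI[of _ es] conjI allI impI es)
    qed
  qed
  \<comment> \<open>As \<mu> and p are the same at all points, a single point gives the formula for
    \<mu>.\<close>
  obtain x :: 'a where x: "norm x = 1" using vector_choose_size[of 1] by auto
  obtain es where es: "orthonormal es" "length es = n + 1" "es ! 0 = x" "p \<le> n"
    "\<And>i j. i < n \<Longrightarrow> j < n \<Longrightarrow> sphere_deriv f x (es ! Suc i) \<bullet> sphere_deriv f x (es ! Suc j) =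
        (if i = j \<and> i < p then \<mu>\<^sup>2 else 0)"
    using frame[OF x] by blast
  interpret equal_singular_value_map f n p \<mu>
    by unfold_locales (use assms(1) f mu(1) es(4) frame in auto)
  have ev: "real p * \<mu>\<^sup>2 = real k * (real k + real n - 1)"
    by (rule eigenmap_singular_value[OF assms(1) f k _ x es(1-4)]) (erule harm, erule (1) es(5))
  from assms(4) show ?thesis
  proof
    assume *: "n = 3 \<and> p = 2 \<and> k \<ge> 4"
    then have "4 * 6 \<le> real k * (real k + 2)" by (intro mult_mono) auto
    moreover have "2 * \<mu>\<^sup>2 = real k * (real k + 2)" using ev * by (simp add: add.commute)
    ultimately have "\<mu>\<^sup>2 \<ge> 12" by linarith
    \<comment> \<open>For l = 0 the instability condition reads
      \<open>4 * \<mu>\<^sup>2 < 3 * (2 * \<mu>\<^sup>2 - 3)\<close>, that is \<mu>^2 > 9/2.\<close>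
    then show ?thesis using * \<theta> by (intro not_area_minimizing[of 0]) auto
  next
    assume *: "n = 5 \<and> p = 4 \<and> k \<ge> 6"
    then have "6 * 10 \<le> real k * (real k + 4)" by (intro mult_mono) auto
    moreover have "4 * \<mu>\<^sup>2 = real k * (real k + 4)" using ev * by (simp add: add.commute)
    ultimately have "\<mu>\<^sup>2 \<ge> 15" by linarith
    \<comment> \<open>For l = 1 the instability condition reads
      \<open>18 * \<mu>\<^sup>2 < 5 * (4 * \<mu>\<^sup>2 - 5)\<close>, that is \<mu>^2 > 25/2; the
      bound k \<ge> 6 gives 15.\<close>
    then show ?thesis using * \<theta> by (intro not_area_minimizing[of 1]) auto
  qed
qed

end
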